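(* Let $f$ be a function and let $\hat c_n$ be the likelihood-based empirical Bayes estimator. Suppose, with $D_n^L=D_{1,n}^L+D_{2,n}^L$: 1. $\sup_{c\in I_n}\frac{|R_{1,n}^L(c,f)|+|R_{2,n}^L(c)|}{D_n^L(c,f)}\to0$ and $\sup_{c\in I_n}\frac{|R_{3,n}(c,f)|+|R_{4,n}(c)|}{D_n^L(c,f)}\to0$ in $P_f$-probability; 2. $D_{2,n}^L(c)\asymp s_n^2(c)$ uniformly in $c\in I_n$. Then for any sequence $M_n\to\infty$, $$\Pi_{\hat c_n}\Bigl(w:\|\vec w_n-\vec f_n\|^2\ge M_n\inf_{c\in I_n}D_n^L(c,f)\,\Big|\,\vec Y_n\Bigr)\to0\quad\text{in }P_f\text{-probability}.$$ In particular, this is true if the polynomial, the product or the Sobolev-type eigenvalue condition (see context) holds.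
   Context: Setting. $\mathcal X$ is a set and for each $n$, $x_{1,n},\dots,x_{n,n}\in\mathcal X$ are known design points. For $f:\mathcal X\to\mathbb R$ write $\vec f_n=(f(x_{1,n}),\dots,f(x_{n,n}))^T$. Under $P_f$ one observes $\vec Y_n=\vec f_n+\vec\varepsilon_n$ with $\vec\varepsilon_n\sim\mathcal N_n(0,I)$. $W^1$ is a mean-zero Gaussian process on $\mathcal X$; given $c>0$ the prior for $f$ is the law of $\sqrt c\,W^1$. $U_n$ is the covariance matrix of $(W^1_{x_{1,n}},\dots,W^1_{x_{n,n}})$, with orthonormal eigenbasis $e_{1,n},\dots,e_{n,n}$ and eigenvalues $\lambda_{1,n},\dots,\lambda_{n,n}$; $f_{j,n}=\vec f_n^Te_{j,n}$, $Z_{j,n}=\vec\varepsilon_n^Te_{j,n}$ (i.i.d. standard normal); $\Sigma_{n,c}=I+cU_n$. $\Pi_c(\cdot\mid\vec Y_n)$ denotes the posterior given $c$, under which $\vec w_n\sim\mathcal N_n(\hat f_{n,c},I-\Sigma_{n,c}^{-1})$ with $\hat f_{n,c}=(I-\Sigma_{n,c}^{-1})\vec Y_n$; $\Pi_{\hat c_n}(\cdot\mid\vec Y_n)$ is the same with $c$ replaced by $\hat c_n$. $I_n=[\log n/n,n^{m-1}]$ for a fixed constant $m\ge1$ (the exponent in the eigenvalue condition when one is assumed). Likelihood-based estimator: $\hat c_n=\operatorname{argmin}_{c\in I_n}[\log\det\Sigma_{n,c}+\vec Y_n^T\Sigma_{n,c}^{-1}\vec Y_n]$. Functions: $D_{1,n}^L(c,f)=\sum_{j=1}^n\frac{f_{j,n}^2}{1+c\lambda_{j,n}}$,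 $D_{2,n}^L(c)=\sum_{j=1}^n\bigl[\log(1+c\lambda_{j,n})-\frac{c\lambda_{j,n}}{1+c\lambda_{j,n}}\bigr]$, $R_{1,n}^L(c,f)=2\sum_{j=1}^n\frac{Z_{j,n}f_{j,n}}{1+c\lambda_{j,n}}$, $R_{2,n}^L(c)=-\sum_{j=1}^n\frac{(Z_{j,n}^2-1)c\lambda_{j,n}}{1+c\lambda_{j,n}}$, $R_{3,n}(c,f)=-2\sum_{j=1}^n\frac{c\lambda_{j,n}Z_{j,n}f_{j,n}}{(1+c\lambda_{j,n})^2}$, $R_{4,n}(c)=\sum_{j=1}^n\frac{(c\lambda_{j,n})^2(Z_{j,n}^2-1)}{(1+c\lambda_{j,n})^2}$, $s_n^2(c)=\sum_{j=1}^n\frac{c\lambda_{j,n}}{1+c\lambda_{j,n}}$. Eigenvalue conditions. Polynomial: $\underline\delta n/j^m\le\lambda_{j,n}\le\overline\delta n/j^m$ for all $n$, $1\le j\le n$, with constants $0<\underline\delta\le\overline\delta<\infty$, $m\ge1$. Product: there are $n^2$ design points, the eigenvalues are indexed by $(i,j)\in\{1,\dots,n\}^2$ and $\lambda_{i,j,n}\asymp n^2/(i^mj^m)$, uniformly in $i,j$ and $n$. Sobolev-type: same with $\lambda_{i,j,n}\asymp n^2/(i^2+j^2)^m$. In the last two cases $m\ge1$ and everywhere $n$ is replaced by $n^2$ (in particular $I_n$ by $I_{n^2}$) and single sums by double sums. $a_n\asymp b_n$ uniformly means that $a_n/b_n$ is bounded away from $0$ and $\infty$ by the same constants over the domain, for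 large $n$.
   Formalization: The "in particular" part is stated for m>1 only; at m=1 it fails: for f=0 and λ_{j,n}=n/j, inf D_n^L is of order log n while the posterior spread s_n^2(c) is at least of order (log n)^2 on I_n. The main implication keeps m≥1. *)

theory Defs
  imports "HOL-Probability.Probability" "Jordan_Normal_Form.Gauss_Jordan_Elimination"
    "Jordan_Normal_Form.Char_Poly"
begin

text \<open>
  Conventions. The set of design values is the type \<open>'a\<close>. At stage \<open>n\<close> there are \<open>N n\<close> design
  points \<open>x n i\<close>, indexed by \<open>i < N n\<close>, and the eigenpairs are indexed by a finite set \<open>J n\<close> of
  cardinality \<open>N n\<close>; this covers both single (\<open>N n = n\<close>) and double (\<open>N n = n\<^sup>2\<close>) indexing.
  Definitions without the argument \<open>n\<close> refer to a single stage.
\<close>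

subsection \<open>Gaussian processes\<close>

definition normal_law :: "real \<Rightarrow> real \<Rightarrow> real measure" where
  "normal_law \<mu> \<sigma> = (if \<sigma> = 0 then return borel \<mu> else density lborel (normal_density \<mu> \<sigma>))"

definition gaussian_process :: "'w measure \<Rightarrow> ('a \<Rightarrow> 'w \<Rightarrow> real) \<Rightarrow> bool" where
  "gaussian_process Q W \<longleftrightarrow> prob_space Q \<and> (\<forall>t. W t \<in> borel_measurable Q) \<and>
     (\<forall>F a. finite F \<longrightarrow>
        (\<exists>\<mu> \<sigma>. 0 \<le> \<sigma> \<and> distr Q borel (\<lambda>\<omega>. \<Sum>t\<in>F. a t * W t \<omega>) = normal_law \<mu> \<sigma>))"

definition mean_zero_gaussian_process :: "'w measure \<Rightarrow> ('a \<Rightarrow> 'w \<Rightarrow> real) \<Rightarrow> bool" where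
  "mean_zero_gaussian_process Q W \<longleftrightarrow> gaussian_process Q W \<and> (\<forall>t. (\<integral>\<omega>. W t \<omega> \<partial>Q) = 0)"

definition covariance :: "'w measure \<Rightarrow> ('w \<Rightarrow> real) \<Rightarrow> ('w \<Rightarrow> real) \<Rightarrow> real" where
  "covariance Q X Y = (\<integral>\<omega>. (X \<omega> - (\<integral>\<omega>'. X \<omega>' \<partial>Q)) * (Y \<omega> - (\<integral>\<omega>'. Y \<omega>' \<partial>Q)) \<partial>Q)"

subsection \<open>Regression model, prior and posterior\<close>

definition design_vec :: "nat \<Rightarrow> (nat \<Rightarrow> 'a) \<Rightarrow> ('a \<Rightarrow> real) \<Rightarrow> real vec" where
  "design_vec N x f = Matrix.vec N (\<lambda>i. f (x i))"

definition cov_mat :: "'w measure \<Rightarrow> ('a \<Rightarrow> 'w \<Rightarrow> real) \<Rightarrow> nat \<Rightarrow> (nat \<Rightarrow> 'a) \<Rightarrow> real mat" where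
  "cov_mat Q W N x = Matrix.mat N N (\<lambda>(i, k). covariance Q (W (x i)) (W (x k)))"

definition Sigma_mat :: "nat \<Rightarrow> real mat \<Rightarrow> real \<Rightarrow> real mat" where
  "Sigma_mat N U c = 1\<^sub>m N + c \<cdot>\<^sub>m U"

definition obs_space :: "nat \<Rightarrow> (nat \<Rightarrow> real) measure" where
  "obs_space N = (\<Pi>\<^sub>M i\<in>{..<N}. borel)"

text \<open>The law of the observation vector under \<open>f\<close>, i.e. the normal law on \<open>\<real>\<^sup>N\<close> with mean
  \<open>design_vec N x f\<close> and covariance \<open>I\<close>; the noise vector is the observation minus its mean.\<close>

definition obs_law :: "nat \<Rightarrow> (nat \<Rightarrow> 'a) \<Rightarrow> ('a \<Rightarrow> real) \<Rightarrow> (nat \<Rightarrow> real) measure" where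
  "obs_law N x f = (\<Pi>\<^sub>M i\<in>{..<N}. normal_law (f (x i)) 1)"

definition likelihood :: "nat \<Rightarrow> (nat \<Rightarrow> 'a) \<Rightarrow> (nat \<Rightarrow> real) \<Rightarrow> ('a \<Rightarrow> real) \<Rightarrow> real" where
  "likelihood N x y w = (\<Prod>i<N. normal_density (w (x i)) 1 (y i))"

definition prior :: "'w measure \<Rightarrow> ('a \<Rightarrow> 'w \<Rightarrow> real) \<Rightarrow> real \<Rightarrow> ('a \<Rightarrow> real) measure" where
  "prior Q W c = distr Q (\<Pi>\<^sub>M t\<in>UNIV. borel) (\<lambda>\<omega> t. sqrt c * W t \<omega>)"

text \<open>Bayes' formula. For a Gaussian process prior this yields that \<open>design_vec N x w\<close> has the
  normal law with mean \<open>(I - \<Sigma>\<^sup>-\<^sup>1) y\<close> and covariance \<open>I - \<Sigma>\<^sup>-\<^sup>1\<close>, where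
  \<open>\<Sigma> = Sigma_mat N (cov_mat Q W N x) c\<close>.\<close>

definition posterior ::
  "'w measure \<Rightarrow> ('a \<Rightarrow> 'w \<Rightarrow> real) \<Rightarrow> nat \<Rightarrow> (nat \<Rightarrow> 'a) \<Rightarrow> real \<Rightarrow> (nat \<Rightarrow> real) \<Rightarrow> ('a \<Rightarrow> real) measure"
where
  "posterior Q W N x c y = density (prior Q W c)
     (\<lambda>w. ennreal (likelihood N x y w / (\<integral>v. likelihood N x y v \<partial>(prior Q W c))))"

definition sq_dist_design :: "nat \<Rightarrow> (nat \<Rightarrow> 'a) \<Rightarrow> ('a \<Rightarrow> real) \<Rightarrow> ('a \<Rightarrow> real) \<Rightarrow> real" where
  "sq_dist_design N x w f =
     scalar_prod (design_vec N x w - design_vec N x f) (design_vec N x w - design_vec N x f)"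

subsection \<open>Likelihood-based empirical Bayes\<close>

definition c_interval :: "real \<Rightarrow> nat \<Rightarrow> real set" where
  "c_interval m N = {ln (real N) / real N .. real N powr (m - 1)}"

definition lik_criterion :: "nat \<Rightarrow> real mat \<Rightarrow> (nat \<Rightarrow> real) \<Rightarrow> real \<Rightarrow> real" where
  "lik_criterion N U y c =
     ln (Determinant.det (Sigma_mat N U c)) +
     scalar_prod (Matrix.vec N y) (the (mat_inverse (Sigma_mat N U c)) *\<^sub>v Matrix.vec N y)"

definition lik_estimator ::
  "'w measure \<Rightarrow> ('a \<Rightarrow> 'w \<Rightarrow> real) \<Rightarrow> real \<Rightarrow> nat \<Rightarrow> (nat \<Rightarrow> 'a) \<Rightarrow> ((nat \<Rightarrow> real) \<Rightarrow> real) \<Rightarrow> bool"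
where
  "lik_estimator Q W m N x chat \<longleftrightarrow> chat \<in> borel_measurable (obs_space N) \<and>
     (\<forall>y\<in>space (obs_space N).
        is_arg_min (lik_criterion N (cov_mat Q W N x) y) (\<lambda>c. c \<in> c_interval m N) (chat y))"

subsection \<open>Eigenvalues and the decomposition of the criterion\<close>

text \<open>Since \<open>card J = N\<close>, an orthonormal family indexed by \<open>J\<close> is a basis of \<open>\<real>\<^sup>N\<close>.\<close>

definition orthonormal_eigenbasis ::
  "nat \<Rightarrow> real mat \<Rightarrow> 'i set \<Rightarrow> ('i \<Rightarrow> real) \<Rightarrow> ('i \<Rightarrow> real vec) \<Rightarrow> bool"
where
  "orthonormal_eigenbasis N U J lam e \<longleftrightarrow> finite J \<and> card J = N \<and>
     (\<forall>j\<in>J. eigenvector U (e j) (lam j)) \<and>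
     (\<forall>j\<in>J. \<forall>k\<in>J. scalar_prod (e j) (e k) = (if j = k then 1 else 0))"

definition f_coef :: "nat \<Rightarrow> (nat \<Rightarrow> 'a) \<Rightarrow> ('i \<Rightarrow> real vec) \<Rightarrow> ('a \<Rightarrow> real) \<Rightarrow> 'i \<Rightarrow> real" where
  "f_coef N x e f j = scalar_prod (design_vec N x f) (e j)"

definition Z_coef ::
  "nat \<Rightarrow> (nat \<Rightarrow> 'a) \<Rightarrow> ('i \<Rightarrow> real vec) \<Rightarrow> ('a \<Rightarrow> real) \<Rightarrow> (nat \<Rightarrow> real) \<Rightarrow> 'i \<Rightarrow> real" where
  "Z_coef N x e f y j = scalar_prod (Matrix.vec N y - design_vec N x f) (e j)"

text \<open>In the following \<open>a\<close> and \<open>z\<close> stand for the coefficients \<open>f_coef\<close> and \<open>Z_coef\<close>.\<close>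

definition D1L :: "'i set \<Rightarrow> ('i \<Rightarrow> real) \<Rightarrow> ('i \<Rightarrow> real) \<Rightarrow> real \<Rightarrow> real" where
  "D1L J lam a c = (\<Sum>j\<in>J. (a j)\<^sup>2 / (1 + c * lam j))"

definition D2L :: "'i set \<Rightarrow> ('i \<Rightarrow> real) \<Rightarrow> real \<Rightarrow> real" where
  "D2L J lam c = (\<Sum>j\<in>J. ln (1 + c * lam j) - c * lam j / (1 + c * lam j))"

definition DL :: "'i set \<Rightarrow> ('i \<Rightarrow> real) \<Rightarrow> ('i \<Rightarrow> real) \<Rightarrow> real \<Rightarrow> real" where
  "DL J lam a c = D1L J lam a c + D2L J lam c"

definition R1L :: "'i set \<Rightarrow> ('i \<Rightarrow> real) \<Rightarrow> ('i \<Rightarrow> real) \<Rightarrow> ('i \<Rightarrow> real) \<Rightarrow> real \<Rightarrow> real" where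
  "R1L J lam a z c = 2 * (\<Sum>j\<in>J. z j * a j / (1 + c * lam j))"

definition R2L :: "'i set \<Rightarrow> ('i \<Rightarrow> real) \<Rightarrow> ('i \<Rightarrow> real) \<Rightarrow> real \<Rightarrow> real" where
  "R2L J lam z c = - (\<Sum>j\<in>J. ((z j)\<^sup>2 - 1) * (c * lam j) / (1 + c * lam j))"

definition R3 :: "'i set \<Rightarrow> ('i \<Rightarrow> real) \<Rightarrow> ('i \<Rightarrow> real) \<Rightarrow> ('i \<Rightarrow> real) \<Rightarrow> real \<Rightarrow> real" where
  "R3 J lam a z c = - 2 * (\<Sum>j\<in>J. c * lam j * z j * a j / (1 + c * lam j)\<^sup>2)"

definition R4 :: "'i set \<Rightarrow> ('i \<Rightarrow> real) \<Rightarrow> ('i \<Rightarrow> real) \<Rightarrow> real \<Rightarrow> real" where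
  "R4 J lam z c = (\<Sum>j\<in>J. (c * lam j)\<^sup>2 * ((z j)\<^sup>2 - 1) / (1 + c * lam j)\<^sup>2)"

definition s2 :: "'i set \<Rightarrow> ('i \<Rightarrow> real) \<Rightarrow> real \<Rightarrow> real" where
  "s2 J lam c = (\<Sum>j\<in>J. c * lam j / (1 + c * lam j))"

subsection \<open>Asymptotic notions\<close>

definition conv0_in_prob :: "(nat \<Rightarrow> 'b measure) \<Rightarrow> (nat \<Rightarrow> 'b \<Rightarrow> real) \<Rightarrow> bool" where
  "conv0_in_prob P T \<longleftrightarrow>
     (\<forall>\<epsilon>>0. (\<lambda>n. measure (P n) {y \<in> space (P n). \<bar>T n y\<bar> > \<epsilon>}) \<longlonglongrightarrow> 0)"

text \<open>The lower bound excludes \<open>b n s = 0\<close>, because division by zero yields zero.\<close>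

definition unif_asymp :: "(nat \<Rightarrow> 's set) \<Rightarrow> (nat \<Rightarrow> 's \<Rightarrow> real) \<Rightarrow> (nat \<Rightarrow> 's \<Rightarrow> real) \<Rightarrow> bool" where
  "unif_asymp S a b \<longleftrightarrow>
     (\<exists>l>0. \<exists>u. \<forall>\<^sub>F n in sequentially. \<forall>s\<in>S n. l \<le> a n s / b n s \<and> a n s / b n s \<le> u)"

text \<open>
  The eigenvalue conditions imply that \<open>D2L\<close> and \<open>s2\<close> are of the same order only if \<open>m > 1\<close>.
  If \<open>m = 1\<close>, e.g. \<open>lam n j = n / j\<close>, then with \<open>T = c * n\<close> the order of \<open>D2L\<close> is \<open>T\<close>, but that of
  \<open>s2\<close>, the trace of the posterior covariance, is \<open>T * ln (1 + n / T)\<close>. For \<open>f = 0\<close> the posterior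
  then does not contract at the rate \<open>INF c. DL\<close>, which is of order \<open>ln n\<close>, whatever the choice of \<open>c\<close>.
\<close>

definition polynomial_eigenvalues :: "real \<Rightarrow> (nat \<Rightarrow> nat \<Rightarrow> real) \<Rightarrow> bool" where
  "polynomial_eigenvalues m lam \<longleftrightarrow>
     (\<exists>\<delta>l \<delta>u. 0 < \<delta>l \<and> \<delta>l \<le> \<delta>u \<and>
        (\<forall>n. \<forall>j\<in>{1..n}. \<delta>l * real n / real j powr m \<le> lam n j \<and>
                         lam n j \<le> \<delta>u * real n / real j powr m))"

definition product_eigenvalues :: "real \<Rightarrow> (nat \<Rightarrow> nat \<times> nat \<Rightarrow> real) \<Rightarrow> bool" where
  "product_eigenvalues m lam \<longleftrightarrow>
     unif_asymp (\<lambda>n. {1..n} \<times> {1..n}) lam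
       (\<lambda>n (i, j). (real n)\<^sup>2 / (real i powr m * real j powr m))"

definition sobolev_eigenvalues :: "real \<Rightarrow> (nat \<Rightarrow> nat \<times> nat \<Rightarrow> real) \<Rightarrow> bool" where
  "sobolev_eigenvalues m lam \<longleftrightarrow>
     unif_asymp (\<lambda>n. {1..n} \<times> {1..n}) lam
       (\<lambda>n (i, j). (real n)\<^sup>2 / ((real i)\<^sup>2 + (real j)\<^sup>2) powr m)"

subsection \<open>Hypotheses and conclusion for a sequence of regression problems\<close>

definition eb_setting ::
  "'w measure \<Rightarrow> ('a \<Rightarrow> 'w \<Rightarrow> real) \<Rightarrow> real \<Rightarrow> (nat \<Rightarrow> nat) \<Rightarrow> (nat \<Rightarrow> nat \<Rightarrow> 'a) \<Rightarrow>
   (nat \<Rightarrow> 'i set) \<Rightarrow> (nat \<Rightarrow> 'i \<Rightarrow> real) \<Rightarrow> (nat \<Rightarrow> 'i \<Rightarrow> real vec) \<Rightarrow>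
   (nat \<Rightarrow> (nat \<Rightarrow> real) \<Rightarrow> real) \<Rightarrow> bool"
where
  "eb_setting Q W m N x J lam e chat \<longleftrightarrow>
     (\<forall>n. orthonormal_eigenbasis (N n) (cov_mat Q W (N n) (x n)) (J n) (lam n) (e n)) \<and>
     (\<forall>n. lik_estimator Q W m (N n) (x n) (chat n))"

definition remainders_negligible ::
  "real \<Rightarrow> (nat \<Rightarrow> nat) \<Rightarrow> (nat \<Rightarrow> nat \<Rightarrow> 'a) \<Rightarrow> (nat \<Rightarrow> 'i set) \<Rightarrow> (nat \<Rightarrow> 'i \<Rightarrow> real) \<Rightarrow>
   (nat \<Rightarrow> 'i \<Rightarrow> real vec) \<Rightarrow> ('a \<Rightarrow> real) \<Rightarrow> bool"
where
  "remainders_negligible m N x J lam e f \<longleftrightarrow>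
     (let P = (\<lambda>n. obs_law (N n) (x n) f);
          a = (\<lambda>n. f_coef (N n) (x n) (e n) f);
          z = (\<lambda>n. Z_coef (N n) (x n) (e n) f)
      in conv0_in_prob P (\<lambda>n y. SUP c\<in>c_interval m (N n).
           (\<bar>R1L (J n) (lam n) (a n) (z n y) c\<bar> + \<bar>R2L (J n) (lam n) (z n y) c\<bar>)
             / DL (J n) (lam n) (a n) c) \<and>
         conv0_in_prob P (\<lambda>n y. SUP c\<in>c_interval m (N n).
           (\<bar>R3 (J n) (lam n) (a n) (z n y) c\<bar> + \<bar>R4 (J n) (lam n) (z n y) c\<bar>)
             / DL (J n) (lam n) (a n) c))"

definition posterior_contracts ::
  "'w measure \<Rightarrow> ('a \<Rightarrow> 'w \<Rightarrow> real) \<Rightarrow> real \<Rightarrow> (nat \<Rightarrow> nat) \<Rightarrow> (nat \<Rightarrow> nat \<Rightarrow> 'a) \<Rightarrow>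
   (nat \<Rightarrow> 'i set) \<Rightarrow> (nat \<Rightarrow> 'i \<Rightarrow> real) \<Rightarrow> (nat \<Rightarrow> 'i \<Rightarrow> real vec) \<Rightarrow>
   (nat \<Rightarrow> (nat \<Rightarrow> real) \<Rightarrow> real) \<Rightarrow> ('a \<Rightarrow> real) \<Rightarrow> bool"
where
  "posterior_contracts Q W m N x J lam e chat f \<longleftrightarrow>
     (\<forall>M. filterlim M at_top sequentially \<longrightarrow>
        conv0_in_prob (\<lambda>n. obs_law (N n) (x n) f)
          (\<lambda>n y. measure (posterior Q W (N n) (x n) (chat n y) y)
             {w. sq_dist_design (N n) (x n) w f \<ge>
                 M n * (INF c\<in>c_interval m (N n).
                          DL (J n) (lam n) (f_coef (N n) (x n) (e n) f) c)}))"

end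

theory Submission
  imports Defs
begin

text \<open>
  In the coordinates of the eigenbasis the scores of \<open>\<surd>c W\<close> are independent normal variables with variances
  \<open>c \<lambda>\<^sub>j\<close>, so the posterior second moment of \<open>\<parallel>w - f\<parallel>\<^sup>2\<close> is explicit: it is at most
  \<open>D\<^sub>1 + 2 s\<^sup>2 + R\<^sub>3 + R\<^sub>4\<close>. The criterion equals \<open>D + R\<^sub>1 + R\<^sub>2\<close> up to a term that does not depend on \<open>c\<close>.
  Hence if, outside an event of small probability, \<open>\<bar>R\<^sub>1\<bar> + \<bar>R\<^sub>2\<bar>\<close> is at most \<open>D / 2\<close> on the whole interval,
  the minimizer satisfies \<open>D(chat) \<le> 3 inf D\<close>; if moreover \<open>\<bar>R\<^sub>3\<bar> + \<bar>R\<^sub>4\<bar>\<close> and \<open>s\<^sup>2\<close> are of order \<open>D\<close>,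
  Markov's inequality for the posterior gives the claim.

  Under an eigenvalue condition with \<open>m > 1\<close>, both \<open>s\<^sup>2\<close> and \<open>D\<^sub>2\<close> are of the order of the number of indices
  with \<open>c \<lambda>\<^sub>j \<ge> 1\<close>, which is at least a positive power of \<open>c N\<close>. Chebyshev's inequality bounds the probability
  that some \<open>R\<^sub>i(c)\<close> exceeds \<open>D(c) / 16\<close> by a multiple of \<open>1 / D(c)\<close>. Summed over a geometric grid in the interval this
  is of the order of a negative power of \<open>ln N\<close>, and between grid points the \<open>R\<^sub>i\<close> change by a small
  multiple of \<open>D\<close>, deterministically on that event.
\<close>

section \<open>Independence of jointly Gaussian coordinates\<close>

text \<open>\<open>gaussian_process\<close> only gives the law of each finite linear combination, so
  independence of the scores has to be extracted from characteristic functions. No joint law is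
  built: the Gaussian likelihood weights are themselves Fourier transforms, hence one-dimensional
  Levy uniqueness shows that weighting by the other coordinates does not change the law of one
  coordinate. For the noise, second and fourth moments of linear combinations are enough: variances
  of order D against a threshold of order D give 1 / D in Chebyshev's inequality. The union bound
  closes because of the lower endpoint ln N / N. At the k-th grid point c N equals ln N times q^k,
  so D is at least a constant times (ln N)^g q^(g k), and the bounds 1 / D are dominated by a
  geometric series; the number of grid points never enters. The condition m > 1 makes the sum of (T
  / j)^m over j > T comparable with T. This tail enters s2 to first order and D2 only to second
  order, since x / (1 + x) behaves like x and ln (1 + x) - x / (1 + x) like x^2 / 2 near 0.\<close>

lemma normal_law_eq_distr:
  assumes "\<sigma> \<ge> 0"
  shows "normal_law \<mu> \<sigma> = distr std_normal_distribution borel (\<lambda>x. \<mu> + \<sigma> * x)"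
proof (cases "\<sigma> = 0")
  case True
  interpret prob_space std_normal_distribution by (rule prob_space_normal_density) simp
  have "distr std_normal_distribution borel (\<lambda>x. \<mu>) = return borel \<mu>"
    by (rule distr_const) simp
  with True show ?thesis by (simp add: normal_law_def)
next
  case False
  with assms have s: "\<sigma> > 0" by simp
  interpret prob_space std_normal_distribution by (rule prob_space_normal_density) simp
  have "distributed std_normal_distribution lborel (\<lambda>x. x) std_normal_density"
    unfolding distributed_def by (auto simp: distr_id2)
  then have "distributed std_normal_distribution lborel (\<lambda>x. \<mu> + \<sigma> * x) (normal_density (\<mu> + \<sigma> * 0) (\<bar>\<sigma>\<bar> * 1))"
    by (intro normal_density_affine) (use s in auto)
  then have "distr std_normal_distribution lborel (\<lambda>x. \<mu> + \<sigma> * x) = density lborel (normal_density \<mu> \<sigma>)"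
    using s by (simp add: distributed_def)
  moreover have "distr std_normal_distribution lborel (\<lambda>x. \<mu> + \<sigma> * x) = distr std_normal_distribution borel (\<lambda>x. \<mu> + \<sigma> * x)"
    by (rule distr_cong) auto
  ultimately show ?thesis using False by (simp add: normal_law_def)
qed

lemma iexp_sum: "finite A \<Longrightarrow> iexp (sum g A) = (\<Prod>j\<in>A. iexp (g j))"
  by (simp add: exp_sum sum_distrib_left)

lemma norm_exp_neg_sq: "norm (complex_of_real (exp (- x\<^sup>2 / 2))) \<le> 1"
  by (simp add: norm_of_real)

text \<open>Each factor \<open>exp (- (\<xi>\<^sub>j - y\<^sub>j)\<^sup>2 / 2)\<close> is the characteristic function of a standard normal variable at
  \<open>\<xi>\<^sub>j - y\<^sub>j\<close>; by Fubini's theorem it is traded for one more linear combination in the exponent.\<close>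

lemma gaussian_weighted_char:
  fixes \<xi> :: "'j \<Rightarrow> 'w \<Rightarrow> real" and \<tau> y :: "'j \<Rightarrow> real"
  assumes "prob_space M" and J: "finite J" and [measurable]: "\<And>j. j \<in> J \<Longrightarrow> \<xi> j \<in> borel_measurable M"
    and ch: "\<And>t. (CLINT \<omega>|M. iexp (\<Sum>j\<in>J. t j * \<xi> j \<omega>)) = exp (- (\<Sum>j\<in>J. (t j)\<^sup>2 * \<tau> j) / 2)"
    and "F \<subseteq> J"
  shows "\<exists>\<kappa>::complex. \<forall>t. (CLINT \<omega>|M. (\<Prod>j\<in>F. complex_of_real (exp (- (\<xi> j \<omega> - y j)\<^sup>2 / 2))) * iexp (\<Sum>j\<in>J-F. t j * \<xi> j \<omega>))
       = \<kappa> * exp (- (\<Sum>j\<in>J-F. (t j)\<^sup>2 * \<tau> j) / 2)"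
proof -
  interpret prob_space M by fact
  interpret S: prob_space std_normal_distribution by (rule prob_space_normal_density) simp
  interpret P: pair_prob_space M std_normal_distribution ..
  have "finite F" using J \<open>F \<subseteq> J\<close> by (rule finite_subset[rotated])
  then show ?thesis using \<open>F \<subseteq> J\<close>
  proof (induction F)
    case empty
    show ?case using ch by (intro exI[of _ 1]) simp
  next
    case (insert k F)
    have kJ: "k \<in> J" and FJ: "F \<subseteq> J" using insert.prems by auto
    define R where "R = J - insert k F"
    have R: "finite R" "k \<notin> R" "R \<subseteq> J" "J - F = insert k R" using J kJ insert unfolding R_def by auto
    have [measurable]: "\<xi> k \<in> borel_measurable M" using kJ by auto
    have [measurable]: "(\<lambda>\<omega>. \<Sum>j\<in>R. t j * \<xi> j \<omega>) \<in> borel_measurable M" for t :: "'j \<Rightarrow> real"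
      using R by (intro borel_measurable_sum) auto
    define G where "G \<omega> = (\<Prod>j\<in>F. complex_of_real (exp (- (\<xi> j \<omega> - y j)\<^sup>2 / 2)))" for \<omega>
    have [measurable]: "G \<in> borel_measurable M" 
      unfolding G_def using FJ by (intro borel_measurable_prod) auto
    have Gb: "norm (G \<omega>) \<le> 1" for \<omega>
      unfolding G_def prod_norm[symmetric] by (intro prod_le_1) (simp add: norm_exp_neg_sq)
    from insert.IH[OF FJ] obtain \<kappa> :: complex where k: "\<And>t. (CLINT \<omega>|M. G \<omega> * iexp (\<Sum>j\<in>J-F. t j * \<xi> j \<omega>))
       = \<kappa> * exp (- (\<Sum>j\<in>J-F. (t j)\<^sup>2 * \<tau> j) / 2)" unfolding G_def by auto
    \<comment> \<open>The induction hypothesis holds for every \<open>t\<close>, so the coefficient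
      of \<open>k\<close> may be set to a free value \<open>v\<close>, over which the standard
      normal law is then integrated.\<close>
    have k2: "(CLINT \<omega>|M. G \<omega> * iexp (v * \<xi> k \<omega> + (\<Sum>j\<in>R. t j * \<xi> j \<omega>)))
       = \<kappa> * exp (- (v\<^sup>2 * \<tau> k) / 2) * exp (- (\<Sum>j\<in>R. (t j)\<^sup>2 * \<tau> j) / 2)" for t v
    proof -
      have *: "(\<Sum>j\<in>R. (t(k := v)) j * \<xi> j \<omega>) = (\<Sum>j\<in>R. t j * \<xi> j \<omega>)" for \<omega>
        using R by (intro sum.cong) auto
      have **: "(\<Sum>j\<in>R. ((t(k := v)) j)\<^sup>2 * \<tau> j) = (\<Sum>j\<in>R. (t j)\<^sup>2 * \<tau> j)"
        using R by (intro sum.cong) auto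
      have 3: "exp (- (v\<^sup>2 * \<tau> k + (\<Sum>j\<in>R. (t j)\<^sup>2 * \<tau> j)) / 2)
        = exp (- (v\<^sup>2 * \<tau> k) / 2) * exp (- (\<Sum>j\<in>R. (t j)\<^sup>2 * \<tau> j) / 2)"
        unfolding exp_add[symmetric] by (rule arg_cong[of _ _ exp]) (simp add: field_simps)
      have "(CLINT \<omega>|M. G \<omega> * iexp (v * \<xi> k \<omega> + (\<Sum>j\<in>R. t j * \<xi> j \<omega>)))
         = \<kappa> * exp (- (v\<^sup>2 * \<tau> k + (\<Sum>j\<in>R. (t j)\<^sup>2 * \<tau> j)) / 2)"
        using k[of "t(k:=v)"] unfolding R(4) sum.insert[OF R(1,2)] * ** fun_upd_same .
      then show ?thesis unfolding 3 of_real_mult by (simp only: mult.assoc)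
    qed
    \<comment> \<open>What is left after integrating over \<open>v\<close>. It is free of
      \<open>t\<close> because the exponent in \<open>k2\<close> splits into a term in
      \<open>v\<close> and a term in \<open>t\<close>.\<close>
    define \<kappa>' where "\<kappa>' = (CLINT v|std_normal_distribution. iexp (- (v * y k)) * (\<kappa> * exp (- (v\<^sup>2 * \<tau> k) / 2)))"
    show ?case
    proof (intro exI[of _ \<kappa>'] allI)
      fix t
      define E where "E = complex_of_real (exp (- (\<Sum>j\<in>R. (t j)\<^sup>2 * \<tau> j) / 2))"
      have four: "complex_of_real (exp (- x\<^sup>2 / 2)) = (CLINT v|std_normal_distribution. iexp (x * v))" for x
        using char_std_normal_distribution by (metis char_def)
      let ?h = "\<lambda>(\<omega>, v). G \<omega> * iexp (\<Sum>j\<in>R. t j * \<xi> j \<omega>) * iexp ((\<xi> k \<omega> - y k) * v)"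
      have meas: "?h \<in> borel_measurable (M \<Otimes>\<^sub>M std_normal_distribution)"
        by measurable
      have hb: "norm (?h x) \<le> 1" for x
        using Gb by (simp add: norm_mult case_prod_beta del: of_real_sum of_real_mult of_real_diff)
      have int: "integrable (M \<Otimes>\<^sub>M std_normal_distribution) ?h"
        by (rule P.integrable_const_bound[where B=1, OF AE_I2 meas]) (rule hb)
      have pt: "(\<Prod>j\<in>insert k F. complex_of_real (exp (- (\<xi> j \<omega> - y j)\<^sup>2 / 2))) * iexp (\<Sum>j\<in>R. t j * \<xi> j \<omega>)
         = (CLINT v|std_normal_distribution. ?h (\<omega>, v))" for \<omega>
      proof -
        have "(\<Prod>j\<in>insert k F. complex_of_real (exp (- (\<xi> j \<omega> - y j)\<^sup>2 / 2)))
           = (CLINT v|std_normal_distribution. iexp ((\<xi> k \<omega> - y k) * v)) * G \<omega>"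
          unfolding prod.insert[OF insert.hyps] G_def four[symmetric] ..
        moreover have "(CLINT v|std_normal_distribution. ?h (\<omega>, v)) =
            G \<omega> * iexp (\<Sum>j\<in>R. t j * \<xi> j \<omega>) * (CLINT v|std_normal_distribution. iexp ((\<xi> k \<omega> - y k) * v))"
          unfolding prod.case by (rule integral_mult_right_zero)
        ultimately show ?thesis by (simp only: mult_ac)
      qed
      have "(CLINT \<omega>|M. (\<Prod>j\<in>insert k F. complex_of_real (exp (- (\<xi> j \<omega> - y j)\<^sup>2 / 2))) * iexp (\<Sum>j\<in>R. t j * \<xi> j \<omega>))
         = (CLINT \<omega>|M. (CLINT v|std_normal_distribution. ?h (\<omega>, v)))"
        unfolding pt ..
      also have "\<dots> = (CLINT v|std_normal_distribution. (CLINT \<omega>|M. ?h (\<omega>, v)))"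
        using P.Fubini_integral[of "\<lambda>\<omega> v. ?h (\<omega>, v)"] int by simp
      also have "\<dots> = (CLINT v|std_normal_distribution. iexp (- (v * y k)) * (CLINT \<omega>|M. G \<omega> * iexp (v * \<xi> k \<omega> + (\<Sum>j\<in>R. t j * \<xi> j \<omega>))))"
      proof (rule Bochner_Integration.integral_cong[OF refl])
        fix v
        have "?h (\<omega>, v) = iexp (- (v * y k)) * (G \<omega> * iexp (v * \<xi> k \<omega> + (\<Sum>j\<in>R. t j * \<xi> j \<omega>)))" for \<omega>
        proof -
          have "iexp ((\<xi> k \<omega> - y k) * v) = iexp (- (v * y k)) * iexp (v * \<xi> k \<omega>)"
            by (simp add: algebra_simps flip: exp_add)
          moreover have "iexp (v * \<xi> k \<omega> + (\<Sum>j\<in>R. t j * \<xi> j \<omega>)) = iexp (v * \<xi> k \<omega>) * iexp (\<Sum>j\<in>R. t j * \<xi> j \<omega>)"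
            unfolding of_real_add ring_distribs exp_add ..
          ultimately show ?thesis unfolding prod.case by (simp only: mult_ac)
        qed
        then show "(CLINT \<omega>|M. ?h (\<omega>, v)) =
           iexp (- (v * y k)) * (CLINT \<omega>|M. G \<omega> * iexp (v * \<xi> k \<omega> + (\<Sum>j\<in>R. t j * \<xi> j \<omega>)))"
          by (simp only: integral_mult_right_zero)
      qed
      also have "\<dots> = (CLINT v|std_normal_distribution. (iexp (- (v * y k)) * (\<kappa> * exp (- (v\<^sup>2 * \<tau> k) / 2))) * E)"
        unfolding k2 E_def by (simp add: mult_ac)
      also have "\<dots> = \<kappa>' * E"
        unfolding \<kappa>'_def by (rule integral_mult_left_zero)
      finally show "(CLINT \<omega>|M. (\<Prod>j\<in>insert k F. complex_of_real (exp (- (\<xi> j \<omega> - y j)\<^sup>2 / 2))) * iexp (\<Sum>j\<in>J - insert k F. t j * \<xi> j \<omega>))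
         = \<kappa>' * exp (- (\<Sum>j\<in>J - insert k F. (t j)\<^sup>2 * \<tau> j) / 2)"
        unfolding R_def[symmetric] E_def by simp
    qed
  qed
qed

text \<open>Under the probability measure with density proportional to the other factors, \<open>\<xi>\<^sub>k\<close> has
  the same characteristic function as without them.\<close>

lemma gaussian_weighted_law:
  fixes \<xi> :: "'j \<Rightarrow> 'w \<Rightarrow> real" and \<tau> y :: "'j \<Rightarrow> real" and h :: "real \<Rightarrow> real"
  assumes "prob_space M" and J: "finite J" and \<xi>m: "\<And>j. j \<in> J \<Longrightarrow> \<xi> j \<in> borel_measurable M"
    and ch: "\<And>t. (CLINT \<omega>|M. iexp (\<Sum>j\<in>J. t j * \<xi> j \<omega>)) = exp (- (\<Sum>j\<in>J. (t j)\<^sup>2 * \<tau> j) / 2)"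
    and k: "k \<in> J" and tau: "\<tau> k \<ge> 0" 
  shows "\<exists>C>0. \<forall>h::real \<Rightarrow> real. h \<in> borel_measurable borel \<longrightarrow> integrable std_normal_distribution (\<lambda>x. h (sqrt (\<tau> k) * x)) \<longrightarrow>
     integrable M (\<lambda>\<omega>. (\<Prod>j\<in>J-{k}. exp (- (\<xi> j \<omega> - y j)\<^sup>2 / 2)) * h (\<xi> k \<omega>)) \<and>
     (\<integral>\<omega>. (\<Prod>j\<in>J-{k}. exp (- (\<xi> j \<omega> - y j)\<^sup>2 / 2)) * h (\<xi> k \<omega>) \<partial>M) = C * (\<integral>x. h (sqrt (\<tau> k) * x) \<partial>std_normal_distribution)"
proof -
  interpret prob_space M by fact
  interpret S: prob_space std_normal_distribution by (rule prob_space_normal_density) simp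
  define G where "G \<omega> = (\<Prod>j\<in>J-{k}. exp (- (\<xi> j \<omega> - y j)\<^sup>2 / 2))" for \<omega>
  have [measurable]: "\<xi> k \<in> borel_measurable M" using \<xi>m k by auto
  have [measurable]: "G \<in> borel_measurable M" 
    unfolding G_def using \<xi>m by (intro borel_measurable_prod) auto
  have G0: "G \<omega> > 0" for \<omega> unfolding G_def by (intro prod_pos) auto
  have G1: "G \<omega> \<le> 1" for \<omega> unfolding G_def by (intro prod_le_1) auto
  have Gint: "integrable M G"
    by (rule integrable_const_bound[where B=1]) (use G0 G1 in \<open>auto simp: less_imp_le\<close>)
  \<comment> \<open>\<open>C\<close> is fixed before \<open>h\<close>, so numerator and denominator
    of a posterior moment carry the same factor and it cancels.\<close>
  define C where "C = expectation G"
  have C0: "C > 0" unfolding C_def using integral_less_AE_space[of "\<lambda>_. 0" G] G0 Gint emeasure_space_1 by simp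
  obtain \<kappa> :: complex where \<kappa>: "\<And>t. (CLINT \<omega>|M. complex_of_real (G \<omega>) * iexp (\<Sum>j\<in>J-(J-{k}). t j * \<xi> j \<omega>))
       = \<kappa> * exp (- (\<Sum>j\<in>J-(J-{k}). (t j)\<^sup>2 * \<tau> j) / 2)"
    using gaussian_weighted_char[OF \<open>prob_space M\<close> J \<xi>m ch, where F="J-{k}" and y=y] unfolding G_def of_real_prod by auto
  have kk: "J - (J - {k}) = {k}" using k by auto
  have \<kappa>t: "(CLINT \<omega>|M. complex_of_real (G \<omega>) * iexp (t * \<xi> k \<omega>)) = \<kappa> * exp (- (t\<^sup>2 * \<tau> k) / 2)" for t
    using \<kappa>[of "\<lambda>_. t"] unfolding kk by simp
  \<comment> \<open>At frequency 0 the unknown factor shows itself as the total mass; it disappears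
    from the characteristic function of the normalized measure \<open>M'\<close>.\<close>
  have \<kappa>C: "\<kappa> = C"
    using \<kappa>t[of 0] unfolding C_def by simp
  define M' where "M' = density M (\<lambda>\<omega>. ennreal (G \<omega> / C))"
  have "prob_space M'"
  proof
    have "emeasure M' (space M') = (\<integral>\<^sup>+\<omega>. ennreal (G \<omega> / C) \<partial>M)"
      unfolding M'_def by (simp add: emeasure_density cong: nn_integral_cong)
    also have "\<dots> = ennreal (expectation (\<lambda>\<omega>. G \<omega> / C))"
      by (rule nn_integral_eq_integral) (use Gint G0 C0 in \<open>auto simp: less_imp_le\<close>)
    also have "\<dots> = 1" using C0 unfolding C_def by simp
    finally show "emeasure M' (space M') = 1" .
  qed
  then interpret M': prob_space M' .
  have [measurable_cong, simp]: "sets M' = sets M" unfolding M'_def by simp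
  define N' where "N' = distr M' borel (\<xi> k)"
  define L where "L = distr std_normal_distribution borel (\<lambda>x. sqrt (\<tau> k) * x)"
  interpret N': real_distribution N'
    unfolding N'_def by (intro M'.real_distribution_distr) simp
  interpret L: real_distribution L
    unfolding L_def by (intro S.real_distribution_distr) simp
  have "char N' t = char L t" for t
  proof -
    have "char N' t = (CLINT \<omega>|M'. iexp (t * \<xi> k \<omega>))"
      unfolding N'_def char_def by (rule integral_distr) auto
    also have "\<dots> = (CLINT \<omega>|M. (G \<omega> / C) *\<^sub>R iexp (t * \<xi> k \<omega>))"
      unfolding M'_def by (rule integral_density) (use G0 C0 in \<open>auto simp: less_imp_le\<close>)
    also have "\<dots> = (CLINT \<omega>|M. complex_of_real (G \<omega>) * iexp (t * \<xi> k \<omega>)) / C"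
      unfolding integral_divide_zero[symmetric] by (simp add: scaleR_conv_of_real del: of_real_mult)
    also have "\<dots> = exp (- (t\<^sup>2 * \<tau> k) / 2)"
      using C0 unfolding \<kappa>t \<kappa>C by simp
    also have "\<dots> = char std_normal_distribution (sqrt (\<tau> k) * t)"
      unfolding char_std_normal_distribution using tau by (simp add: power_mult_distrib mult.commute)
    also have "\<dots> = char L t"
      unfolding L_def char_def by (subst integral_distr) (auto simp: mult_ac)
    finally show ?thesis .
  qed
  then have "N' = L"
    by (intro Levy_uniqueness N'.real_distribution_axioms L.real_distribution_axioms) auto
  have "integrable M (\<lambda>\<omega>. G \<omega> * h (\<xi> k \<omega>)) \<and>
     (\<integral>\<omega>. G \<omega> * h (\<xi> k \<omega>) \<partial>M) = C * (\<integral>x. h (sqrt (\<tau> k) * x) \<partial>std_normal_distribution)"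
    if [measurable]: "h \<in> borel_measurable borel" and i: "integrable std_normal_distribution (\<lambda>x. h (sqrt (\<tau> k) * x))" for h :: "real \<Rightarrow> real"
  proof -
    have "integrable L h" unfolding L_def using i by (subst integrable_distr_eq) auto
    then have "integrable M' (\<lambda>\<omega>. h (\<xi> k \<omega>))" unfolding \<open>N' = L\<close>[symmetric] N'_def by (subst (asm) integrable_distr_eq) auto
    then have "integrable M (\<lambda>\<omega>. (G \<omega> / C) *\<^sub>R h (\<xi> k \<omega>))" unfolding M'_def
      by (subst (asm) integrable_density) (use G0 C0 in \<open>auto simp: less_imp_le\<close>)
    then have "integrable M (\<lambda>\<omega>. C * ((G \<omega> / C) *\<^sub>R h (\<xi> k \<omega>)))" by (rule integrable_mult_right)
    moreover have "C * ((G \<omega> / C) *\<^sub>R h (\<xi> k \<omega>)) = G \<omega> * h (\<xi> k \<omega>)" for \<omega> using C0 by simp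
    ultimately have 1: "integrable M (\<lambda>\<omega>. G \<omega> * h (\<xi> k \<omega>))" by simp
    have "(\<integral>x. h (sqrt (\<tau> k) * x) \<partial>std_normal_distribution) = (\<integral>x. h x \<partial>L)"
      unfolding L_def by (subst integral_distr) auto
    also have "\<dots> = (\<integral>\<omega>. h (\<xi> k \<omega>) \<partial>M')" unfolding \<open>N' = L\<close>[symmetric] N'_def by (subst integral_distr) auto
    also have "\<dots> = (\<integral>\<omega>. (G \<omega> / C) *\<^sub>R h (\<xi> k \<omega>) \<partial>M)" unfolding M'_def
      by (rule integral_density) (use G0 C0 in \<open>auto simp: less_imp_le\<close>)
    also have "\<dots> = (\<integral>\<omega>. G \<omega> * h (\<xi> k \<omega>) \<partial>M) / C" by simp
    finally show ?thesis using 1 C0 by simp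
  qed
  then show ?thesis using C0 unfolding G_def by blast
qed

section \<open>One-dimensional Gaussian conjugacy\<close>

lemma normal_second_moment_affine:
  assumes "\<sigma> > 0"
  shows "integrable lborel (\<lambda>x. normal_density \<mu> \<sigma> x * (s * x - f)\<^sup>2)"
    "(\<integral>x. normal_density \<mu> \<sigma> x * (s * x - f)\<^sup>2 \<partial>lborel) = s\<^sup>2 * \<sigma>\<^sup>2 + (s * \<mu> - f)\<^sup>2"
proof -
  have e: "normal_density \<mu> \<sigma> x * (s * x - f)\<^sup>2 = s\<^sup>2 * (normal_density \<mu> \<sigma> x * (x - \<mu>) ^ 2)
     + 2 * s * (s * \<mu> - f) * (normal_density \<mu> \<sigma> x * (x - \<mu>)) + (s * \<mu> - f)\<^sup>2 * normal_density \<mu> \<sigma> x" for x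
    by (simp add: power2_eq_square algebra_simps)
  have m2: "has_bochner_integral lborel (\<lambda>x. normal_density \<mu> \<sigma> x * (x - \<mu>) ^ 2) (\<sigma>\<^sup>2)"
    using normal_moment_even[OF assms, of \<mu> 1] by (simp add: fact_numeral)
  have m1: "has_bochner_integral lborel (\<lambda>x. normal_density \<mu> \<sigma> x * (x - \<mu>)) 0"
    using normal_moment_odd[OF assms, of \<mu> 0] by simp
  have m0: "has_bochner_integral lborel (\<lambda>x. normal_density \<mu> \<sigma> x) 1"
    using integrable_normal_density[OF assms] integral_normal_density[OF assms] by (metis has_bochner_integral_integrable)
  have "has_bochner_integral lborel (\<lambda>x. normal_density \<mu> \<sigma> x * (s * x - f)\<^sup>2) (s\<^sup>2 * \<sigma>\<^sup>2 + 2 * s * (s * \<mu> - f) * 0 + (s * \<mu> - f)\<^sup>2 * 1)"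
    unfolding e by (intro has_bochner_integral_add has_bochner_integral_mult_right m0 m1 m2)
  then show "integrable lborel (\<lambda>x. normal_density \<mu> \<sigma> x * (s * x - f)\<^sup>2)"
    "(\<integral>x. normal_density \<mu> \<sigma> x * (s * x - f)\<^sup>2 \<partial>lborel) = s\<^sup>2 * \<sigma>\<^sup>2 + (s * \<mu> - f)\<^sup>2"
    by (auto simp: has_bochner_integral_iff)
qed

text \<open>Completion of the square for a standard normal X and an observation y of s X with unit
  noise: given y, X is normal with mean s y / (1 + s^2) and variance 1 / (1 + s^2). The factor in
  front is the marginal density of y times sqrt (2 pi). Keeping X instead of s X as the variable
  covers the degenerate case s = 0.\<close>

lemma gaussian_tilt_density:
  fixes s y x :: real
  defines "\<tau> \<equiv> s\<^sup>2"
  shows "std_normal_density x * exp (- (s * x - y)\<^sup>2 / 2) =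
    exp (- y\<^sup>2 / (2 * (1 + \<tau>))) / sqrt (1 + \<tau>) * normal_density (s * y / (1 + \<tau>)) (1 / sqrt (1 + \<tau>)) x"
proof -
  have p: "1 + \<tau> > 0" unfolding \<tau>_def by (simp add: add_pos_nonneg)
  have "- x\<^sup>2 / 2 + - (s * x - y)\<^sup>2 / 2 = - y\<^sup>2 / (2 * (1 + \<tau>)) + - (x - s * y / (1 + \<tau>))\<^sup>2 / (2 * (1 / sqrt (1 + \<tau>))\<^sup>2)"
    using p by (simp add: power_divide divide_simps) (simp add: \<tau>_def power2_eq_square algebra_simps)
  then have e: "exp (- x\<^sup>2 / 2) * exp (- (s * x - y)\<^sup>2 / 2) =
     exp (- y\<^sup>2 / (2 * (1 + \<tau>))) * exp (- (x - s * y / (1 + \<tau>))\<^sup>2 / (2 * (1 / sqrt (1 + \<tau>))\<^sup>2))"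
    by (simp only: exp_add[symmetric])
  have r: "1 / sqrt (2 * pi * (1 / sqrt (1 + \<tau>))\<^sup>2) = sqrt (1 + \<tau>) / sqrt (2 * pi)"
    using p by (simp add: power_divide real_sqrt_divide)
  show ?thesis unfolding normal_density_def r using e p
    by (simp add: field_simps)
qed

text \<open>Passing from X to s X multiplies the posterior mean by s and the variance by s^2, which
  produces the shrinkage factor \<open>\<tau> / (1 + \<tau>)\<close> in both places.\<close>

lemma gaussian_tilt:
  fixes s y f :: real
  defines "\<tau> \<equiv> s\<^sup>2"
  shows "\<exists>K>0. integrable std_normal_distribution (\<lambda>x. exp (- (s * x - y)\<^sup>2 / 2)) \<and>
    (\<integral>x. exp (- (s * x - y)\<^sup>2 / 2) \<partial>std_normal_distribution) = K \<and>
    integrable std_normal_distribution (\<lambda>x. (s * x - f)\<^sup>2 * exp (- (s * x - y)\<^sup>2 / 2)) \<and>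
    (\<integral>x. (s * x - f)\<^sup>2 * exp (- (s * x - y)\<^sup>2 / 2) \<partial>std_normal_distribution) = K * (\<tau> / (1 + \<tau>) + (\<tau> / (1 + \<tau>) * y - f)\<^sup>2)"
proof -
  define K where "K = exp (- y\<^sup>2 / (2 * (1 + \<tau>))) / sqrt (1 + \<tau>)"
  have p: "1 + \<tau> > 0" unfolding \<tau>_def by (simp add: add_pos_nonneg)
  have K: "K > 0" using p unfolding K_def by simp
  let ?n = "normal_density (s * y / (1 + \<tau>)) (1 / sqrt (1 + \<tau>))"
  have sg: "1 / sqrt (1 + \<tau>) > 0" using p by simp
  have t: "std_normal_density x * exp (- (s * x - y)\<^sup>2 / 2) = K * ?n x" for x
    unfolding K_def \<tau>_def by (rule gaussian_tilt_density)
  have t2: "std_normal_density x * ((s * x - f)\<^sup>2 * exp (- (s * x - y)\<^sup>2 / 2)) = K * (?n x * (s * x - f)\<^sup>2)" for x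
    using t[of x] by (metis mult.assoc mult.commute)
  have v: "s\<^sup>2 * (1 / sqrt (1 + \<tau>))\<^sup>2 + (s * (s * y) / (1 + \<tau>) - f)\<^sup>2 = \<tau> / (1 + \<tau>) + (\<tau> * y / (1 + \<tau>) - f)\<^sup>2"
    using p by (simp add: power_divide \<tau>_def power2_eq_square mult.assoc)
  show ?thesis
    using K normal_second_moment_affine[OF sg, of "s * y / (1 + \<tau>)" s f] integrable_normal_density[OF sg] integral_normal_density[OF sg]
    by (intro exI[of _ K]) (auto simp: integrable_density integral_density t t2 v simp del: divide_minus_left)
qed

text \<open>Separate the weight of \<open>k\<close> from the others. The others contribute the same
  constant \<open>C\<close> to both integrals, and what remains is the tilt of one normal variable
  by its own observation.\<close>

lemma gaussian_posterior_second_moment: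
  fixes \<xi> :: "'j \<Rightarrow> 'w \<Rightarrow> real" and \<tau> y :: "'j \<Rightarrow> real"
  assumes "prob_space M" and J: "finite J" and \<xi>m: "\<And>j. j \<in> J \<Longrightarrow> \<xi> j \<in> borel_measurable M"
    and ch: "\<And>t. (CLINT \<omega>|M. iexp (\<Sum>j\<in>J. t j * \<xi> j \<omega>)) = exp (- (\<Sum>j\<in>J. (t j)\<^sup>2 * \<tau> j) / 2)"
    and k: "k \<in> J" and tau: "\<tau> k \<ge> 0" 
  defines "G \<equiv> \<lambda>\<omega>. \<Prod>j\<in>J. exp (- (\<xi> j \<omega> - y j)\<^sup>2 / 2)"
  shows "integrable M (\<lambda>\<omega>. (\<xi> k \<omega> - f)\<^sup>2 * G \<omega>)"
    "(\<integral>\<omega>. (\<xi> k \<omega> - f)\<^sup>2 * G \<omega> \<partial>M) = (\<tau> k / (1 + \<tau> k) + (\<tau> k / (1 + \<tau> k) * y k - f)\<^sup>2) * (\<integral>\<omega>. G \<omega> \<partial>M)"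
proof -
  define s where "s = sqrt (\<tau> k)"
  have s: "s\<^sup>2 = \<tau> k" using tau unfolding s_def by simp
  from gaussian_weighted_law[OF assms(1-6), of y]
  obtain C where C: "C > 0" "\<And>h::real \<Rightarrow> real. h \<in> borel_measurable borel \<Longrightarrow> integrable std_normal_distribution (\<lambda>x. h (s * x)) \<Longrightarrow>
     integrable M (\<lambda>\<omega>. (\<Prod>j\<in>J-{k}. exp (- (\<xi> j \<omega> - y j)\<^sup>2 / 2)) * h (\<xi> k \<omega>)) \<and>
     (\<integral>\<omega>. (\<Prod>j\<in>J-{k}. exp (- (\<xi> j \<omega> - y j)\<^sup>2 / 2)) * h (\<xi> k \<omega>) \<partial>M) = C * (\<integral>x. h (s * x) \<partial>std_normal_distribution)"
    unfolding s_def by blast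
  from gaussian_tilt[of s "y k" f, unfolded s] obtain K where K: "K > 0"
    "integrable std_normal_distribution (\<lambda>x. exp (- (s * x - y k)\<^sup>2 / 2))"
    "(\<integral>x. exp (- (s * x - y k)\<^sup>2 / 2) \<partial>std_normal_distribution) = K"
    "integrable std_normal_distribution (\<lambda>x. (s * x - f)\<^sup>2 * exp (- (s * x - y k)\<^sup>2 / 2))"
    "(\<integral>x. (s * x - f)\<^sup>2 * exp (- (s * x - y k)\<^sup>2 / 2) \<partial>std_normal_distribution) = K * (\<tau> k / (1 + \<tau> k) + (\<tau> k / (1 + \<tau> k) * y k - f)\<^sup>2)"
    by blast
  have G: "G \<omega> = (\<Prod>j\<in>J-{k}. exp (- (\<xi> j \<omega> - y j)\<^sup>2 / 2)) * exp (- (\<xi> k \<omega> - y k)\<^sup>2 / 2)" for \<omega>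
    unfolding G_def using prod.remove[OF J k] by (simp add: mult.commute)
  have G2: "(\<xi> k \<omega> - f)\<^sup>2 * G \<omega> = (\<Prod>j\<in>J-{k}. exp (- (\<xi> j \<omega> - y j)\<^sup>2 / 2)) * ((\<xi> k \<omega> - f)\<^sup>2 * exp (- (\<xi> k \<omega> - y k)\<^sup>2 / 2))" for \<omega>
    unfolding G by (simp only: mult_ac)
  have 1: "(\<integral>\<omega>. G \<omega> \<partial>M) = C * K"
    unfolding G using C(2)[of "\<lambda>x. exp (- (x - y k)\<^sup>2 / 2)"] K(2,3) by simp
  have m2: "(\<lambda>x. (x - f)\<^sup>2 * exp (- (x - y k)\<^sup>2 / 2)) \<in> borel_measurable borel" by measurable
  show "integrable M (\<lambda>\<omega>. (\<xi> k \<omega> - f)\<^sup>2 * G \<omega>)"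
    unfolding G2 using C(2)[OF m2 K(4)] by blast
  have "(\<integral>\<omega>. (\<xi> k \<omega> - f)\<^sup>2 * G \<omega> \<partial>M) = C * (K * (\<tau> k / (1 + \<tau> k) + (\<tau> k / (1 + \<tau> k) * y k - f)\<^sup>2))"
    unfolding G2 using C(2)[OF m2 K(4)] unfolding K(5) by blast
  then show "(\<integral>\<omega>. (\<xi> k \<omega> - f)\<^sup>2 * G \<omega> \<partial>M) = (\<tau> k / (1 + \<tau> k) + (\<tau> k / (1 + \<tau> k) * y k - f)\<^sup>2) * (\<integral>\<omega>. G \<omega> \<partial>M)"
    unfolding 1 by (simp only: mult_ac)
qed

section \<open>Moments of independent normal families and Chebyshev bounds\<close>

lemma integrable_std_normal_power: "integrable std_normal_distribution (\<lambda>x. x ^ k)"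
  using integrable_std_normal_moment[of k] by (subst integrable_density) (auto simp: mult.commute)

lemma integral_std_normal_power:
  "(\<integral>x. x\<^sup>2 \<partial>std_normal_distribution) = 1" "(\<integral>x. x ^ 4 \<partial>std_normal_distribution) = 3"
  using integral_std_normal_moment_even[of 1] integral_std_normal_moment_even[of 2]
  by (auto simp: integral_density fact_numeral mult.commute)

text \<open>Independent centred normal variables with variances \<open>\<tau> j\<close>, encoded
  through their linear combinations because both Gaussian objects are given in that form: the prior
  scores with \<open>\<tau> j = c * lam j\<close> and the noise coefficients with
  \<open>\<tau> j = 1\<close>.\<close>

locale gaussian_family = prob_space M for M :: "'w measure" +
  fixes J :: "'j set" and \<xi> :: "'j \<Rightarrow> 'w \<Rightarrow> real" and \<tau> :: "'j \<Rightarrow> real"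
  assumes fin: "finite J" and meas: "\<And>j. j \<in> J \<Longrightarrow> \<xi> j \<in> borel_measurable M"
    and tau: "\<And>j. j \<in> J \<Longrightarrow> \<tau> j \<ge> 0"
    and law: "\<And>t. distr M borel (\<lambda>\<omega>. \<Sum>j\<in>J. t j * \<xi> j \<omega>) = normal_law 0 (sqrt (\<Sum>j\<in>J. (t j)\<^sup>2 * \<tau> j))"
begin

lemma meas_comb [measurable]: "(\<lambda>\<omega>. \<Sum>j\<in>J. t j * \<xi> j \<omega>) \<in> borel_measurable M"
  using meas by (intro borel_measurable_sum) auto

lemma var_nonneg: "(\<Sum>j\<in>J. (t j)\<^sup>2 * \<tau> j) \<ge> 0"
  using tau by (intro sum_nonneg) auto

lemma law_distr: "distr M borel (\<lambda>\<omega>. \<Sum>j\<in>J. t j * \<xi> j \<omega>) =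
    distr std_normal_distribution borel (\<lambda>x. sqrt (\<Sum>j\<in>J. (t j)\<^sup>2 * \<tau> j) * x)"
  unfolding law using var_nonneg[of t] by (subst normal_law_eq_distr) auto

lemma char_comb: "(CLINT \<omega>|M. iexp (\<Sum>j\<in>J. t j * \<xi> j \<omega>)) = exp (- (\<Sum>j\<in>J. (t j)\<^sup>2 * \<tau> j) / 2)"
proof -
  let ?V = "\<Sum>j\<in>J. (t j)\<^sup>2 * \<tau> j"
  have "(CLINT \<omega>|M. iexp (\<Sum>j\<in>J. t j * \<xi> j \<omega>)) = (CLINT u|distr M borel (\<lambda>\<omega>. \<Sum>j\<in>J. t j * \<xi> j \<omega>). iexp u)"
    by (rule integral_distr[symmetric]) auto
  also have "\<dots> = (CLINT x|std_normal_distribution. iexp (sqrt ?V * x))"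
    unfolding law_distr by (rule integral_distr) auto
  also have "\<dots> = char std_normal_distribution (sqrt ?V)" by (simp add: char_def)
  also have "\<dots> = exp (- ?V / 2)" unfolding char_std_normal_distribution using var_nonneg[of t] by simp
  finally show ?thesis .
qed

lemma moment_comb:
  "integrable M (\<lambda>\<omega>. (\<Sum>j\<in>J. t j * \<xi> j \<omega>) ^ k)" (is ?A)
  "expectation (\<lambda>\<omega>. (\<Sum>j\<in>J. t j * \<xi> j \<omega>) ^ k) =
     sqrt (\<Sum>j\<in>J. (t j)\<^sup>2 * \<tau> j) ^ k * (\<integral>x. x ^ k \<partial>std_normal_distribution)" (is ?B)
proof -
  let ?X = "\<lambda>\<omega>. \<Sum>j\<in>J. t j * \<xi> j \<omega>" and ?s = "sqrt (\<Sum>j\<in>J. (t j)\<^sup>2 * \<tau> j)"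
  have "integrable (distr M borel ?X) (\<lambda>u. u ^ k)"
    unfolding law_distr by (subst integrable_distr_eq) (auto simp: power_mult_distrib intro: integrable_std_normal_power)
  then show ?A by (subst (asm) integrable_distr_eq) auto
  have "expectation (\<lambda>\<omega>. ?X \<omega> ^ k) = (\<integral>u. u ^ k \<partial>distr M borel ?X)"
    by (rule integral_distr[symmetric]) auto
  also have "\<dots> = (\<integral>x. (?s * x) ^ k \<partial>std_normal_distribution)"
    unfolding law_distr by (rule integral_distr) auto
  finally show ?B by (simp add: power_mult_distrib)
qed

lemma comb_single: "k \<in> J \<Longrightarrow> (\<Sum>j\<in>J. (if j = k then 1 else 0) * \<xi> j \<omega>) = \<xi> k \<omega>"
  using fin by (simp add: if_distrib[of "\<lambda>x. x * _"] sum.delta cong: if_cong)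

lemma posterior_second_moment:
  fixes y :: "'j \<Rightarrow> real" and f :: real
  assumes k: "k \<in> J"
  defines "G \<equiv> \<lambda>\<omega>. \<Prod>j\<in>J. exp (- (\<xi> j \<omega> - y j)\<^sup>2 / 2)"
  shows "integrable M (\<lambda>\<omega>. (\<xi> k \<omega> - f)\<^sup>2 * G \<omega>)"
    "(\<integral>\<omega>. (\<xi> k \<omega> - f)\<^sup>2 * G \<omega> \<partial>M) = (\<tau> k / (1 + \<tau> k) + (\<tau> k / (1 + \<tau> k) * y k - f)\<^sup>2) * (\<integral>\<omega>. G \<omega> \<partial>M)"
  unfolding G_def
  by (rule gaussian_posterior_second_moment[OF prob_space_axioms fin meas char_comb k tau[OF k]]; assumption)+

end

locale standard_gaussian_family = gaussian_family M J \<xi> "\<lambda>_. 1" for M :: "'w measure" and J :: "'j set" and \<xi>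
begin

lemma second_moment_comb:
  "integrable M (\<lambda>\<omega>. (\<Sum>j\<in>J. t j * \<xi> j \<omega>)\<^sup>2)"
  "expectation (\<lambda>\<omega>. (\<Sum>j\<in>J. t j * \<xi> j \<omega>)\<^sup>2) = (\<Sum>j\<in>J. (t j)\<^sup>2)"
  using moment_comb[of t 2] var_nonneg[of t] by (auto simp: integral_std_normal_power)

lemma fourth_moment_comb:
  "integrable M (\<lambda>\<omega>. (\<Sum>j\<in>J. t j * \<xi> j \<omega>) ^ 4)"
  "expectation (\<lambda>\<omega>. (\<Sum>j\<in>J. t j * \<xi> j \<omega>) ^ 4) = 3 * (\<Sum>j\<in>J. (t j)\<^sup>2)\<^sup>2"
proof -
  have e: "sqrt v ^ 4 = v\<^sup>2" if "v \<ge> 0" for v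
  proof -
    have "sqrt v ^ 4 = (sqrt v ^ 2) ^ 2" by (simp flip: power_mult)
    then show ?thesis using that by simp
  qed
  show "integrable M (\<lambda>\<omega>. (\<Sum>j\<in>J. t j * \<xi> j \<omega>) ^ 4)" by (rule moment_comb)
  show "expectation (\<lambda>\<omega>. (\<Sum>j\<in>J. t j * \<xi> j \<omega>) ^ 4) = 3 * (\<Sum>j\<in>J. (t j)\<^sup>2)\<^sup>2"
    using moment_comb(2)[of t 4] var_nonneg[of t] by (simp add: integral_std_normal_power e)
qed

lemma moment_single:
  assumes k: "k \<in> J"
  shows "integrable M (\<lambda>\<omega>. (\<xi> k \<omega>)\<^sup>2)" "expectation (\<lambda>\<omega>. (\<xi> k \<omega>)\<^sup>2) = 1"
    "integrable M (\<lambda>\<omega>. \<xi> k \<omega> ^ 4)" "expectation (\<lambda>\<omega>. \<xi> k \<omega> ^ 4) = 3"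
proof -
  let ?t = "\<lambda>j. if j = k then 1 else 0 :: real"
  have "(\<Sum>j\<in>J. (?t j)\<^sup>2) = 1"
    using fin k by (simp add: if_distrib[of "\<lambda>x. x ^ 2"] sum.delta cong: if_cong)
  then show "integrable M (\<lambda>\<omega>. (\<xi> k \<omega>)\<^sup>2)" "expectation (\<lambda>\<omega>. (\<xi> k \<omega>)\<^sup>2) = 1"
    "integrable M (\<lambda>\<omega>. \<xi> k \<omega> ^ 4)" "expectation (\<lambda>\<omega>. \<xi> k \<omega> ^ 4) = 3"
    using second_moment_comb[of ?t] fourth_moment_comb[of ?t] unfolding comb_single[OF k] by auto
qed

text \<open>Polarization: the mixed moment is read off the fourth moments of the sum and of the difference.\<close>

lemma mixed_moment:
  assumes k: "k \<in> J" and l: "l \<in> J" and kl: "k \<noteq> l"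
  shows "integrable M (\<lambda>\<omega>. (\<xi> k \<omega>)\<^sup>2 * (\<xi> l \<omega>)\<^sup>2)" "expectation (\<lambda>\<omega>. (\<xi> k \<omega>)\<^sup>2 * (\<xi> l \<omega>)\<^sup>2) = 1"
proof -
  define t where "t s j = (if j = k then 1 else 0) + (if j = l then s else 0 :: real)" for s j
  have c: "(\<Sum>j\<in>J. t s j * \<xi> j \<omega>) = \<xi> k \<omega> + s * \<xi> l \<omega>" for s \<omega>
    using fin k l unfolding t_def
    by (simp add: distrib_right sum.distrib if_distrib[of "\<lambda>x. x * _"] sum.delta cong: if_cong)
  have q: "(t s j)\<^sup>2 = (if j = k then 1 else 0) + (if j = l then s\<^sup>2 else 0)" for s j
    using kl unfolding t_def by auto
  have v: "(\<Sum>j\<in>J. (t s j)\<^sup>2) = 1 + s\<^sup>2" for s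
    unfolding q using fin k l by (simp add: sum.distrib sum.delta)
  note f = fourth_moment_comb[of "t 1"] fourth_moment_comb[of "t (-1)"] 
  note f' = f[unfolded c v, simplified]
  note m = moment_single(3,4)[OF k] moment_single(3,4)[OF l]
  \<comment> \<open>The sum and the difference have fourth moment 3 * 2^2 = 12 and the single
    variables 3, so the right-hand side has mean (12 + 12 - 6 - 6) / 12 = 1.\<close>
  have id: "(\<xi> k \<omega>)\<^sup>2 * (\<xi> l \<omega>)\<^sup>2 = ((\<xi> k \<omega> + \<xi> l \<omega>) ^ 4 + (\<xi> k \<omega> - \<xi> l \<omega>) ^ 4 - 2 * \<xi> k \<omega> ^ 4 - 2 * \<xi> l \<omega> ^ 4) / 12" for \<omega>
    by (simp add: power2_eq_square power4_eq_xxxx algebra_simps)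
  show "integrable M (\<lambda>\<omega>. (\<xi> k \<omega>)\<^sup>2 * (\<xi> l \<omega>)\<^sup>2)" "expectation (\<lambda>\<omega>. (\<xi> k \<omega>)\<^sup>2 * (\<xi> l \<omega>)\<^sup>2) = 1"
    unfolding id using f' m by auto
qed

text \<open>Expand the square into a double sum. A diagonal term has mean 3 - 2 + 1 = 2, an
  off-diagonal one 1 - 1 - 1 + 1 = 0.\<close>

lemma chi_square_moment:
  "integrable M (\<lambda>\<omega>. (\<Sum>j\<in>J. b j * ((\<xi> j \<omega>)\<^sup>2 - 1))\<^sup>2)" (is ?A)
  "expectation (\<lambda>\<omega>. (\<Sum>j\<in>J. b j * ((\<xi> j \<omega>)\<^sup>2 - 1))\<^sup>2) = 2 * (\<Sum>j\<in>J. (b j)\<^sup>2)" (is ?B)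
proof -
  have e: "((\<xi> j \<omega>)\<^sup>2 - 1) * ((\<xi> k \<omega>)\<^sup>2 - 1) = (\<xi> j \<omega>)\<^sup>2 * (\<xi> k \<omega>)\<^sup>2 - (\<xi> j \<omega>)\<^sup>2 - (\<xi> k \<omega>)\<^sup>2 + 1" for j k \<omega>
    by (simp add: algebra_simps)
  have p: "integrable M (\<lambda>\<omega>. ((\<xi> j \<omega>)\<^sup>2 - 1) * ((\<xi> k \<omega>)\<^sup>2 - 1)) \<and>
    expectation (\<lambda>\<omega>. ((\<xi> j \<omega>)\<^sup>2 - 1) * ((\<xi> k \<omega>)\<^sup>2 - 1)) = (if j = k then 2 else 0)" if "j \<in> J" "k \<in> J" for j k
  proof (cases "j = k")
    case True
    have "(\<xi> j \<omega>)\<^sup>2 * (\<xi> j \<omega>)\<^sup>2 = \<xi> j \<omega> ^ 4" for \<omega> by (simp flip: power_add)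
    then show ?thesis using True moment_single[OF that(1)] unfolding e by (simp add: prob_space)
  next
    case False
    then show ?thesis using mixed_moment[OF that False] moment_single[OF that(1)] moment_single[OF that(2)]
      unfolding e by (simp add: prob_space)
  qed
  have s: "(\<Sum>j\<in>J. b j * ((\<xi> j \<omega>)\<^sup>2 - 1))\<^sup>2 = (\<Sum>j\<in>J. \<Sum>k\<in>J. (b j * b k) * (((\<xi> j \<omega>)\<^sup>2 - 1) * ((\<xi> k \<omega>)\<^sup>2 - 1)))" for \<omega>
    unfolding power2_eq_square[of "sum _ _"] sum_product by (intro sum.cong refl) (simp only: mult_ac)
  show ?A unfolding s using p by (intro Bochner_Integration.integrable_sum integrable_mult_right) auto
  have "expectation (\<lambda>\<omega>. (\<Sum>j\<in>J. b j * ((\<xi> j \<omega>)\<^sup>2 - 1))\<^sup>2) = (\<Sum>j\<in>J. \<Sum>k\<in>J. (b j * b k) * (if j = k then 2 else 0))"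
    unfolding s using p by (simp add: Bochner_Integration.integral_sum Bochner_Integration.integrable_sum)
  also have "\<dots> = (\<Sum>j\<in>J. b j * b j * 2)"
    using fin by (intro sum.cong refl) (simp add: if_distrib[of "\<lambda>x. _ * x"] sum.delta' cong: if_cong)
  finally show ?B by (simp add: sum_distrib_left power2_eq_square mult.commute)
qed

lemma prob_abs_gt_le:
  assumes [measurable]: "X \<in> borel_measurable M" and "integrable M (\<lambda>\<omega>. (X \<omega>)\<^sup>2)" and "r > 0"
  shows "prob {\<omega> \<in> space M. \<bar>X \<omega>\<bar> > r} \<le> expectation (\<lambda>\<omega>. (X \<omega>)\<^sup>2) / r\<^sup>2"
proof -
  have "prob {\<omega> \<in> space M. \<bar>X \<omega>\<bar> > r} \<le> prob {\<omega> \<in> space M. (X \<omega>)\<^sup>2 \<ge> r\<^sup>2}"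
    using \<open>r > 0\<close> by (intro finite_measure_mono) (auto simp: abs_le_square_iff[symmetric])
  also have "\<dots> \<le> expectation (\<lambda>\<omega>. (X \<omega>)\<^sup>2) / r\<^sup>2"
    using assms by (intro integral_Markov_inequality_measure[where A="{}"]) auto
  finally show ?thesis .
qed

lemma chebyshev_linear:
  assumes "r > 0"
  shows "prob {\<omega> \<in> space M. \<bar>\<Sum>j\<in>J. b j * \<xi> j \<omega>\<bar> > r} \<le> (\<Sum>j\<in>J. (b j)\<^sup>2) / r\<^sup>2"
  using prob_abs_gt_le[OF meas_comb second_moment_comb(1) assms] unfolding second_moment_comb(2) .

lemma chebyshev_chi_square:
  assumes "r > 0"
  shows "prob {\<omega> \<in> space M. \<bar>\<Sum>j\<in>J. b j * ((\<xi> j \<omega>)\<^sup>2 - 1)\<bar> > r} \<le> 2 * (\<Sum>j\<in>J. (b j)\<^sup>2) / r\<^sup>2"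
proof -
  have "(\<lambda>\<omega>. \<Sum>j\<in>J. b j * ((\<xi> j \<omega>)\<^sup>2 - 1)) \<in> borel_measurable M"
    using meas by (intro borel_measurable_sum) auto
  from prob_abs_gt_le[OF this chi_square_moment(1) assms] show ?thesis unfolding chi_square_moment(2) .
qed

end

section \<open>The criterion and the posterior in the eigenbasis\<close>

lemma scalar_prod_sum:
  "v \<in> carrier_vec N \<Longrightarrow> w \<in> carrier_vec N \<Longrightarrow> scalar_prod v w = (\<Sum>i<N. vec_index v i * vec_index w i)"
  by (simp add: scalar_prod_def atLeast0LessThan)

lemma sum_rotate: "(\<Sum>i\<in>A. \<Sum>j\<in>B. \<Sum>k\<in>C. f i j k) = (\<Sum>j\<in>B. \<Sum>k\<in>C. \<Sum>i\<in>A. f i j k)"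
proof -
  have "(\<Sum>i\<in>A. \<Sum>j\<in>B. \<Sum>k\<in>C. f i j k) = (\<Sum>j\<in>B. \<Sum>i\<in>A. \<Sum>k\<in>C. f i j k)" by (rule sum.swap)
  also have "\<dots> = (\<Sum>j\<in>B. \<Sum>k\<in>C. \<Sum>i\<in>A. f i j k)" by (intro sum.cong[OF refl] sum.swap)
  finally show ?thesis .
qed

locale eigenbasis =
  fixes N :: nat and U :: "real mat" and J :: "'j set" and lam :: "'j \<Rightarrow> real" and e :: "'j \<Rightarrow> real Matrix.vec"
  assumes U [simp]: "U \<in> carrier_mat N N" and basis: "orthonormal_eigenbasis N U J lam e"
begin

abbreviation ev :: "'j \<Rightarrow> nat \<Rightarrow> real" where "ev j i \<equiv> vec_index (e j) i"

lemma dim_U [simp]: "dim_row U = N" "dim_col U = N"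
  by (rule carrier_matD[OF U])+

lemma finJ [simp]: "finite J" and cardJ: "card J = N"
  using basis by (auto simp: orthonormal_eigenbasis_def)

lemma e_carrier [simp]: "j \<in> J \<Longrightarrow> e j \<in> carrier_vec N"
  using basis U by (auto simp: orthonormal_eigenbasis_def eigenvector_def)

lemma dim_e [simp]: "j \<in> J \<Longrightarrow> dim_vec (e j) = N"
  by (rule carrier_vecD[OF e_carrier])

lemma e_orth: "j \<in> J \<Longrightarrow> k \<in> J \<Longrightarrow> (\<Sum>i<N. ev j i * ev k i) = (if j = k then 1 else 0)"
  using basis by (auto simp: orthonormal_eigenbasis_def scalar_prod_sum[of _ N])

lemma U_e:
  assumes "j \<in> J" "i < N"
  shows "(\<Sum>k<N. U $$ (i, k) * ev j k) = lam j * ev j i"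
proof -
  have "U *\<^sub>v e j = lam j \<cdot>\<^sub>v e j"
    using basis assms by (auto simp: orthonormal_eigenbasis_def eigenvector_def)
  then have "vec_index (U *\<^sub>v e j) i = vec_index (lam j \<cdot>\<^sub>v e j) i" by simp
  then show ?thesis using assms U by (simp add: scalar_prod_def atLeast0LessThan)
qed

text \<open>With the eigenvectors as columns of a square matrix P, orthonormality reads P^T P = 1. A
  left inverse of a square matrix is a right inverse, and the entries of P P^T = 1 are the
  completeness relation. The bijection is there because \<open>J\<close> has no order of its
  own.\<close>

lemma e_complete:
  assumes "i < N" "k < N"
  shows "(\<Sum>j\<in>J. ev j i * ev j k) = (if i = k then 1 else 0)"
proof -
  obtain \<phi> where \<phi>: "bij_betw \<phi> {..<N} J"
    using ex_bij_betw_nat_finite[OF finJ] by (auto simp: cardJ atLeast0LessThan)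
  then have \<phi>J: "\<phi> a \<in> J" if "a < N" for a using that by (auto simp: bij_betw_def)
  have \<phi>i: "\<phi> a = \<phi> b \<longleftrightarrow> a = b" if "a < N" "b < N" for a b using \<phi> that by (auto simp: bij_betw_def inj_on_def)
  define P where "P = mat N N (\<lambda>(i, a). ev (\<phi> a) i)"
  have P: "P \<in> carrier_mat N N" "transpose_mat P \<in> carrier_mat N N" by (auto simp: P_def)
  have "transpose_mat P * P = 1\<^sub>m N"
    by (rule eq_matI) (auto simp: P_def scalar_prod_def atLeast0LessThan e_orth \<phi>J \<phi>i)
  then have "P * transpose_mat P = 1\<^sub>m N" by (rule mat_mult_left_right_inverse[OF P(2,1)])
  then have "(P * transpose_mat P) $$ (i, k) = (if i = k then 1 else 0)" using assms by simp
  then have "(\<Sum>a<N. ev (\<phi> a) i * ev (\<phi> a) k) = (if i = k then 1 else 0)"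
    using assms by (simp add: P_def scalar_prod_def atLeast0LessThan)
  then show ?thesis using sum.reindex_bij_betw[OF \<phi>, of "\<lambda>j. ev j i * ev j k"] by simp
qed

lemma parseval:
  fixes v :: "nat \<Rightarrow> real"
  shows "(\<Sum>j\<in>J. (\<Sum>i<N. v i * ev j i)\<^sup>2) = (\<Sum>i<N. (v i)\<^sup>2)"
proof -
  have "(\<Sum>j\<in>J. (\<Sum>i<N. v i * ev j i)\<^sup>2) = (\<Sum>j\<in>J. \<Sum>i<N. \<Sum>k<N. v i * v k * (ev j i * ev j k))"
    unfolding power2_eq_square sum_product by (intro sum.cong[OF refl]) (simp only: mult_ac)
  also have "\<dots> = (\<Sum>i<N. \<Sum>k<N. v i * v k * (\<Sum>j\<in>J. ev j i * ev j k))"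
    unfolding sum_distrib_left by (rule sum_rotate)
  also have "\<dots> = (\<Sum>i<N. (v i)\<^sup>2)"
    by (intro sum.cong[OF refl]) (simp add: e_complete if_distrib[of "\<lambda>x. _ * x"] power2_eq_square cong: if_cong)
  finally show ?thesis .
qed

lemma sum_sq_comb: "(\<Sum>i<N. (\<Sum>j\<in>J. t j * ev j i)\<^sup>2) = (\<Sum>j\<in>J. (t j)\<^sup>2)"
proof -
  have "(\<Sum>i<N. (\<Sum>j\<in>J. t j * ev j i)\<^sup>2) = (\<Sum>i<N. \<Sum>j\<in>J. \<Sum>k\<in>J. t j * t k * (ev j i * ev k i))"
    unfolding power2_eq_square sum_product by (intro sum.cong[OF refl]) (simp only: mult_ac)
  also have "\<dots> = (\<Sum>j\<in>J. \<Sum>k\<in>J. t j * t k * (\<Sum>i<N. ev j i * ev k i))"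
    unfolding sum_distrib_left by (rule sum_rotate)
  also have "\<dots> = (\<Sum>j\<in>J. (t j)\<^sup>2)"
    by (intro sum.cong[OF refl]) (simp add: e_orth if_distrib[of "\<lambda>x. _ * x"] power2_eq_square cong: if_cong)
  finally show ?thesis .
qed

text \<open>Read probabilistically: the scores along the eigenvectors are uncorrelated, with
  variances \<open>lam j\<close>.\<close>

lemma quadratic_form_comb:
  "(\<Sum>i<N. \<Sum>k<N. (\<Sum>j\<in>J. t j * ev j i) * (\<Sum>j\<in>J. t j * ev j k) * U $$ (i, k)) = (\<Sum>j\<in>J. (t j)\<^sup>2 * lam j)"
proof -
  have "(\<Sum>i<N. \<Sum>k<N. (\<Sum>j\<in>J. t j * ev j i) * (\<Sum>j\<in>J. t j * ev j k) * U $$ (i, k))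
     = (\<Sum>i<N. (\<Sum>j\<in>J. t j * ev j i) * (\<Sum>j\<in>J. t j * (\<Sum>k<N. U $$ (i, k) * ev j k)))"
  proof (intro sum.cong[OF refl])
    fix i
    have "(\<Sum>k<N. (\<Sum>j\<in>J. t j * ev j i) * (\<Sum>j\<in>J. t j * ev j k) * U $$ (i, k))
       = (\<Sum>j\<in>J. t j * ev j i) * (\<Sum>k<N. \<Sum>j\<in>J. t j * (U $$ (i, k) * ev j k))"
      unfolding sum_distrib_left sum_distrib_right by (intro sum.cong[OF refl]) (simp only: mult_ac)
    also have "(\<Sum>k<N. \<Sum>j\<in>J. t j * (U $$ (i, k) * ev j k)) = (\<Sum>j\<in>J. t j * (\<Sum>k<N. U $$ (i, k) * ev j k))"
      unfolding sum_distrib_left by (rule sum.swap)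
    finally show "(\<Sum>k<N. (\<Sum>j\<in>J. t j * ev j i) * (\<Sum>j\<in>J. t j * ev j k) * U $$ (i, k))
       = (\<Sum>j\<in>J. t j * ev j i) * (\<Sum>j\<in>J. t j * (\<Sum>k<N. U $$ (i, k) * ev j k))" .
  qed
  also have "\<dots> = (\<Sum>i<N. (\<Sum>j\<in>J. t j * ev j i) * (\<Sum>j\<in>J. (t j * lam j) * ev j i))"
    by (intro sum.cong[OF refl]) (simp add: U_e mult.assoc)
  also have "\<dots> = (\<Sum>i<N. \<Sum>j\<in>J. \<Sum>k\<in>J. t j * (t k * lam k) * (ev j i * ev k i))"
    unfolding sum_product by (intro sum.cong[OF refl]) (simp only: mult_ac)
  also have "\<dots> = (\<Sum>j\<in>J. \<Sum>k\<in>J. t j * (t k * lam k) * (\<Sum>i<N. ev j i * ev k i))"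
    unfolding sum_distrib_left by (rule sum_rotate)
  also have "\<dots> = (\<Sum>j\<in>J. (t j)\<^sup>2 * lam j)"
    by (intro sum.cong[OF refl]) (simp add: e_orth if_distrib[of "\<lambda>x. _ * x"] power2_eq_square mult.assoc cong: if_cong)
  finally show ?thesis .
qed

lemma Sigma_carrier [simp]: "Sigma_mat N U c \<in> carrier_mat N N"
  by (simp add: Sigma_mat_def)

lemma Sigma_e:
  assumes "j \<in> J" "i < N"
  shows "(\<Sum>k<N. Sigma_mat N U c $$ (i, k) * ev j k) = (1 + c * lam j) * ev j i"
proof -
  have "Sigma_mat N U c $$ (i, k) = (if i = k then 1 else 0) + c * U $$ (i, k)" if "k < N" for k
    using that assms U unfolding Sigma_mat_def by (auto simp: carrier_matD)
  then have "(\<Sum>k<N. Sigma_mat N U c $$ (i, k) * ev j k) = (\<Sum>k<N. (if i = k then 1 else 0) * ev j k + c * (U $$ (i, k) * ev j k))"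
    by (intro sum.cong[OF refl]) (simp add: algebra_simps)
  also have "\<dots> = ev j i + c * (\<Sum>k<N. U $$ (i, k) * ev j k)"
    unfolding sum.distrib sum_distrib_left using assms by (simp add: if_distrib[of "\<lambda>x. x * _"] cong: if_cong)
  also have "\<dots> = (1 + c * lam j) * ev j i" unfolding U_e[OF assms] by (simp add: algebra_simps)
  finally show ?thesis .
qed

text \<open>Diagonalization as \<Sigma> P = P D; the determinant of P cancels, being nonzero by P^T
  P = 1.\<close>

lemma det_Sigma: "Determinant.det (Sigma_mat N U c) = (\<Prod>j\<in>J. 1 + c * lam j)"
proof -
  obtain \<phi> where \<phi>: "bij_betw \<phi> {..<N} J"
    using ex_bij_betw_nat_finite[OF finJ] by (auto simp: cardJ atLeast0LessThan)
  then have \<phi>J: "\<phi> a \<in> J" if "a < N" for a using that by (auto simp: bij_betw_def)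
  have \<phi>i: "\<phi> a = \<phi> b \<longleftrightarrow> a = b" if "a < N" "b < N" for a b using \<phi> that by (auto simp: bij_betw_def inj_on_def)
  define P where "P = mat N N (\<lambda>(i, a). ev (\<phi> a) i)"
  define D where "D = mat N N (\<lambda>(a, b). if a = b then 1 + c * lam (\<phi> a) else 0)"
  have P: "P \<in> carrier_mat N N" "transpose_mat P \<in> carrier_mat N N" and D: "D \<in> carrier_mat N N" 
    by (auto simp: P_def D_def)
  have PP: "transpose_mat P * P = 1\<^sub>m N"
    by (rule eq_matI) (auto simp: P_def scalar_prod_def atLeast0LessThan e_orth \<phi>J \<phi>i)
  have "Determinant.det (transpose_mat P) * Determinant.det P = 1"
    using det_mult[OF P(2,1)] unfolding PP by simp
  then have dP: "Determinant.det P \<noteq> 0" by auto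
  have "Sigma_mat N U c * P = P * D"
  proof (rule eq_matI)
    fix i a assume "i < dim_row (P * D)" "a < dim_col (P * D)"
    then have ia: "i < N" "a < N" by (auto simp: P_def D_def)
    have "(Sigma_mat N U c * P) $$ (i, a) = (\<Sum>k<N. Sigma_mat N U c $$ (i, k) * ev (\<phi> a) k)"
      using ia carrier_matD[OF Sigma_carrier] by (simp add: P_def scalar_prod_def atLeast0LessThan)
    moreover have "(P * D) $$ (i, a) = (1 + c * lam (\<phi> a)) * ev (\<phi> a) i"
      using ia by (simp add: P_def D_def scalar_prod_def atLeast0LessThan if_distrib[of "\<lambda>x. _ * x"] cong: if_cong)
    ultimately show "(Sigma_mat N U c * P) $$ (i, a) = (P * D) $$ (i, a)"
      using Sigma_e[OF \<phi>J ia(1)] ia by simp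
  qed (auto simp: P_def D_def Sigma_mat_def carrier_matD[OF U])
  then have "Determinant.det (Sigma_mat N U c) * Determinant.det P = Determinant.det P * Determinant.det D"
    using det_mult[OF Sigma_carrier P(1)] det_mult[OF P(1) D] by metis
  then have "Determinant.det (Sigma_mat N U c) = Determinant.det D" using dP by simp
  also have "\<dots> = prod_list (diag_mat D)"
    by (rule det_upper_triangular[OF _ D]) (auto simp: D_def)
  also have "\<dots> = (\<Prod>a<N. 1 + c * lam (\<phi> a))"
    unfolding prod_list_diag_prod by (auto simp: D_def atLeast0LessThan)
  also have "\<dots> = (\<Prod>j\<in>J. 1 + c * lam j)" using prod.reindex_bij_betw[OF \<phi>] by simp
  finally show ?thesis .
qed

text \<open>The spectral formula \<open>B\<close> is a two-sided inverse. This excludes the value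
  \<open>None\<close> of \<open>mat_inverse\<close>, and uniqueness of inverses identifies any
  returned matrix with \<open>B\<close>.\<close>

lemma inverse_Sigma_form:
  fixes y :: "nat \<Rightarrow> real"
  assumes pos: "\<And>j. j \<in> J \<Longrightarrow> 1 + c * lam j > 0"
  shows "scalar_prod (Matrix.vec N y) (the (mat_inverse (Sigma_mat N U c)) *\<^sub>v Matrix.vec N y)
    = (\<Sum>j\<in>J. (\<Sum>i<N. y i * ev j i)\<^sup>2 / (1 + c * lam j))"
proof -
  let ?S = "Sigma_mat N U c"
  define B where "B = mat N N (\<lambda>(i, k). \<Sum>j\<in>J. ev j i * ev j k / (1 + c * lam j))"
  have B: "B \<in> carrier_mat N N" by (simp add: B_def)
  have SB: "?S * B = 1\<^sub>m N"
  proof (rule eq_matI)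
    fix i l assume "i < dim_row (1\<^sub>m N)" "l < dim_col (1\<^sub>m N)"
    then have il: "i < N" "l < N" by auto
    have "(?S * B) $$ (i, l) = (\<Sum>k<N. ?S $$ (i, k) * (\<Sum>j\<in>J. ev j k * ev j l / (1 + c * lam j)))"
      using il carrier_matD[OF Sigma_carrier] by (simp add: B_def scalar_prod_def atLeast0LessThan)
    also have "\<dots> = (\<Sum>j\<in>J. (\<Sum>k<N. ?S $$ (i, k) * ev j k) * (ev j l / (1 + c * lam j)))"
      unfolding sum_distrib_left sum_distrib_right by (subst sum.swap) (simp add: mult.assoc)
    also have "\<dots> = (\<Sum>j\<in>J. ev j i * ev j l)"
      using pos by (intro sum.cong[OF refl]) (auto simp: Sigma_e il dest!: less_imp_neq[OF pos])
    also have "\<dots> = 1\<^sub>m N $$ (i, l)" using il by (simp add: e_complete)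
    finally show "(?S * B) $$ (i, l) = 1\<^sub>m N $$ (i, l)" .
  qed (auto simp: B_def Sigma_mat_def carrier_matD[OF U])
  then have BS: "B * ?S = 1\<^sub>m N" by (rule mat_mult_left_right_inverse[OF Sigma_carrier B])
  have "the (mat_inverse ?S) = B"
  proof (cases "mat_inverse ?S")
    case None
    have "?S \<in> Units (ring_mat TYPE(real) N ())"
      unfolding Units_def ring_mat_def using SB BS B by auto
    with mat_inverse(1)[OF Sigma_carrier None, of "()"] show ?thesis by blast
  next
    case (Some A)
    from mat_inverse(2)[OF Sigma_carrier Some] have A: "?S * A = 1\<^sub>m N" "A \<in> carrier_mat N N" by auto
    have "A = (B * ?S) * A" using BS A by simp
    also have "\<dots> = B * (?S * A)" by (rule assoc_mult_mat[OF B Sigma_carrier A(2)])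
    also have "\<dots> = B" using A B by simp
    finally show ?thesis using Some by simp
  qed
  then have "scalar_prod (Matrix.vec N y) (the (mat_inverse ?S) *\<^sub>v Matrix.vec N y)
      = (\<Sum>i<N. y i * (\<Sum>k<N. (\<Sum>j\<in>J. ev j i * ev j k / (1 + c * lam j)) * y k))"
    by (simp add: B_def scalar_prod_def atLeast0LessThan)
  also have "\<dots> = (\<Sum>i<N. \<Sum>k<N. \<Sum>j\<in>J. (y i * ev j i) * (y k * ev j k) / (1 + c * lam j))"
    unfolding sum_distrib_left sum_distrib_right by (intro sum.cong[OF refl]) (simp add: mult_ac)
  also have "\<dots> = (\<Sum>i<N. \<Sum>j\<in>J. \<Sum>k<N. (y i * ev j i) * (y k * ev j k) / (1 + c * lam j))"
    by (intro sum.cong[OF refl] sum.swap)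
  also have "\<dots> = (\<Sum>j\<in>J. \<Sum>i<N. \<Sum>k<N. (y i * ev j i) * (y k * ev j k) / (1 + c * lam j))"
    by (rule sum.swap)
  also have "\<dots> = (\<Sum>j\<in>J. (\<Sum>i<N. y i * ev j i)\<^sup>2 / (1 + c * lam j))"
    unfolding power2_eq_square sum_product sum_divide_distrib ..
  finally show ?thesis .
qed

end

section \<open>The law of the observations\<close>

lemma prob_space_normal_law [simp]: "prob_space (normal_law \<mu> 1)"
  unfolding normal_law_def by (simp add: prob_space_normal_density)

lemma sets_normal_law [simp, measurable_cong]: "sets (normal_law \<mu> \<sigma>) = sets borel"
  by (simp add: normal_law_def)

lemma space_normal_law [simp]: "space (normal_law \<mu> \<sigma>) = UNIV"
  by (simp add: normal_law_def)

lemma real_distribution_normal_law: "\<sigma> \<ge> 0 \<Longrightarrow> real_distribution (normal_law \<mu> \<sigma>)"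
  by (subst normal_law_eq_distr)
     (auto intro!: prob_space.real_distribution_distr prob_space_normal_density)

lemma char_normal_law:
  assumes "\<sigma> \<ge> 0"
  shows "char (normal_law 0 \<sigma>) t = exp (- (t\<^sup>2 * \<sigma>\<^sup>2) / 2)"
proof -
  have "char (normal_law 0 \<sigma>) t = (CLINT x|std_normal_distribution. iexp (t * (0 + \<sigma> * x)))"
    unfolding normal_law_eq_distr[OF assms] char_def by (rule integral_distr) auto
  also have "\<dots> = char std_normal_distribution (t * \<sigma>)" by (simp add: char_def mult_ac)
  finally show ?thesis unfolding char_std_normal_distribution by (simp add: power_mult_distrib)
qed

lemma sets_obs_law [simp, measurable_cong]: "sets (obs_law N x f) = sets (obs_space N)"
  unfolding obs_law_def obs_space_def by (rule sets_PiM_cong) auto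

lemma space_obs_law [simp]: "space (obs_law N x f) = space (obs_space N)"
  by (rule sets_eq_imp_space_eq) simp

lemma prob_space_obs_law: "prob_space (obs_law N x f)"
  unfolding obs_law_def by (rule prob_space_PiM) simp

lemma measurable_obs_component: "i < N \<Longrightarrow> (\<lambda>y. y i) \<in> borel_measurable (obs_space N)"
  unfolding obs_space_def by measurable

lemma measurable_obs_comb: "(\<lambda>y. \<Sum>i<N. a i * (y i - \<mu> i)) \<in> borel_measurable (obs_space N)"
  by (intro borel_measurable_sum borel_measurable_times borel_measurable_diff borel_measurable_const measurable_obs_component) auto

text \<open>The coordinates are independent by construction of the product measure, so the
  characteristic function of a combination factors into those of one-dimensional normal
  laws.\<close>

lemma distr_obs_law_comb:
  "distr (obs_law N x f) borel (\<lambda>y. \<Sum>i<N. a i * (y i - f (x i))) = normal_law 0 (sqrt (\<Sum>i<N. (a i)\<^sup>2))"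
proof (rule Levy_uniqueness)
  interpret prob_space "obs_law N x f" by (rule prob_space_obs_law)
  interpret PS: product_prob_space "\<lambda>i. normal_law (f (x i)) 1" by (rule product_prob_spaceI) simp
  have V: "(\<Sum>i<N. (a i)\<^sup>2) \<ge> 0" by (simp add: sum_nonneg)
  have m: "(\<lambda>y. \<Sum>i<N. a i * (y i - f (x i))) \<in> borel_measurable (obs_law N x f)"
    using measurable_obs_comb by simp
  show "real_distribution (distr (obs_law N x f) borel (\<lambda>y. \<Sum>i<N. a i * (y i - f (x i))))"
    using m by (rule real_distribution_distr)
  show "real_distribution (normal_law 0 (sqrt (\<Sum>i<N. (a i)\<^sup>2)))" using V by (intro real_distribution_normal_law) simp
  show "char (distr (obs_law N x f) borel (\<lambda>y. \<Sum>i<N. a i * (y i - f (x i)))) = char (normal_law 0 (sqrt (\<Sum>i<N. (a i)\<^sup>2)))"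
  proof
    fix t
    have one: "(CLINT u|normal_law \<mu> 1. iexp (t * (b * (u - \<mu>)))) = exp (- (t\<^sup>2 * b\<^sup>2) / 2)" for b \<mu>
    proof -
      have "(CLINT u|normal_law \<mu> 1. iexp (t * (b * (u - \<mu>)))) = (CLINT u|std_normal_distribution. iexp (t * (b * ((\<mu> + 1 * u) - \<mu>))))"
        by (subst normal_law_eq_distr, simp, rule integral_distr) auto
      also have "\<dots> = char std_normal_distribution (t * b)" by (simp add: char_def mult_ac)
      finally show ?thesis unfolding char_std_normal_distribution by (simp add: power_mult_distrib)
    qed
    have int: "integrable (normal_law \<mu> 1) (\<lambda>u. iexp (t * (b * (u - \<mu>))))" for b \<mu>
    proof (rule finite_measure.integrable_const_bound[where B=1])
      show "finite_measure (normal_law \<mu> 1)" by (simp add: prob_space.finite_measure)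
      show "(\<lambda>u. iexp (t * (b * (u - \<mu>)))) \<in> borel_measurable (normal_law \<mu> 1)" by measurable
    qed simp
    have "char (distr (obs_law N x f) borel (\<lambda>y. \<Sum>i<N. a i * (y i - f (x i)))) t
      = (CLINT y|obs_law N x f. iexp (t * (\<Sum>i<N. a i * (y i - f (x i)))))"
      unfolding char_def using m by (rule integral_distr) auto
    also have "\<dots> = (CLINT y|obs_law N x f. (\<Prod>i<N. iexp (t * (a i * (y i - f (x i))))))"
      unfolding sum_distrib_left by (simp only: iexp_sum[OF finite_lessThan])
    also have "\<dots> = (\<Prod>i<N. CLINT u|normal_law (f (x i)) 1. iexp (t * (a i * (u - f (x i)))))"
      unfolding obs_law_def
      by (rule PS.product_integral_prod[OF finite_lessThan]) (rule int)
    also have "\<dots> = complex_of_real (\<Prod>i<N. exp (- (t\<^sup>2 * (a i)\<^sup>2) / 2))"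
      unfolding one of_real_prod ..
    also have "(\<Prod>i<N. exp (- (t\<^sup>2 * (a i)\<^sup>2) / 2)) = exp (- (t\<^sup>2 * (\<Sum>i<N. (a i)\<^sup>2)) / 2)"
      unfolding exp_sum[OF finite_lessThan, symmetric] by (simp add: sum_distrib_left sum_negf sum_divide_distrib)
    finally show "char (distr (obs_law N x f) borel (\<lambda>y. \<Sum>i<N. a i * (y i - f (x i)))) t = char (normal_law 0 (sqrt (\<Sum>i<N. (a i)\<^sup>2))) t"
      using V by (subst char_normal_law) auto
  qed
qed

text \<open>Design points may coincide, whereas \<open>gaussian_process\<close> speaks of finite
  sets of distinct points; the coefficients belonging to one point have to be added first.\<close>

lemma sum_compose_image:
  fixes a :: "nat \<Rightarrow> real"
  assumes "finite I"
  shows "(\<Sum>i\<in>I. a i * w (x i)) = (\<Sum>t\<in>x ` I. (\<Sum>i\<in>{i \<in> I. x i = t}. a i) * w t)"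
proof -
  have "(\<Sum>i\<in>I. a i * w (x i)) = (\<Sum>t\<in>x ` I. \<Sum>i\<in>{i \<in> I. x i = t}. a i * w (x i))"
    by (rule sum.image_gen[OF assms])
  also have "\<dots> = (\<Sum>t\<in>x ` I. (\<Sum>i\<in>{i \<in> I. x i = t}. a i) * w t)"
    unfolding sum_distrib_right by (intro sum.cong[OF refl]) auto
  finally show ?thesis .
qed

section \<open>Linear combinations of a centred Gaussian process\<close>

locale centered_gaussian_process =
  fixes Q :: "'w measure" and W :: "'a \<Rightarrow> 'w \<Rightarrow> real"
  assumes mzgp: "mean_zero_gaussian_process Q W"
begin

sublocale prob_space Q
  using mzgp by (simp add: mean_zero_gaussian_process_def gaussian_process_def)

lemma W_meas [measurable]: "W t \<in> borel_measurable Q"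
  using mzgp by (simp add: mean_zero_gaussian_process_def gaussian_process_def)

lemma W_mean: "expectation (W t) = 0"
  using mzgp by (simp add: mean_zero_gaussian_process_def)

lemma comb_normal:
  fixes x :: "nat \<Rightarrow> 'a"
  shows "\<exists>\<mu> \<sigma>. 0 \<le> \<sigma> \<and> distr Q borel (\<lambda>\<omega>. \<Sum>i<N. a i * W (x i) \<omega>) = normal_law \<mu> \<sigma>"
proof -
  let ?b = "\<lambda>t. \<Sum>i\<in>{i \<in> {..<N}. x i = t}. a i"
  have g: "\<And>F b. finite F \<Longrightarrow> \<exists>\<mu> \<sigma>. 0 \<le> \<sigma> \<and> distr Q borel (\<lambda>\<omega>. \<Sum>t\<in>F. b t * W t \<omega>) = normal_law \<mu> \<sigma>"
    using mzgp by (simp add: mean_zero_gaussian_process_def gaussian_process_def)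
  have e: "(\<Sum>i<N. a i * W (x i) \<omega>) = (\<Sum>t\<in>x ` {..<N}. ?b t * W t \<omega>)" for \<omega>
    using sum_compose_image[of "{..<N}" a "\<lambda>t. W t \<omega>" x] by simp
  show ?thesis unfolding e by (rule g) simp
qed

lemma normal_moments:
  assumes "0 \<le> \<sigma>" "distr Q borel X = normal_law \<mu> \<sigma>" and [measurable]: "X \<in> borel_measurable Q"
  shows "integrable Q X" "expectation X = \<mu>" "integrable Q (\<lambda>\<omega>. (X \<omega>)\<^sup>2)" "expectation (\<lambda>\<omega>. (X \<omega>)\<^sup>2) = \<mu>\<^sup>2 + \<sigma>\<^sup>2"
proof -
  interpret S: prob_space std_normal_distribution by (rule prob_space_normal_density) simp
  have d: "distr Q borel X = distr std_normal_distribution borel (\<lambda>x. \<mu> + \<sigma> * x)"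
    unfolding assms(2) by (rule normal_law_eq_distr[OF assms(1)])
  have i1: "integrable std_normal_distribution (\<lambda>x. x)"
    using integrable_std_normal_power[of 1] by simp
  have "S.expectation (\<lambda>x. x) = (\<integral>x. std_normal_density x *\<^sub>R x \<partial>lborel)"
    by (rule integral_density) auto
  then have e1: "S.expectation (\<lambda>x. x) = 0"
    using integral_std_normal_moment_odd[of 0] by simp
  have iff: "integrable Q (\<lambda>\<omega>. g (X \<omega>)) \<longleftrightarrow> integrable std_normal_distribution (\<lambda>x. g (\<mu> + \<sigma> * x))"
    if g: "g \<in> borel_measurable borel" for g :: "real \<Rightarrow> real"
  proof -
    have "integrable Q (\<lambda>\<omega>. g (X \<omega>)) \<longleftrightarrow> integrable (distr Q borel X) g"
      by (rule integrable_distr_eq[symmetric]) (use g in auto)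
    also have "\<dots> \<longleftrightarrow> integrable std_normal_distribution (\<lambda>x. g (\<mu> + \<sigma> * x))"
      unfolding d by (rule integrable_distr_eq) (use g in auto)
    finally show ?thesis .
  qed
  note i2 = integrable_std_normal_power[of 2] integral_std_normal_power(1)
  have e: "(\<mu> + \<sigma> * x)\<^sup>2 = \<mu>\<^sup>2 + 2 * \<mu> * \<sigma> * x + \<sigma>\<^sup>2 * x\<^sup>2" for x by (simp add: power2_eq_square algebra_simps)
  have I1: "integrable std_normal_distribution (\<lambda>x. \<mu> + \<sigma> * x)"
    by (intro Bochner_Integration.integrable_add integrable_mult_right i1 S.integrable_const)
  have I2: "integrable std_normal_distribution (\<lambda>x. (\<mu> + \<sigma> * x)\<^sup>2)"
    unfolding e by (intro Bochner_Integration.integrable_add integrable_mult_right i1 i2 S.integrable_const)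
  show "integrable Q X" by (rule iff[THEN iffD2, OF _ I1]) simp
  show "integrable Q (\<lambda>\<omega>. (X \<omega>)\<^sup>2)" by (rule iff[THEN iffD2, OF _ I2]) simp
  have "expectation X = (\<integral>u. u \<partial>distr Q borel X)" by (rule integral_distr[symmetric]) auto
  also have "\<dots> = S.expectation (\<lambda>x. \<mu> + \<sigma> * x)" unfolding d by (rule integral_distr) auto
  also have "\<dots> = \<mu>" using i1 S.prob_space by (simp add: e1)
  finally show "expectation X = \<mu>" .
  have "expectation (\<lambda>\<omega>. (X \<omega>)\<^sup>2) = (\<integral>u. u\<^sup>2 \<partial>distr Q borel X)" by (rule integral_distr[symmetric]) auto
  also have "\<dots> = S.expectation (\<lambda>x. (\<mu> + \<sigma> * x)\<^sup>2)" unfolding d by (rule integral_distr) auto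
  also have "\<dots> = \<mu>\<^sup>2 + \<sigma>\<^sup>2" unfolding e using i1 i2 S.prob_space by (simp add: e1)
  finally show "expectation (\<lambda>\<omega>. (X \<omega>)\<^sup>2) = \<mu>\<^sup>2 + \<sigma>\<^sup>2" .
qed

lemma W_integrable: "integrable Q (W t)" "integrable Q (\<lambda>\<omega>. (W t \<omega>)\<^sup>2)"
proof -
  obtain \<mu> \<sigma> where "0 \<le> \<sigma>" "distr Q borel (W t) = normal_law \<mu> \<sigma>"
    using comb_normal[where N=1 and a="\<lambda>_. 1" and x="\<lambda>_. t"] by auto
  then show "integrable Q (W t)" "integrable Q (\<lambda>\<omega>. (W t \<omega>)\<^sup>2)" using normal_moments W_meas by blast+
qed

lemma W_prod_integrable: "integrable Q (\<lambda>\<omega>. W s \<omega> * W t \<omega>)"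
proof (rule Bochner_Integration.integrable_bound)
  show "integrable Q (\<lambda>\<omega>. (W s \<omega>)\<^sup>2 + (W t \<omega>)\<^sup>2)" using W_integrable by auto
  have "\<bar>u * v\<bar> \<le> u\<^sup>2 + v\<^sup>2" for u v :: real
  proof -
    have "2 * \<bar>u\<bar> * \<bar>v\<bar> \<le> u\<^sup>2 + v\<^sup>2" using sum_squares_bound[of "\<bar>u\<bar>" "\<bar>v\<bar>"] by simp
    moreover have "\<bar>u\<bar> * \<bar>v\<bar> \<ge> 0" by simp
    ultimately show ?thesis unfolding abs_mult by linarith
  qed
  then show "AE \<omega> in Q. norm (W s \<omega> * W t \<omega>) \<le> norm ((W s \<omega>)\<^sup>2 + (W t \<omega>)\<^sup>2)" by simp
qed simp

lemma covariance_W: "covariance Q (W s) (W t) = expectation (\<lambda>\<omega>. W s \<omega> * W t \<omega>)"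
  unfolding covariance_def by (simp add: W_mean)

text \<open>The definition of a Gaussian process leaves the parameters of each combination open. The
  mean, which is 0, and the second moment, which expands into covariances, recover them.\<close>

lemma comb_law:
  fixes x :: "nat \<Rightarrow> 'a" and a :: "nat \<Rightarrow> real" and N :: nat
  defines "V \<equiv> \<Sum>i<N. \<Sum>k<N. a i * a k * cov_mat Q W N x $$ (i, k)"
  shows "V \<ge> 0" "distr Q borel (\<lambda>\<omega>. \<Sum>i<N. a i * W (x i) \<omega>) = normal_law 0 (sqrt (V))"
proof -
  let ?X = "\<lambda>\<omega>. \<Sum>i<N. a i * W (x i) \<omega>"
  obtain \<mu> \<sigma> where m: "0 \<le> \<sigma>" "distr Q borel ?X = normal_law \<mu> \<sigma>" using comb_normal by blast
  note nm = normal_moments[OF m, simplified]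
  have "expectation ?X = 0" using W_integrable by (simp add: W_mean)
  then have \<mu>: "\<mu> = 0" using nm by simp
  have sq: "(?X \<omega>)\<^sup>2 = (\<Sum>i<N. \<Sum>k<N. a i * a k * (W (x i) \<omega> * W (x k) \<omega>))" for \<omega>
    unfolding power2_eq_square sum_product by (intro sum.cong[OF refl]) (simp only: mult_ac)
  have "\<sigma>\<^sup>2 = expectation (\<lambda>\<omega>. (?X \<omega>)\<^sup>2)" using nm \<mu> by simp
  also have "\<dots> = (\<Sum>i<N. \<Sum>k<N. a i * a k * expectation (\<lambda>\<omega>. W (x i) \<omega> * W (x k) \<omega>))"
    unfolding sq using W_prod_integrable by (simp add: Bochner_Integration.integral_sum Bochner_Integration.integrable_sum)
  also have "\<dots> = V" unfolding V_def by (intro sum.cong[OF refl]) (simp add: cov_mat_def covariance_W)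
  finally have V: "V = \<sigma>\<^sup>2" by simp
  then show "V \<ge> 0" by simp
  show "distr Q borel ?X = normal_law 0 (sqrt (V))" using m V \<mu> by simp
qed

end


section \<open>Scores, likelihood and criterion in eigencoordinates\<close>

locale gp_eigenbasis = centered_gaussian_process Q W + eigenbasis N "cov_mat Q W N x" J lam e
  for Q :: "'w measure" and W :: "'a \<Rightarrow> 'w \<Rightarrow> real" and N :: nat and x :: "nat \<Rightarrow> 'a"
    and J :: "'j set" and lam :: "'j \<Rightarrow> real" and e :: "'j \<Rightarrow> real Matrix.vec"
begin

definition coef :: "(nat \<Rightarrow> real) \<Rightarrow> 'j \<Rightarrow> real" where
  "coef v j = (\<Sum>i<N. v i * ev j i)"

lemma f_coef_eq: "j \<in> J \<Longrightarrow> f_coef N x e g j = coef (\<lambda>i. g (x i)) j"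
  by (simp add: f_coef_def coef_def scalar_prod_def design_vec_def atLeast0LessThan)

lemma Z_coef_eq: "j \<in> J \<Longrightarrow> Z_coef N x e g y j = coef (\<lambda>i. y i - g (x i)) j"
  by (simp add: Z_coef_def coef_def scalar_prod_def design_vec_def atLeast0LessThan)

lemma coef_diff: "coef (\<lambda>i. u i - v i) j = coef u j - coef v j"
  by (simp add: coef_def left_diff_distrib sum_subtractf)

lemma parseval_coef: "(\<Sum>j\<in>J. (coef v j)\<^sup>2) = (\<Sum>i<N. (v i)\<^sup>2)"
  unfolding coef_def by (rule parseval)

lemma sum_coef: "(\<Sum>j\<in>J. t j * coef v j) = (\<Sum>i<N. (\<Sum>j\<in>J. t j * ev j i) * v i)"
  unfolding coef_def sum_distrib_left sum_distrib_right
  by (subst sum.swap) (intro sum.cong[OF refl], simp only: mult_ac)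

text \<open>\<open>lam j\<close> is the variance of the combination of the process with coefficient
  vector \<open>e j\<close>.\<close>

lemma lam_nonneg:
  assumes "j \<in> J" shows "lam j \<ge> 0"
proof -
  have "(\<Sum>k\<in>J. (if k = j then 1 else 0)\<^sup>2 * lam k) = lam j"
    using assms by (simp add: if_distrib[of "\<lambda>x. x ^ 2"] if_distrib[of "\<lambda>x. x * _"] cong: if_cong)
  then show ?thesis using comb_law(1)[where x=x and N=N and a="\<lambda>i. \<Sum>k\<in>J. (if k = j then 1 else 0) * ev k i"]
    unfolding quadratic_form_comb by simp
qed

text \<open>Rotation invariance of the standard normal law, on the level of linear combinations: an
  orthonormal basis preserves the sum of squared coefficients.\<close>

lemma obs_standard_gaussian_family:
  "standard_gaussian_family (obs_law N x f) J (\<lambda>j y. Z_coef N x e f y j)"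
proof -
  interpret O: prob_space "obs_law N x f" by (rule prob_space_obs_law)
  have 1: "(\<lambda>y. Z_coef N x e f y j) \<in> borel_measurable (obs_law N x f)" if "j \<in> J" for j
    using measurable_obs_comb[of "ev j" "\<lambda>i. f (x i)" N]
    unfolding Z_coef_eq[OF that] coef_def by (simp add: mult.commute)
  have "(\<Sum>j\<in>J. t j * Z_coef N x e f y j) = (\<Sum>i<N. (\<Sum>j\<in>J. t j * ev j i) * (y i - f (x i)))" for t y
    using sum_coef[of t "\<lambda>i. y i - f (x i)"] by (simp add: Z_coef_eq)
  then have 2: "distr (obs_law N x f) borel (\<lambda>y. \<Sum>j\<in>J. t j * Z_coef N x e f y j) = normal_law 0 (sqrt (\<Sum>j\<in>J. (t j)\<^sup>2 * 1))" for t
    using distr_obs_law_comb[of N x f "\<lambda>i. \<Sum>j\<in>J. t j * ev j i"] by (simp add: sum_sq_comb)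
  show ?thesis by unfold_locales (use 1 2 in auto)
qed

definition scores :: "real \<Rightarrow> 'j \<Rightarrow> 'w \<Rightarrow> real" where
  "scores c j \<omega> = coef (\<lambda>i. sqrt c * W (x i) \<omega>) j"

lemma scores_gaussian_family:
  assumes "c \<ge> 0"
  shows "gaussian_family Q J (scores c) (\<lambda>j. c * lam j)"
proof
  fix t :: "'j \<Rightarrow> real"
  have "(\<Sum>j\<in>J. t j * scores c j \<omega>) = (\<Sum>i<N. (\<Sum>j\<in>J. (sqrt c * t j) * ev j i) * W (x i) \<omega>)" for \<omega>
    unfolding scores_def sum_coef sum_distrib_right by (intro sum.cong[OF refl]) (simp only: mult_ac)
  moreover have "(\<Sum>j\<in>J. (sqrt c * t j)\<^sup>2 * lam j) = (\<Sum>j\<in>J. (t j)\<^sup>2 * (c * lam j))"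
    using assms by (simp add: power_mult_distrib mult_ac)
  ultimately show "distr Q borel (\<lambda>\<omega>. \<Sum>j\<in>J. t j * scores c j \<omega>) = normal_law 0 (sqrt (\<Sum>j\<in>J. (t j)\<^sup>2 * (c * lam j)))"
    using comb_law(2)[where x=x and N=N and a="\<lambda>i. \<Sum>j\<in>J. (sqrt c * t j) * ev j i"] unfolding quadratic_form_comb by simp
next
  show "scores c j \<in> borel_measurable Q" for j
    unfolding scores_def[abs_def] coef_def by measurable
qed (use assms lam_nonneg in auto)

lemma sq_dist_design_eq: "sq_dist_design N x w f = (\<Sum>j\<in>J. (coef (\<lambda>i. w (x i)) j - coef (\<lambda>i. f (x i)) j)\<^sup>2)"
  unfolding coef_diff[symmetric] parseval_coef
  by (simp add: sq_dist_design_def design_vec_def scalar_prod_def atLeast0LessThan power2_eq_square)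

text \<open>By Parseval's identity the squared norm in the exponent is the same in eigencoordinates,
  so the likelihood is a product over \<open>J\<close> of exactly the weights treated for Gaussian
  families.\<close>

lemma likelihood_eq:
  "likelihood N x y w = (1 / sqrt (2 * pi)) ^ N * (\<Prod>j\<in>J. exp (- (coef (\<lambda>i. w (x i)) j - coef y j)\<^sup>2 / 2))"
proof -
  have "likelihood N x y w = (1 / sqrt (2 * pi)) ^ N * exp (- (\<Sum>i<N. (w (x i) - y i)\<^sup>2) / 2)"
    unfolding likelihood_def normal_density_def
    by (simp add: prod.distrib prod_dividef exp_sum sum_negf sum_divide_distrib power2_commute power_one_over flip: sum_negf)
  also have "(\<Sum>i<N. (w (x i) - y i)\<^sup>2) = (\<Sum>j\<in>J. (coef (\<lambda>i. w (x i)) j - coef y j)\<^sup>2)"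
    unfolding coef_diff[symmetric] parseval_coef ..
  also have "exp (- (\<Sum>j\<in>J. (coef (\<lambda>i. w (x i)) j - coef y j)\<^sup>2) / 2) = (\<Prod>j\<in>J. exp (- (coef (\<lambda>i. w (x i)) j - coef y j)\<^sup>2 / 2))"
    by (simp add: exp_sum sum_divide_distrib flip: sum_negf)
  finally show ?thesis .
qed

lemma lik_criterion_eq:
  assumes "c \<ge> 0"
  shows "lik_criterion N (cov_mat Q W N x) y c =
    DL J lam (f_coef N x e f) c + R1L J lam (f_coef N x e f) (Z_coef N x e f y) c
      + R2L J lam (Z_coef N x e f y) c + (\<Sum>j\<in>J. (Z_coef N x e f y j)\<^sup>2)"
proof -
  let ?a = "f_coef N x e f" and ?z = "Z_coef N x e f y"
  have p: "1 + c * lam j > 0" if "j \<in> J" for j using assms lam_nonneg[OF that] by (simp add: add_pos_nonneg)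
  have y: "coef y j = ?a j + ?z j" if "j \<in> J" for j
    using that by (simp add: f_coef_eq Z_coef_eq coef_diff)
  have "lik_criterion N (cov_mat Q W N x) y c = ln (\<Prod>j\<in>J. 1 + c * lam j) + (\<Sum>j\<in>J. (coef y j)\<^sup>2 / (1 + c * lam j))"
    unfolding lik_criterion_def det_Sigma coef_def using p by (simp add: inverse_Sigma_form)
  also have "ln (\<Prod>j\<in>J. 1 + c * lam j) = (\<Sum>j\<in>J. ln (1 + c * lam j))"
    using p by (intro ln_prod) (auto dest: p)
  also have "\<dots> + (\<Sum>j\<in>J. (coef y j)\<^sup>2 / (1 + c * lam j)) =
     (\<Sum>j\<in>J. (?a j)\<^sup>2 / (1 + c * lam j) + (ln (1 + c * lam j) - c * lam j / (1 + c * lam j))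
       + 2 * (?z j * ?a j / (1 + c * lam j)) - ((?z j)\<^sup>2 - 1) * (c * lam j) / (1 + c * lam j) + (?z j)\<^sup>2)"
    unfolding sum.distrib[symmetric]
  proof (intro sum.cong[OF refl])
    fix j assume j: "j \<in> J"
    \<comment> \<open>The square of the noise is centred: with u = c \<lambda> and z the noise
      coefficient, z^2 / (1 + u) = z^2 - (z^2 - 1) u / (1 + u) - u / (1 + u). The last term
      completes the summand of \<open>D2L\<close>.\<close>
    have "(coef y j)\<^sup>2 / (1 + c * lam j) = (?a j)\<^sup>2 / (1 + c * lam j) - c * lam j / (1 + c * lam j)
       + 2 * (?z j * ?a j / (1 + c * lam j)) - ((?z j)\<^sup>2 - 1) * (c * lam j) / (1 + c * lam j) + (?z j)\<^sup>2"
      unfolding y[OF j] using p[OF j] by (simp add: divide_simps) (simp add: algebra_simps power2_eq_square)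
    then show "ln (1 + c * lam j) + (coef y j)\<^sup>2 / (1 + c * lam j) =
     (?a j)\<^sup>2 / (1 + c * lam j) + (ln (1 + c * lam j) - c * lam j / (1 + c * lam j))
       + 2 * (?z j * ?a j / (1 + c * lam j)) - ((?z j)\<^sup>2 - 1) * (c * lam j) / (1 + c * lam j) + (?z j)\<^sup>2" by simp
  qed
  also have "\<dots> = DL J lam ?a c + R1L J lam ?a ?z c + R2L J lam ?z c + (\<Sum>j\<in>J. (?z j)\<^sup>2)"
    unfolding DL_def D1L_def D2L_def R1L_def R2L_def by (simp only: sum.distrib sum_subtractf sum_distrib_left diff_conv_add_uminus sum_negf)
  finally show ?thesis .
qed

end

section \<open>The posterior second moment\<close>

context gp_eigenbasis
begin

lemma measurable_eval: "(\<lambda>w. w t) \<in> borel_measurable (\<Pi>\<^sub>M t\<in>UNIV. borel)"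
  by (rule measurable_component_singleton) simp

lemma measurable_coef: "(\<lambda>w. coef (\<lambda>i. w (x i)) j) \<in> borel_measurable (\<Pi>\<^sub>M t\<in>UNIV. borel)"
  unfolding coef_def by (intro borel_measurable_sum borel_measurable_times measurable_eval borel_measurable_const)

lemma measurable_likelihood: "likelihood N x y \<in> borel_measurable (\<Pi>\<^sub>M t\<in>UNIV. borel)"
  unfolding likelihood_eq[abs_def]
  by (intro borel_measurable_prod borel_measurable_times borel_measurable_const borel_measurable_exp borel_measurable_diff
      borel_measurable_power borel_measurable_divide borel_measurable_uminus measurable_coef borel_measurable_continuous_on_indicator measurable_compose[OF _ borel_measurable_exp])

lemma measurable_sq_dist: "(\<lambda>w. sq_dist_design N x w f) \<in> borel_measurable (\<Pi>\<^sub>M t\<in>UNIV. borel)"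
  unfolding sq_dist_design_eq[abs_def]
  by (intro borel_measurable_sum borel_measurable_power borel_measurable_diff measurable_coef borel_measurable_const)

lemma measurable_scaled_process: "(\<lambda>\<omega> t. sqrt c * W t \<omega>) \<in> measurable Q (\<Pi>\<^sub>M t\<in>UNIV. borel)"
  by (rule measurable_PiM_single') (auto simp: space_PiM)

lemma likelihood_pos: "likelihood N x y w > 0"
  unfolding likelihood_def by (intro prod_pos) (simp add: normal_density_pos)

text \<open>The sum is the exact posterior mean of the squared distance, coordinate by coordinate
  variance plus squared bias, and the bound is Markov's inequality. Posterior normality is not
  derived; the mean is computed as a quotient of two prior integrals, in which the constants
  cancel.\<close>

lemma posterior_sq_dist_le:
  assumes "c \<ge> 0" and "r > 0"
  shows "measure (posterior Q W N x c y) {w. sq_dist_design N x w f \<ge> r} \<le>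
    (\<Sum>j\<in>J. c * lam j / (1 + c * lam j) + (c * lam j / (1 + c * lam j) * coef y j - coef (\<lambda>i. f (x i)) j)\<^sup>2) / r"
proof -
  let ?P = "\<Pi>\<^sub>M (t::'a)\<in>UNIV. (borel :: real measure)"
  let ?L = "likelihood N x y" and ?S = "\<lambda>w. sq_dist_design N x w f"
  let ?C = "(1 / sqrt (2 * pi)) ^ N" and ?a = "coef (\<lambda>i. f (x i))"
  let ?m = "\<Sum>j\<in>J. c * lam j / (1 + c * lam j) + (c * lam j / (1 + c * lam j) * coef y j - ?a j)\<^sup>2"
  let ?pr = "prior Q W c"
  interpret G: gaussian_family Q J "scores c" "\<lambda>j. c * lam j" by (rule scores_gaussian_family[OF assms(1)])
  define G where "G \<omega> = (\<Prod>j\<in>J. exp (- (scores c j \<omega> - coef y j)\<^sup>2 / 2))" for \<omega>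
  have C: "?C > 0" by simp
  have L: "?L (\<lambda>t. sqrt c * W t \<omega>) = ?C * G \<omega>" for \<omega>
    unfolding likelihood_eq G_def scores_def ..
  have S: "?S (\<lambda>t. sqrt c * W t \<omega>) = (\<Sum>j\<in>J. (scores c j \<omega> - ?a j)\<^sup>2)" for \<omega>
    unfolding sq_dist_design_eq scores_def ..
  note mT = measurable_scaled_process[of c] and mL = measurable_likelihood[of y] and mS = measurable_sq_dist
  have mG: "G \<in> borel_measurable Q"
    unfolding G_def[abs_def] using G.meas by (intro borel_measurable_prod) auto
  have G0: "G \<omega> > 0" for \<omega> unfolding G_def by (intro prod_pos) auto
  have G1: "G \<omega> \<le> 1" for \<omega> unfolding G_def by (intro prod_le_1) auto
  have iG: "integrable Q G"
    by (rule integrable_const_bound[where B=1]) (use G0 G1 mG in \<open>auto simp: less_imp_le\<close>)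
  have K: "expectation G > 0"
    using integral_less_AE_space[of "\<lambda>_. 0" G] G0 iG emeasure_space_1 by simp
  have sp: "sets ?pr = sets ?P" unfolding prior_def by simp
  have mL': "?L \<in> borel_measurable ?pr" "?S \<in> borel_measurable ?pr" using mL mS by (auto simp: measurable_cong_sets[OF sp refl])
  define Z where "Z = (\<integral>v. ?L v \<partial>?pr)"
  have Z: "Z = ?C * expectation G"
    unfolding Z_def prior_def integral_distr[OF mT mL] L by simp
  have Z0: "Z > 0" using C K unfolding Z by simp
  have iL: "integrable ?pr ?L"
    unfolding prior_def integrable_distr_eq[OF mT mL] L using iG by simp
  have SL: "?S (\<lambda>t. sqrt c * W t \<omega>) * ?L (\<lambda>t. sqrt c * W t \<omega>) = ?C * (\<Sum>j\<in>J. (scores c j \<omega> - ?a j)\<^sup>2 * G \<omega>)" for \<omega>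
    unfolding S L sum_distrib_left sum_distrib_right by (intro sum.cong[OF refl]) (simp only: mult_ac)
  note sm = G.posterior_second_moment[of _ "?a _" "coef y", folded G_def]
  have mSL: "(\<lambda>w. ?S w * ?L w) \<in> borel_measurable ?P" using mS mL by (intro borel_measurable_times)
  have iSL: "integrable ?pr (\<lambda>w. ?S w * ?L w)"
    unfolding prior_def integrable_distr_eq[OF mT mSL] SL using sm(1) by (intro integrable_mult_right Bochner_Integration.integrable_sum)
  have ESL: "(\<integral>w. ?S w * ?L w \<partial>?pr) = Z * ?m"
  proof -
    have "(\<integral>w. ?S w * ?L w \<partial>?pr) = expectation (\<lambda>\<omega>. ?C * (\<Sum>j\<in>J. (scores c j \<omega> - ?a j)\<^sup>2 * G \<omega>))"
      unfolding prior_def integral_distr[OF mT mSL] SL ..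
    also have "\<dots> = ?C * (\<Sum>j\<in>J. expectation (\<lambda>\<omega>. (scores c j \<omega> - ?a j)\<^sup>2 * G \<omega>))"
      using sm(1) by (simp add: Bochner_Integration.integral_sum)
    also have "(\<Sum>j\<in>J. expectation (\<lambda>\<omega>. (scores c j \<omega> - ?a j)\<^sup>2 * G \<omega>)) = ?m * expectation G"
      unfolding sum_distrib_right by (intro sum.cong[OF refl] sm(2))
    finally show ?thesis unfolding Z by (simp only: mult_ac)
  qed
  let ?po = "posterior Q W N x c y"
  have po: "?po = density ?pr (\<lambda>w. ennreal (?L w / Z))" unfolding posterior_def Z_def ..
  have nn: "AE w in ?pr. 0 \<le> ?L w / Z" using Z0 likelihood_pos by (auto simp: less_imp_le)
  have md: "(\<lambda>w. ?L w / Z) \<in> borel_measurable ?pr" using mL'(1) by (intro borel_measurable_divide) auto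
  have q: "(?L w / Z) *\<^sub>R ?S w = (?S w * ?L w) / Z" for w by simp
  have ipo: "integrable ?po ?S"
    unfolding po integrable_density[OF mL'(2) md nn] q using iSL by (rule integrable_divide)
  have Epo: "(\<integral>w. ?S w \<partial>?po) = ?m"
    unfolding po integral_density[OF mL'(2) md nn] q using ESL Z0 by simp
  have spo: "space ?po = UNIV" unfolding posterior_def prior_def by (simp add: space_PiM)
  have S0: "?S w \<ge> 0" for w unfolding sq_dist_design_eq by (intro sum_nonneg) simp
  have "measure ?po {w \<in> space ?po. ?S w \<ge> r} \<le> (\<integral>w. ?S w \<partial>?po) / r"
    by (rule integral_Markov_inequality_measure[where A="{}"]) (use ipo S0 assms in auto)
  then show ?thesis unfolding spo Epo by simp
qed

text \<open>With u = c \<lambda>, the posterior mean misses the coefficient a by (u z - a) / (1 +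
  u). In its square the term in a^2 is below the summand of \<open>D1L\<close>, the mixed term is
  that of \<open>R3\<close>, and u^2 z^2 / (1 + u)^2 is the summand of \<open>R4\<close> plus u^2 /
  (1 + u)^2, which is at most u / (1 + u). This gives the second copy of \<open>s2\<close>; the
  first is the posterior variance.\<close>

lemma posterior_sq_dist_le_criterion:
  fixes f :: "'a \<Rightarrow> real" and y :: "nat \<Rightarrow> real"
  assumes "c \<ge> 0" and "r > 0"
  defines "a \<equiv> f_coef N x e f" and "z \<equiv> Z_coef N x e f y"
  shows "measure (posterior Q W N x c y) {w. sq_dist_design N x w f \<ge> r} \<le>
    (D1L J lam a c + 2 * s2 J lam c + R3 J lam a z c + R4 J lam z c) / r"
proof -
  have "(\<Sum>j\<in>J. c * lam j / (1 + c * lam j) + (c * lam j / (1 + c * lam j) * coef y j - coef (\<lambda>i. f (x i)) j)\<^sup>2)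
     \<le> (\<Sum>j\<in>J. (a j)\<^sup>2 / (1 + c * lam j) + 2 * (c * lam j / (1 + c * lam j)) - 2 * (c * lam j * z j * a j / (1 + c * lam j)\<^sup>2)
          + (c * lam j)\<^sup>2 * ((z j)\<^sup>2 - 1) / (1 + c * lam j)\<^sup>2)"
  proof (rule sum_mono)
    fix j assume j: "j \<in> J"
    define u where "u = c * lam j"
    have u: "u \<ge> 0" using assms lam_nonneg[OF j] by (simp add: u_def)
    have y: "coef y j = a j + z j" "coef (\<lambda>i. f (x i)) j = a j"
      using j by (simp_all add: a_def z_def f_coef_eq Z_coef_eq coef_diff)
    have "u / (1 + u) * (a j + z j) - a j = (u * z j - a j) / (1 + u)"
      using u by (simp add: field_simps)
    then have e: "(u / (1 + u) * (a j + z j) - a j)\<^sup>2 = (u * z j - a j)\<^sup>2 / (1 + u)\<^sup>2" by (simp add: power_divide)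
    have A: "(a j)\<^sup>2 / (1 + u)\<^sup>2 \<le> (a j)\<^sup>2 / (1 + u)"
      using u by (intro divide_left_mono) (auto simp: power2_eq_square)
    have B: "u\<^sup>2 / (1 + u)\<^sup>2 \<le> u / (1 + u)"
      using u by (simp add: divide_simps power2_eq_square) (simp add: algebra_simps)
    have "(u * z j - a j)\<^sup>2 / (1 + u)\<^sup>2 = (a j)\<^sup>2 / (1 + u)\<^sup>2 - 2 * (u * z j * a j / (1 + u)\<^sup>2) + u\<^sup>2 * ((z j)\<^sup>2 - 1) / (1 + u)\<^sup>2 + u\<^sup>2 / (1 + u)\<^sup>2"
      by (simp add: add_divide_distrib[symmetric] diff_divide_distrib[symmetric]) (simp add: power2_eq_square algebra_simps)
    with A B show "c * lam j / (1 + c * lam j) + (c * lam j / (1 + c * lam j) * coef y j - coef (\<lambda>i. f (x i)) j)\<^sup>2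
     \<le> (a j)\<^sup>2 / (1 + c * lam j) + 2 * (c * lam j / (1 + c * lam j)) - 2 * (c * lam j * z j * a j / (1 + c * lam j)\<^sup>2)
          + (c * lam j)\<^sup>2 * ((z j)\<^sup>2 - 1) / (1 + c * lam j)\<^sup>2"
      unfolding y e u_def[symmetric] by linarith
  qed
  also have "\<dots> = D1L J lam a c + 2 * s2 J lam c + R3 J lam a z c + R4 J lam z c"
    unfolding D1L_def s2_def R3_def R4_def
    by (simp only: sum.distrib sum_subtractf sum_distrib_left diff_conv_add_uminus sum_negf mult_minus_left)
  finally have "(\<Sum>j\<in>J. c * lam j / (1 + c * lam j) + (c * lam j / (1 + c * lam j) * coef y j - coef (\<lambda>i. f (x i)) j)\<^sup>2) / r
     \<le> (D1L J lam a c + 2 * s2 J lam c + R3 J lam a z c + R4 J lam z c) / r"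
    using assms(2) by (intro divide_right_mono) auto
  with posterior_sq_dist_le[OF assms(1,2)] show ?thesis by (rule order_trans)
qed

end

section \<open>Contraction outside small events\<close>

lemma DL_nonneg_parts:
  assumes "\<And>j. j \<in> J \<Longrightarrow> 0 \<le> lam j" "0 \<le> c"
  shows "0 \<le> D1L J lam a c" "0 \<le> s2 J lam c" "0 \<le> D2L J lam c"
proof -
  have p: "0 \<le> c * lam j" if "j \<in> J" for j using assms that by simp
  show "0 \<le> D1L J lam a c" unfolding D1L_def using p by (intro sum_nonneg divide_nonneg_nonneg) (auto intro: add_nonneg_nonneg)
  show "0 \<le> s2 J lam c" unfolding s2_def using p by (intro sum_nonneg divide_nonneg_nonneg) (auto intro: add_nonneg_nonneg)
  have "u / (1 + u) \<le> ln (1 + u)" if "0 \<le> u" for u :: real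
  proof -
    have "- ln (1 + u) = ln (1 / (1 + u))" using that by (simp add: ln_div)
    also have "\<dots> \<le> 1 / (1 + u) - 1" using that by (intro ln_le_minus_one) simp
    also have "\<dots> = - (u / (1 + u))" using that by (simp add: field_simps)
    finally show ?thesis by simp
  qed
  then show "0 \<le> D2L J lam c" unfolding D2L_def using p by (intro sum_nonneg) simp
qed

lemma c_interval_nonneg: "c \<in> c_interval m N \<Longrightarrow> 0 \<le> c"
proof (cases "N = 0")
  case False
  then have "0 \<le> ln (real N) / real N" by simp
  then show "c \<in> c_interval m N \<Longrightarrow> 0 \<le> c" unfolding c_interval_def by auto
\<comment> \<open>At \<open>N = 0\<close> the left endpoint is 0, because division by zero yields
  zero.\<close>
qed (simp add: c_interval_def)

text \<open>\<open>A\<close> need not be measurable: nonmeasurable sets have measure \<open>0\<close>.\<close>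

lemma (in finite_measure) measure_le_of_subset:
  assumes "B \<in> sets M" "A \<subseteq> B"
  shows "measure M A \<le> measure M B"
  using assms by (cases "A \<in> sets M") (auto intro: finite_measure_mono simp: measure_notin_sets)

context gp_eigenbasis
begin

text \<open>Minimality gives D(ch) / 2 \<le> D(ch) + R1(ch) + R2(ch) \<le> D(c) + R1(c) + R2(c)
  \<le> 3 D(c) / 2, whence the factor 3. The numerator of the Markov bound is at most D1 + 2 C D2 +
  D \<le> 2 (1 + C) D at \<open>ch\<close>, so the constant is 3 times 2 (1 + C).\<close>

lemma posterior_bound_on_good_event:
  fixes f :: "'a \<Rightarrow> real" and y :: "nat \<Rightarrow> real"
  defines "a \<equiv> f_coef N x e f" and "z \<equiv> Z_coef N x e f y"
  assumes ch: "is_arg_min (lik_criterion N (cov_mat Q W N x) y) (\<lambda>c. c \<in> I) ch" and I: "\<And>c. c \<in> I \<Longrightarrow> 0 \<le> c"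
    and R12: "\<And>c. c \<in> I \<Longrightarrow> \<bar>R1L J lam a z c\<bar> + \<bar>R2L J lam z c\<bar> \<le> DL J lam a c / 2"
    and R34: "\<And>c. c \<in> I \<Longrightarrow> \<bar>R3 J lam a z c\<bar> + \<bar>R4 J lam z c\<bar> \<le> DL J lam a c"
    and D0: "\<And>c. c \<in> I \<Longrightarrow> 0 < DL J lam a c"
    and s2: "\<And>c. c \<in> I \<Longrightarrow> s2 J lam c \<le> C * D2L J lam c" and "C \<ge> 0" "M > 0"
  shows "measure (posterior Q W N x ch y) {w. sq_dist_design N x w f \<ge> M * (INF c\<in>I. DL J lam a c)} \<le> 6 * (1 + C) / M"
proof -
  let ?D = "DL J lam a"
  have chI: "ch \<in> I" using ch by (simp add: is_arg_min_def)
  have min: "lik_criterion N (cov_mat Q W N x) y ch \<le> lik_criterion N (cov_mat Q W N x) y c" if "c \<in> I" for c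
    using ch that by (auto simp: is_arg_min_def not_less)
  have "?D ch / 3 \<le> ?D c" if c: "c \<in> I" for c
  proof -
    have "?D ch + R1L J lam a z ch + R2L J lam z ch \<le> ?D c + R1L J lam a z c + R2L J lam z c"
      using min[OF c] unfolding lik_criterion_eq[OF I[OF c], of y f] lik_criterion_eq[OF I[OF chI], of y f] a_def z_def by simp
    then show ?thesis using R12[OF c] R12[OF chI] by (auto simp: abs_le_iff)
  qed
  then have inf: "?D ch / 3 \<le> (INF c\<in>I. ?D c)" using chI by (intro cINF_greatest) auto
  then have inf0: "0 < (INF c\<in>I. ?D c)" using D0[OF chI] by linarith
  then have r: "0 < M * (INF c\<in>I. ?D c)" using \<open>M > 0\<close> by simp
  have "0 \<le> s2 J lam ch" "0 \<le> D1L J lam a ch" using DL_nonneg_parts lam_nonneg I[OF chI] by metis+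
  then have "D1L J lam a ch + 2 * s2 J lam ch + R3 J lam a z ch + R4 J lam z ch
     \<le> D1L J lam a ch + 2 * (C * D2L J lam ch) + ?D ch"
    using R34[OF chI] s2[OF chI] by (auto simp: abs_le_iff)
  also have "\<dots> \<le> 2 * (1 + C) * ?D ch"
  proof -
    have "0 \<le> C * D1L J lam a ch" using \<open>C \<ge> 0\<close> \<open>0 \<le> D1L J lam a ch\<close> by simp
    moreover have "0 \<le> C * D2L J lam ch" using s2[OF chI] \<open>0 \<le> s2 J lam ch\<close> by linarith
    moreover have "0 \<le> D2L J lam ch"
      using DL_nonneg_parts(3) lam_nonneg I[OF chI] by metis
    ultimately show ?thesis unfolding DL_def by (simp add: algebra_simps)
  qed
  also have "\<dots> \<le> 2 * (1 + C) * (3 * (INF c\<in>I. ?D c))"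
    using inf \<open>C \<ge> 0\<close> by (intro mult_left_mono) auto
  finally have "(D1L J lam a ch + 2 * s2 J lam ch + R3 J lam a z ch + R4 J lam z ch) / (M * (INF c\<in>I. ?D c))
     \<le> (2 * (1 + C) * (3 * (INF c\<in>I. ?D c))) / (M * (INF c\<in>I. ?D c))"
    using r by (intro divide_right_mono) auto
  also have "\<dots> = 6 * (1 + C) / M" using inf0 by simp
  finally show ?thesis
    using posterior_sq_dist_le_criterion[OF I[OF chI] r, of y f] unfolding a_def z_def by simp
qed

end

lemma gp_eigenbasisI:
  assumes "mean_zero_gaussian_process Q W" "eb_setting Q W m N x J lam e chat"
  shows "gp_eigenbasis Q W (N n) (x n) (J n) (lam n) (e n)"
  by unfold_locales (use assms in \<open>auto simp: eb_setting_def cov_mat_def\<close>)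

text \<open>As soon as \<open>M n\<close> exceeds 6 (1 + C) / \<epsilon>, the event that the
  posterior mass exceeds \<epsilon> lies inside \<open>B n\<close>. The argument rests on this
  inclusion in a measurable set and leaves open whether the event itself is measurable.\<close>

lemma posterior_contractsI:
  assumes gp: "mean_zero_gaussian_process Q W" and eb: "eb_setting Q W m N x J lam e chat"
    and B: "\<And>n. B n \<in> sets (obs_space (N n))"
    and B0: "(\<lambda>n. measure (obs_law (N n) (x n) f) (B n)) \<longlonglongrightarrow> 0" and "C \<ge> 0"
    and good: "\<forall>\<^sub>F n in sequentially. \<forall>y\<in>space (obs_space (N n)) - B n. \<forall>c\<in>c_interval m (N n).
       (let a = f_coef (N n) (x n) (e n) f; z = Z_coef (N n) (x n) (e n) f y in
        \<bar>R1L (J n) (lam n) a z c\<bar> + \<bar>R2L (J n) (lam n) z c\<bar> \<le> DL (J n) (lam n) a c / 2 \<and>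
        \<bar>R3 (J n) (lam n) a z c\<bar> + \<bar>R4 (J n) (lam n) z c\<bar> \<le> DL (J n) (lam n) a c \<and>
        0 < DL (J n) (lam n) a c \<and> s2 (J n) (lam n) c \<le> C * D2L (J n) (lam n) c)"
  shows "posterior_contracts Q W m N x J lam e chat f"
  unfolding posterior_contracts_def conv0_in_prob_def
proof (intro allI impI)
  fix M :: "nat \<Rightarrow> real" and \<epsilon> :: real
  assume M: "filterlim M at_top sequentially" and \<epsilon>: "\<epsilon> > 0"
  let ?T = "\<lambda>n y. measure (posterior Q W (N n) (x n) (chat n y) y)
             {w. M n * (INF c\<in>c_interval m (N n). DL (J n) (lam n) (f_coef (N n) (x n) (e n) f) c) \<le> sq_dist_design (N n) (x n) w f}"
  let ?A = "\<lambda>n. {y \<in> space (obs_law (N n) (x n) f). \<epsilon> < \<bar>?T n y\<bar>}"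
  have "\<forall>\<^sub>F n in sequentially. M n > 6 * (1 + C) / \<epsilon>"
    using M by (simp add: filterlim_at_top_dense)
  then have "\<forall>\<^sub>F n in sequentially. measure (obs_law (N n) (x n) f) (?A n) \<le> measure (obs_law (N n) (x n) f) (B n)"
    using good
  proof eventually_elim
    case (elim n)
    interpret G: gp_eigenbasis Q W "N n" "x n" "J n" "lam n" "e n" by (rule gp_eigenbasisI[OF gp eb])
    interpret O: prob_space "obs_law (N n) (x n) f" by (rule prob_space_obs_law)
    have "0 \<le> 6 * (1 + C) / \<epsilon>" using \<epsilon> \<open>C \<ge> 0\<close> by simp
    then have M0: "M n > 0" using elim(1) by linarith
    have "?A n \<subseteq> B n"
    proof
      fix y assume y: "y \<in> ?A n"
      show "y \<in> B n"
      proof (rule ccontr)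
        assume "y \<notin> B n"
        then have yB: "y \<in> space (obs_space (N n)) - B n" using y by simp
        then have am: "is_arg_min (lik_criterion (N n) (cov_mat Q W (N n) (x n)) y) (\<lambda>c. c \<in> c_interval m (N n)) (chat n y)"
          using eb unfolding eb_setting_def lik_estimator_def by auto
        note g = elim(2)[rule_format, OF yB, unfolded Let_def]
        have "?T n y \<le> 6 * (1 + C) / M n"
          using g M0 \<open>C \<ge> 0\<close> c_interval_nonneg by (intro G.posterior_bound_on_good_event[OF am]) auto
        also have "\<dots> < \<epsilon>" using elim(1) M0 \<epsilon> by (simp add: field_simps)
        finally show False using y by simp
      qed
    qed
    then show ?case using B[of n] by (intro O.measure_le_of_subset) auto
  qed
  then show "(\<lambda>n. measure (obs_law (N n) (x n) f) (?A n)) \<longlonglongrightarrow> 0"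
    by (intro tendsto_sandwich[OF _ _ tendsto_const B0]) auto
qed

section \<open>Suprema over the interval as measurable events\<close>

lemma sup_exceeds_measurable:
  fixes h :: "real \<Rightarrow> 'b \<Rightarrow> real"
  assumes m: "\<And>c. c \<in> {a..b} \<Longrightarrow> h c \<in> borel_measurable M"
    and c: "\<And>y. y \<in> space M \<Longrightarrow> continuous_on {a..b} (\<lambda>c. h c y)"
  shows "{y \<in> space M. \<exists>c\<in>{a..b}. h c y > t} \<in> sets M"
proof -
  obtain T where T: "countable T" "T \<subseteq> {a..b}" "{a..b} \<subseteq> closure T" using separable by blast
  have "{y \<in> space M. \<exists>c\<in>{a..b}. h c y > t} = (\<Union>c\<in>T. {y \<in> space M. h c y > t})" (is "?L = ?R")
  proof (intro equalityI subsetI)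
    fix y assume y: "y \<in> ?L"
    show "y \<in> ?R"
    proof (rule ccontr)
      assume n: "y \<notin> ?R"
      have "closed {c \<in> {a..b}. h c y \<le> t}"
        using y by (intro continuous_on_closed_Collect_le[OF c] continuous_on_const) auto
      moreover have "T \<subseteq> {c \<in> {a..b}. h c y \<le> t}" using n y T(2) by (auto simp: not_less)
      ultimately have "{a..b} \<subseteq> {c \<in> {a..b}. h c y \<le> t}" using T(3) closure_minimal by blast
      \<comment> \<open>By continuity a bound on the countable dense set \<open>T\<close> extends to
        the whole interval, contradicting the point of exceedance.\<close>
      then show False using y by force
    qed
  qed (use T(2) in auto)
  also have "\<dots> \<in> sets M"
    using T m by (intro sets.countable_UN') (auto intro!: borel_measurable_less)
  finally show ?thesis .
qed

text \<open>A real \<open>SUP\<close> is meaningful only for sets bounded above; continuity on a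
  compact interval provides the bound, and nonnegativity removes the absolute value.\<close>

lemma sup_exceeds_eq:
  fixes h :: "real \<Rightarrow> 'b \<Rightarrow> real"
  assumes c: "\<And>y. y \<in> space M \<Longrightarrow> continuous_on {a..b} (\<lambda>c. h c y)" and "a \<le> b" "0 \<le> t"
    and h: "\<And>c y. c \<in> {a..b} \<Longrightarrow> y \<in> space M \<Longrightarrow> 0 \<le> h c y"
  shows "{y \<in> space M. \<bar>SUP c\<in>{a..b}. h c y\<bar> > t} = {y \<in> space M. \<exists>c\<in>{a..b}. h c y > t}"
proof -
  have "\<bar>SUP c\<in>{a..b}. h c y\<bar> > t \<longleftrightarrow> (\<exists>c\<in>{a..b}. h c y > t)" if y: "y \<in> space M" for y
  proof -
    have bd: "bdd_above ((\<lambda>c. h c y) ` {a..b})"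
      by (intro compact_imp_bounded[THEN bounded_imp_bdd_above] compact_continuous_image c[OF y]) simp
    have "0 \<le> h a y" using h[of a y] y \<open>a \<le> b\<close> by simp
    also have "\<dots> \<le> (SUP c\<in>{a..b}. h c y)" using bd \<open>a \<le> b\<close> by (intro cSUP_upper) auto
    finally show ?thesis using bd \<open>a \<le> b\<close> by (subst abs_of_nonneg) (auto simp: less_cSUP_iff)
  qed
  then show ?thesis by auto
qed

text \<open>A positive lower bound on the quotient excludes \<open>s2 J lam c = 0\<close>, as the
  quotient would then be 0. Hence \<open>D2L\<close>, and with it \<open>DL\<close>, is
  positive.\<close>

lemma DL_pos_of_ratio:
  assumes lam: "\<And>j. j \<in> J \<Longrightarrow> 0 \<le> lam j" "0 \<le> c" and "l > 0" "l \<le> D2L J lam c / s2 J lam c"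
  shows "0 < DL J lam a c" "s2 J lam c \<le> 1 / l * D2L J lam c"
proof -
  note nn = DL_nonneg_parts[where J=J and lam=lam and c=c, OF lam]
  have s: "0 < s2 J lam c" using nn assms(3,4) by (cases "s2 J lam c = 0") auto
  then have "l * s2 J lam c \<le> D2L J lam c" using assms(4) by (simp add: field_simps)
  moreover have "0 < l * s2 J lam c" using s \<open>l > 0\<close> by simp
  ultimately show "0 < DL J lam a c" "s2 J lam c \<le> 1 / l * D2L J lam c"
    using nn(1)[of a] \<open>l > 0\<close> by (auto simp: DL_def field_simps)
qed

context gp_eigenbasis
begin

lemma continuous_DL: 
  assumes "\<And>c. c \<in> S \<Longrightarrow> 0 \<le> c"
  shows "continuous_on S (DL J lam a)" 
    "continuous_on S (R1L J lam a z)" "continuous_on S (R2L J lam z)" "continuous_on S (R3 J lam a z)" "continuous_on S (R4 J lam z)"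
proof -
  have p: "1 + c * lam j > 0" if "c \<in> S" "j \<in> J" for c j
    using assms that lam_nonneg by (intro add_pos_nonneg mult_nonneg_nonneg) auto
  then have p': "1 + c * lam j \<noteq> 0" if "c \<in> S" "j \<in> J" for c j using that by (auto simp: less_imp_neq[THEN not_sym])
  show "continuous_on S (DL J lam a)"
    "continuous_on S (R1L J lam a z)" "continuous_on S (R2L J lam z)" "continuous_on S (R3 J lam a z)" "continuous_on S (R4 J lam z)"
    unfolding DL_def[abs_def] D1L_def[abs_def] D2L_def[abs_def] R1L_def[abs_def] R2L_def[abs_def] R3_def[abs_def] R4_def[abs_def]
    using p' by (intro continuous_intros; force)+
qed

lemma measurable_R:
  "(\<lambda>y. R1L J lam a (Z_coef N x e f y) c) \<in> borel_measurable (obs_law N x f)"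
  "(\<lambda>y. R2L J lam (Z_coef N x e f y) c) \<in> borel_measurable (obs_law N x f)"
  "(\<lambda>y. R3 J lam a (Z_coef N x e f y) c) \<in> borel_measurable (obs_law N x f)"
  "(\<lambda>y. R4 J lam (Z_coef N x e f y) c) \<in> borel_measurable (obs_law N x f)"
proof -
  interpret Z: standard_gaussian_family "obs_law N x f" J "\<lambda>j y. Z_coef N x e f y j"
    by (rule obs_standard_gaussian_family)
  note [measurable] = Z.meas
  show "(\<lambda>y. R1L J lam a (Z_coef N x e f y) c) \<in> borel_measurable (obs_law N x f)"
    "(\<lambda>y. R2L J lam (Z_coef N x e f y) c) \<in> borel_measurable (obs_law N x f)"
    "(\<lambda>y. R3 J lam a (Z_coef N x e f y) c) \<in> borel_measurable (obs_law N x f)"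
    "(\<lambda>y. R4 J lam (Z_coef N x e f y) c) \<in> borel_measurable (obs_law N x f)"
    unfolding R1L_def R2L_def R3_def R4_def by measurable
qed

end

text \<open>The estimator selects a point of the interval for every observation, and the zero vector
  is one.\<close>

lemma eb_setting_interval_nonempty:
  assumes "eb_setting Q W m N x J lam e chat"
  shows "c_interval m (N n) \<noteq> {}"
proof -
  have "(\<lambda>i\<in>{..<N n}. 0) \<in> space (obs_space (N n))" by (auto simp: obs_space_def space_PiM)
  then show ?thesis using assms unfolding eb_setting_def lik_estimator_def is_arg_min_def by blast
qed

theorem contraction_of_negligible_remainders:
  assumes gp: "mean_zero_gaussian_process Q W" and eb: "eb_setting Q W m N x J lam e chat"
    and rem: "remainders_negligible m N x J lam e f"
    and ua: "unif_asymp (\<lambda>n. c_interval m (N n)) (\<lambda>n. D2L (J n) (lam n)) (\<lambda>n. s2 (J n) (lam n))"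
  shows "posterior_contracts Q W m N x J lam e chat f"
proof -
  define a where "a n = f_coef (N n) (x n) (e n) f" for n
  define z where "z n = Z_coef (N n) (x n) (e n) f" for n
  define P where "P n = obs_law (N n) (x n) f" for n
  define h1 where "h1 n c y = (\<bar>R1L (J n) (lam n) (a n) (z n y) c\<bar> + \<bar>R2L (J n) (lam n) (z n y) c\<bar>) / DL (J n) (lam n) (a n) c" for n c y
  define h2 where "h2 n c y = (\<bar>R3 (J n) (lam n) (a n) (z n y) c\<bar> + \<bar>R4 (J n) (lam n) (z n y) c\<bar>) / DL (J n) (lam n) (a n) c" for n c y
  let ?I = "\<lambda>n. c_interval m (N n)"
  have c1: "conv0_in_prob P (\<lambda>n y. SUP c\<in>?I n. h1 n c y)" and c2: "conv0_in_prob P (\<lambda>n y. SUP c\<in>?I n. h2 n c y)"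
    using rem unfolding remainders_negligible_def Let_def h1_def h2_def a_def z_def P_def by auto
  obtain l u where l: "l > 0" and ev0: "\<forall>\<^sub>F n in sequentially. \<forall>c\<in>?I n. l \<le> D2L (J n) (lam n) c / s2 (J n) (lam n) c
      \<and> D2L (J n) (lam n) c / s2 (J n) (lam n) c \<le> u"
    using ua unfolding unif_asymp_def by blast
  from ev0 have ev: "\<forall>\<^sub>F n in sequentially. \<forall>c\<in>?I n. l \<le> D2L (J n) (lam n) c / s2 (J n) (lam n) c"
    by (rule eventually_mono) blast
  \<comment> \<open>Where \<open>DL\<close> vanishes somewhere the ratios need not be continuous in
    \<open>c\<close> and measurability could fail; this happens for finitely many \<open>n\<close>
    only, and there \<open>B n\<close> is taken empty. The thresholds 1/2 and 1 are those of
    \<open>posterior_contractsI\<close>.\<close>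
  define B where "B n = (if \<forall>c\<in>?I n. 0 < DL (J n) (lam n) (a n) c
     then {y \<in> space (P n). \<exists>c\<in>?I n. h1 n c y > 1 / 2} \<union> {y \<in> space (P n). \<exists>c\<in>?I n. h2 n c y > 1} else {})" for n
  have main: "B n \<in> sets (P n) \<and> measure (P n) (B n) \<le> measure (P n) {y \<in> space (P n). \<bar>SUP c\<in>?I n. h1 n c y\<bar> > 1 / 2}
      + measure (P n) {y \<in> space (P n). \<bar>SUP c\<in>?I n. h2 n c y\<bar> > 1}" for n
  proof (cases "\<forall>c\<in>?I n. 0 < DL (J n) (lam n) (a n) c")
    case False
    then show ?thesis unfolding B_def by (simp only: if_False sets.empty_sets measure_empty) simp
  next
    case True
    interpret G: gp_eigenbasis Q W "N n" "x n" "J n" "lam n" "e n" by (rule gp_eigenbasisI[OF gp eb])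
    interpret O: prob_space "P n" unfolding P_def by (rule prob_space_obs_law)
    obtain p q where I: "?I n = {p..q}" "p \<le> q" using eb_setting_interval_nonempty[OF eb, of n] by (auto simp: c_interval_def)
    have nz: "DL (J n) (lam n) (a n) c \<noteq> 0" if "c \<in> {p..q}" for c using True that I by force
    note ci = c_interval_nonneg[of _ m "N n", unfolded I(1)]
    have k1: "continuous_on {p..q} (\<lambda>c. h1 n c y)" and k2: "continuous_on {p..q} (\<lambda>c. h2 n c y)" for y
      unfolding h1_def h2_def using nz by (intro continuous_intros G.continuous_DL ci; force)+
    have m1: "h1 n c \<in> borel_measurable (P n)" and m2: "h2 n c \<in> borel_measurable (P n)" for c
      unfolding h1_def[abs_def] h2_def[abs_def] z_def P_def
      by (intro borel_measurable_divide borel_measurable_add borel_measurable_abs borel_measurable_const G.measurable_R)+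
    have n1: "0 \<le> h1 n c y" and n2: "0 \<le> h2 n c y" if "c \<in> {p..q}" for c y
      using True I that unfolding h1_def h2_def by (auto intro!: divide_nonneg_pos)
    have B: "B n = {y \<in> space (P n). \<exists>c\<in>{p..q}. h1 n c y > 1 / 2} \<union> {y \<in> space (P n). \<exists>c\<in>{p..q}. h2 n c y > 1}"
      using True unfolding B_def I(1) by simp
    note s1 = sup_exceeds_measurable[of p q "h1 n" "P n", OF m1 k1] and s2 = sup_exceeds_measurable[of p q "h2 n" "P n", OF m2 k2]
    have e1: "{y \<in> space (P n). \<bar>SUP c\<in>{p..q}. h1 n c y\<bar> > 1 / 2} = {y \<in> space (P n). \<exists>c\<in>{p..q}. h1 n c y > 1 / 2}"
      by (rule sup_exceeds_eq[OF k1 I(2) _ n1]) auto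
    have e2: "{y \<in> space (P n). \<bar>SUP c\<in>{p..q}. h2 n c y\<bar> > 1} = {y \<in> space (P n). \<exists>c\<in>{p..q}. h2 n c y > 1}"
      by (rule sup_exceeds_eq[OF k2 I(2) _ n2]) auto
    show ?thesis unfolding B I(1) e1 e2 by (intro conjI sets.Un measure_Un_le s1 s2)
  qed
  show ?thesis
  proof (rule posterior_contractsI[OF gp eb])
    show "B n \<in> sets (obs_space (N n))" for n using main[of n] unfolding P_def by simp
    have "(\<lambda>n. measure (P n) {y \<in> space (P n). \<bar>SUP c\<in>?I n. h1 n c y\<bar> > 1 / 2}
      + measure (P n) {y \<in> space (P n). \<bar>SUP c\<in>?I n. h2 n c y\<bar> > 1}) \<longlonglongrightarrow> 0 + 0"
      (is "?g \<longlonglongrightarrow> _")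
      by (intro tendsto_add c1[unfolded conv0_in_prob_def, rule_format] c2[unfolded conv0_in_prob_def, rule_format]) simp_all
    then have lim: "?g \<longlonglongrightarrow> 0" by simp
    show "(\<lambda>n. measure (obs_law (N n) (x n) f) (B n)) \<longlonglongrightarrow> 0"
    proof (rule tendsto_sandwich[OF _ _ tendsto_const lim])
      show "\<forall>\<^sub>F n in sequentially. measure (obs_law (N n) (x n) f) (B n) \<le> ?g n"
        using main unfolding P_def[symmetric] by (intro always_eventually allI) blast
    qed simp
    show "0 \<le> 1 / l" using l by simp
    show "\<forall>\<^sub>F n in sequentially. \<forall>y\<in>space (obs_space (N n)) - B n. \<forall>c\<in>c_interval m (N n).
       (let a = f_coef (N n) (x n) (e n) f; z = Z_coef (N n) (x n) (e n) f y in
        \<bar>R1L (J n) (lam n) a z c\<bar> + \<bar>R2L (J n) (lam n) z c\<bar> \<le> DL (J n) (lam n) a c / 2 \<and>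
        \<bar>R3 (J n) (lam n) a z c\<bar> + \<bar>R4 (J n) (lam n) z c\<bar> \<le> DL (J n) (lam n) a c \<and>
        0 < DL (J n) (lam n) a c \<and> s2 (J n) (lam n) c \<le> 1 / l * D2L (J n) (lam n) c)"
      using ev
    proof eventually_elim
      case (elim n)
      interpret G: gp_eigenbasis Q W "N n" "x n" "J n" "lam n" "e n" by (rule gp_eigenbasisI[OF gp eb])
      have D: "0 < DL (J n) (lam n) (a n) c" "s2 (J n) (lam n) c \<le> 1 / l * D2L (J n) (lam n) c" if "c \<in> ?I n" for c
        using DL_pos_of_ratio[of "J n" "lam n", OF G.lam_nonneg c_interval_nonneg[OF that] l elim[rule_format, OF that]] by blast+
      show ?case unfolding Let_def a_def[symmetric] z_def[symmetric]
      proof (intro ballI conjI)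
        fix y c assume y: "y \<in> space (obs_space (N n)) - B n" and c: "c \<in> ?I n"
        have "h1 n c y \<le> 1 / 2" "h2 n c y \<le> 1"
          using y c D(1) unfolding B_def P_def by (auto simp: not_less split: if_splits)
        then show "\<bar>R1L (J n) (lam n) (a n) (z n y) c\<bar> + \<bar>R2L (J n) (lam n) (z n y) c\<bar> \<le> DL (J n) (lam n) (a n) c / 2"
          "\<bar>R3 (J n) (lam n) (a n) (z n y) c\<bar> + \<bar>R4 (J n) (lam n) (z n y) c\<bar> \<le> DL (J n) (lam n) (a n) c"
          unfolding h1_def h2_def using D(1)[OF c] by (simp_all add: pos_divide_le_eq)
      qed (use D in auto)
    qed
  qed
qed

section \<open>Uniform control of the remainders\<close>

text \<open>The derivative is x / (1 + x)^2. The proof avoids it: ln t \<le> t - 1 at t = (1 + x) /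
  (1 + y) gives (x - y) / (1 + y), which grows when divided by 1 + x because its numerator is
  nonpositive.\<close>

lemma D2_summand_mono:
  fixes x y :: real
  assumes "0 \<le> x" "x \<le> y"
  shows "ln (1 + x) - x / (1 + x) \<le> ln (1 + y) - y / (1 + y)"
proof -
  have "ln (1 + x) - ln (1 + y) = ln ((1 + x) / (1 + y))" using assms by (simp add: ln_div)
  also have "\<dots> \<le> (1 + x) / (1 + y) - 1" using assms by (intro ln_le_minus_one) simp
  also have "\<dots> = (x - y) / (1 + y)" using assms by (simp add: field_simps)
  also have "\<dots> \<le> (x - y) / ((1 + x) * (1 + y))"
    using assms by (intro divide_left_mono_neg) (auto simp: mult_le_cancel_right1)
  also have "\<dots> = x / (1 + x) - y / (1 + y)" using assms by (simp add: field_simps)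
  finally show ?thesis by simp
qed

text \<open>With \<open>A = x / (1 + x)\<close> and \<open>B = 1 / (1 + x)\<close>, all four coefficient functions change by multiples of
  the same \<open>\<delta>\<close> when \<open>x\<close> increases to \<open>x'\<close>: \<open>A\<close> becomes \<open>A + \<delta>\<close> and \<open>B\<close> becomes \<open>B - \<delta>\<close>.\<close>

lemma coefficient_increments:
  fixes x x' \<eta> :: real
  assumes "0 \<le> x" "x \<le> x'" "x' \<le> (1 + \<eta>) * x" "0 \<le> \<eta>"
  defines "A \<equiv> x / (1 + x)" and "B \<equiv> 1 / (1 + x)" and "A' \<equiv> x' / (1 + x')" and "B' \<equiv> 1 / (1 + x')"
  shows "\<bar>B' - B\<bar> \<le> \<eta> * (A * B)" "\<bar>A' - A\<bar> \<le> \<eta> * A" "\<bar>A' * B' - A * B\<bar> \<le> \<eta> * (A * B)" "\<bar>A'\<^sup>2 - A\<^sup>2\<bar> \<le> 2 * \<eta> * A"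
proof -
  define d where "d = (x' - x) / ((1 + x) * (1 + x'))"
  have x: "0 < 1 + x" "0 < 1 + x'" using assms by auto
  have d0: "0 \<le> d" unfolding d_def using assms x by simp
  have A': "A' = A + d" and B': "B' = B - d" unfolding A_def B_def A'_def B'_def d_def using x
    by (simp_all add: divide_simps) (simp_all add: algebra_simps)
  have b: "0 \<le> A" "A \<le> 1" "0 \<le> B" "B \<le> 1" "0 \<le> A'" "A' \<le> 1" "0 \<le> B'" "B' \<le> 1"
    unfolding A_def B_def A'_def B'_def using assms x by auto
  have "d \<le> (\<eta> * x) / ((1 + x) * (1 + x'))"
    unfolding d_def using assms x by (intro divide_right_mono) (auto simp: algebra_simps)
  also have "\<dots> = (\<eta> * x / (1 + x)) * (1 / (1 + x'))" by simp
  also have "\<dots> \<le> (\<eta> * x / (1 + x)) * (1 / (1 + x))"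
  proof (intro mult_left_mono)
    show "0 \<le> \<eta> * x / (1 + x)" using assms x by simp
  qed (use assms x in \<open>auto intro!: divide_left_mono\<close>)
  finally have d: "d \<le> \<eta> * (A * B)" unfolding A_def B_def by simp
  then have \<eta>AB: "0 \<le> \<eta> * (A * B)" using d0 by linarith
  have dA: "d \<le> \<eta> * A"
  proof -
    have "0 \<le> \<eta> * A" using b \<open>0 \<le> \<eta>\<close> by simp
    then have "\<eta> * A * B \<le> \<eta> * A" using b mult_left_mono[of B 1 "\<eta> * A"] by simp
    then show ?thesis using d by (simp add: mult.assoc)
  qed
  show "\<bar>B' - B\<bar> \<le> \<eta> * (A * B)" using B' d d0 by simp
  show "\<bar>A' - A\<bar> \<le> \<eta> * A" using A' dA d0 by simp
  have "\<bar>A' * B' - A * B\<bar> = d * \<bar>B' - A\<bar>"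
  proof -
    have "A' * B' - A * B = d * (B' - A)" unfolding A' B' by (simp add: algebra_simps)
    then show ?thesis using d0 by (simp add: abs_mult)
  qed
  also have "\<dots> \<le> d * 1" using b d0 by (intro mult_left_mono) auto
  finally show "\<bar>A' * B' - A * B\<bar> \<le> \<eta> * (A * B)" using d by simp
  have "A'\<^sup>2 - A\<^sup>2 = d * (A' + A)" unfolding A' by (simp add: power2_eq_square algebra_simps)
  moreover have "d * (A' + A) \<le> d * 2" using b d0 by (intro mult_left_mono) auto
  moreover have "0 \<le> d * (A' + A)" using b d0 by simp
  ultimately show "\<bar>A'\<^sup>2 - A\<^sup>2\<bar> \<le> 2 * \<eta> * A" using dA by simp
qed

lemma sum_abs_le:
  fixes g h :: "'b \<Rightarrow> real"
  assumes "\<And>j. j \<in> J \<Longrightarrow> \<bar>g j\<bar> \<le> h j"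
  shows "\<bar>sum g J\<bar> \<le> sum h J"
proof -
  have "\<bar>sum g J\<bar> \<le> (\<Sum>j\<in>J. \<bar>g j\<bar>)" by (rule sum_abs)
  also have "\<dots> \<le> sum h J" using assms by (rule sum_mono)
  finally show ?thesis .
qed

text \<open>All four increments are dominated by \<eta> times the random sum \<open>S\<close>. Since
  the terms (z^2 + 1) A add up to 2 s2 - R2, \<open>S\<close> is at most \<open>T\<close>, whose
  only random part is R2 at the point \<open>c\<close> itself. This is why control at a grid point
  passes to its neighbours without further probability.\<close>

lemma remainder_increments:
  fixes J :: "'b set" and lam a z :: "'b \<Rightarrow> real"
  assumes lam: "\<And>j. j \<in> J \<Longrightarrow> 0 \<le> lam j" and c: "0 \<le> c" "c \<le> u" "u \<le> (1 + \<eta>) * c" and \<eta>: "0 \<le> \<eta>"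
  defines "T \<equiv> D1L J lam a c + 2 * s2 J lam c + \<bar>R2L J lam z c\<bar>"
  shows "\<bar>R1L J lam a z u - R1L J lam a z c\<bar> \<le> 2 * \<eta> * T" "\<bar>R2L J lam z u - R2L J lam z c\<bar> \<le> 2 * \<eta> * T"
    "\<bar>R3 J lam a z u - R3 J lam a z c\<bar> \<le> 2 * \<eta> * T" "\<bar>R4 J lam z u - R4 J lam z c\<bar> \<le> 2 * \<eta> * T"
proof -
  define A B A' B' where "A j = c * lam j / (1 + c * lam j)" and "B j = 1 / (1 + c * lam j)"
    and "A' j = u * lam j / (1 + u * lam j)" and "B' j = 1 / (1 + u * lam j)" for j
  have x: "0 \<le> c * lam j" "c * lam j \<le> u * lam j" "u * lam j \<le> (1 + \<eta>) * (c * lam j)" if "j \<in> J" for j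
    using lam[OF that] c mult_right_mono[OF c(3) lam[OF that]] by (auto intro: mult_right_mono simp: mult.assoc)
  note inc = coefficient_increments[OF x \<eta>, folded A_def B_def A'_def B'_def]
  have A0: "0 \<le> A j" "A j \<le> 1" "0 \<le> B j" if "j \<in> J" for j
    using x(1)[OF that] unfolding A_def B_def by auto
  define S where "S = (\<Sum>j\<in>J. (a j)\<^sup>2 * B j + ((z j)\<^sup>2 + 1) * A j)"
  have "S = D1L J lam a c + 2 * s2 J lam c - R2L J lam z c"
    unfolding S_def D1L_def s2_def R2L_def sum_distrib_left sum_negf[symmetric] sum.distrib[symmetric] sum_subtractf[symmetric] A_def B_def
    by (intro sum.cong[OF refl]) (simp add: algebra_simps add_divide_distrib diff_divide_distrib)
  then have ST: "S \<le> T" unfolding T_def by simp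
  \<comment> \<open>From 2 |a| (|z| A) \<le> a^2 + z^2 A^2, multiplied by B, together with A^2 B
    \<le> A.\<close>
  have za: "2 * \<bar>z j * a j\<bar> * (A j * B j) \<le> (a j)\<^sup>2 * B j + ((z j)\<^sup>2 + 1) * A j" if j: "j \<in> J" for j
  proof -
    have "2 * (\<bar>z j\<bar> * \<bar>a j\<bar>) * A j \<le> (a j)\<^sup>2 + (z j)\<^sup>2 * (A j)\<^sup>2"
      using sum_squares_bound[of "\<bar>a j\<bar>" "\<bar>z j\<bar> * A j"] by (simp add: power_mult_distrib mult_ac)
    then have "2 * (\<bar>z j\<bar> * \<bar>a j\<bar>) * A j * B j \<le> ((a j)\<^sup>2 + (z j)\<^sup>2 * (A j)\<^sup>2) * B j" using A0[OF j] by (intro mult_right_mono)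
    also have "\<dots> = (a j)\<^sup>2 * B j + (z j)\<^sup>2 * ((A j)\<^sup>2 * B j)" by (simp add: algebra_simps)
    also have "(A j)\<^sup>2 * B j \<le> A j * 1"
    proof -
      have "A j * B j \<le> 1 * 1" using A0[OF j] x(1)[OF j] by (intro mult_mono) (auto simp: B_def)
      then have "A j * (A j * B j) \<le> A j * 1" using A0[OF j] by (intro mult_left_mono) auto
      then show ?thesis by (simp add: power2_eq_square mult.assoc)
    qed
    then have "(z j)\<^sup>2 * ((A j)\<^sup>2 * B j) \<le> (z j)\<^sup>2 * A j" by (intro mult_left_mono) auto
    also have "\<dots> \<le> ((z j)\<^sup>2 + 1) * A j" using A0[OF j] by (intro mult_right_mono) auto
    finally show ?thesis by (simp add: abs_mult mult.assoc)
  qed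
  have zA: "\<bar>(z j)\<^sup>2 - 1\<bar> * A j \<le> (a j)\<^sup>2 * B j + ((z j)\<^sup>2 + 1) * A j" if j: "j \<in> J" for j
  proof -
    have "\<bar>(z j)\<^sup>2 - 1\<bar> \<le> (z j)\<^sup>2 + 1" using zero_le_power2[of "z j"] by linarith
    then have "\<bar>(z j)\<^sup>2 - 1\<bar> * A j \<le> ((z j)\<^sup>2 + 1) * A j" using A0[OF j] by (intro mult_right_mono)
    moreover have "0 \<le> (a j)\<^sup>2 * B j" using A0[OF j] by simp
    ultimately show ?thesis by linarith
  qed
  have fin: "\<bar>sum g J\<bar> \<le> 2 * \<eta> * T" if g: "\<And>j. j \<in> J \<Longrightarrow> \<bar>g j\<bar> \<le> 2 * \<eta> * ((a j)\<^sup>2 * B j + ((z j)\<^sup>2 + 1) * A j)" for g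
  proof -
    have "\<bar>sum g J\<bar> \<le> (\<Sum>j\<in>J. 2 * \<eta> * ((a j)\<^sup>2 * B j + ((z j)\<^sup>2 + 1) * A j))" by (rule sum_abs_le) (rule g)
    also have "\<dots> = 2 * \<eta> * S" unfolding S_def sum_distrib_left ..
    also have "\<dots> \<le> 2 * \<eta> * T" using ST \<eta> by (intro mult_left_mono) auto
    finally show ?thesis .
  qed
  have mono2: "w * r \<le> 2 * \<eta> * s" if "r \<le> k * \<eta> * v" "w * (k * v) \<le> 2 * s" "0 \<le> w" for w r s v k :: real
  proof -
    have "w * r \<le> w * (k * \<eta> * v)" using that by (intro mult_left_mono)
    also have "\<dots> = \<eta> * (w * (k * v))" by (simp only: mult_ac)
    also have "\<dots> \<le> \<eta> * (2 * s)" using that \<eta> by (intro mult_left_mono)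
    finally show ?thesis by (simp only: mult_ac)
  qed
  have s0: "0 \<le> (a j)\<^sup>2 * B j + ((z j)\<^sup>2 + 1) * A j" if "j \<in> J" for j
    using A0[OF that] by (intro add_nonneg_nonneg mult_nonneg_nonneg) auto
  have "R1L J lam a z u - R1L J lam a z c = (\<Sum>j\<in>J. 2 * (z j * a j) * (B' j - B j))"
    unfolding R1L_def sum_distrib_left sum_subtractf[symmetric] B'_def B_def
    by (intro sum.cong[OF refl]) (simp add: algebra_simps)
  moreover have "\<bar>2 * (z j * a j) * (B' j - B j)\<bar> \<le> 2 * \<eta> * ((a j)\<^sup>2 * B j + ((z j)\<^sup>2 + 1) * A j)" if j: "j \<in> J" for j
    unfolding abs_mult[of _ "B' j - B j"]
    by (rule mono2[where k=1 and v="A j * B j"]) (use inc(1)[OF j j j] za[OF j] s0[OF j] in \<open>auto simp: abs_mult\<close>)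
  ultimately show "\<bar>R1L J lam a z u - R1L J lam a z c\<bar> \<le> 2 * \<eta> * T" using fin by presburger
  have "R2L J lam z u - R2L J lam z c = (\<Sum>j\<in>J. ((z j)\<^sup>2 - 1) * (A j - A' j))"
    unfolding R2L_def sum_negf[symmetric] sum_subtractf[symmetric] A'_def A_def
    by (intro sum.cong[OF refl]) (simp add: algebra_simps)
  moreover have "\<bar>((z j)\<^sup>2 - 1) * (A j - A' j)\<bar> \<le> 2 * \<eta> * ((a j)\<^sup>2 * B j + ((z j)\<^sup>2 + 1) * A j)" if j: "j \<in> J" for j
    unfolding abs_mult abs_minus_commute[of "A j"]
    by (rule mono2[where k=1 and v="A j"]) (use inc(2)[OF j j j] zA[OF j] s0[OF j] in auto)
  ultimately show "\<bar>R2L J lam z u - R2L J lam z c\<bar> \<le> 2 * \<eta> * T" using fin by presburger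
  have "R3 J lam a z u - R3 J lam a z c = (\<Sum>j\<in>J. (- 2 * (z j * a j)) * (A' j * B' j - A j * B j))"
    unfolding R3_def sum_distrib_left sum_subtractf[symmetric] A'_def A_def B'_def B_def
    by (intro sum.cong[OF refl]) (simp add: algebra_simps power2_eq_square)
  moreover have "\<bar>(- 2 * (z j * a j)) * (A' j * B' j - A j * B j)\<bar> \<le> 2 * \<eta> * ((a j)\<^sup>2 * B j + ((z j)\<^sup>2 + 1) * A j)" if j: "j \<in> J" for j
    unfolding abs_mult[of _ "_ - _"]
    by (rule mono2[where k=1 and v="A j * B j"]) (use inc(3)[OF j j j] za[OF j] s0[OF j] in \<open>auto simp: abs_mult\<close>)
  ultimately show "\<bar>R3 J lam a z u - R3 J lam a z c\<bar> \<le> 2 * \<eta> * T" using fin by presburger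
  have "R4 J lam z u - R4 J lam z c = (\<Sum>j\<in>J. ((z j)\<^sup>2 - 1) * ((A' j)\<^sup>2 - (A j)\<^sup>2))"
    unfolding R4_def sum_subtractf[symmetric] A'_def A_def power_divide
    by (intro sum.cong[OF refl]) (simp add: algebra_simps)
  moreover have "\<bar>((z j)\<^sup>2 - 1) * ((A' j)\<^sup>2 - (A j)\<^sup>2)\<bar> \<le> 2 * \<eta> * ((a j)\<^sup>2 * B j + ((z j)\<^sup>2 + 1) * A j)" if j: "j \<in> J" for j
    unfolding abs_mult
    by (rule mono2[where k=2 and v="A j"]) (use inc(4)[OF j j j] zA[OF j] s0[OF j] in auto)
  ultimately show "\<bar>R4 J lam z u - R4 J lam z c\<bar> \<le> 2 * \<eta> * T" using fin by presburger
qed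

text \<open>\<open>D2L\<close> increases in \<open>c\<close>, and \<open>D1L\<close> decreases, but
  by no more than the factor 2 when \<open>c\<close> at most doubles.\<close>

lemma DL_le_of_le:
  fixes lam :: "'b \<Rightarrow> real"
  assumes lam: "\<And>j. j \<in> J \<Longrightarrow> 0 \<le> lam j" and c: "0 \<le> c" "c \<le> u" "u \<le> 2 * c"
  shows "DL J lam a c \<le> 2 * DL J lam a u"
proof -
  have "D1L J lam a c \<le> 2 * D1L J lam a u"
    unfolding D1L_def sum_distrib_left
  proof (rule sum_mono)
    fix j assume j: "j \<in> J"
    have p: "0 \<le> c * lam j" "0 \<le> u * lam j" using lam[OF j] c by auto
    have "1 + u * lam j \<le> 2 * (1 + c * lam j)" using mult_right_mono[OF c(3) lam[OF j]] by simp
    then have "1 / (1 + c * lam j) \<le> 2 / (1 + u * lam j)" using p by (simp add: divide_simps)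
    then have "(a j)\<^sup>2 * (1 / (1 + c * lam j)) \<le> (a j)\<^sup>2 * (2 / (1 + u * lam j))" by (intro mult_left_mono) auto
    then show "(a j)\<^sup>2 / (1 + c * lam j) \<le> 2 * ((a j)\<^sup>2 / (1 + u * lam j))" by (simp add: mult_ac)
  qed
  moreover have "D2L J lam c \<le> D2L J lam u"
    unfolding D2L_def using lam c by (intro sum_mono D2_summand_mono mult_right_mono mult_nonneg_nonneg) auto
  moreover have "0 \<le> D2L J lam u" using DL_nonneg_parts(3)[of J lam u] lam c by auto
  ultimately show ?thesis unfolding DL_def by simp
qed

section \<open>Control at a single value of c and in its neighbourhood\<close>

context gp_eigenbasis
begin

definition bad_set :: "('a \<Rightarrow> real) \<Rightarrow> real \<Rightarrow> real \<Rightarrow> (nat \<Rightarrow> real) set" where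
  "bad_set f \<theta> c = (let a = f_coef N x e f; z = Z_coef N x e f; t = \<theta> * DL J lam a c in
     {y \<in> space (obs_law N x f). t < \<bar>R1L J lam a (z y) c\<bar>} \<union> {y \<in> space (obs_law N x f). t < \<bar>R2L J lam (z y) c\<bar>} \<union>
     ({y \<in> space (obs_law N x f). t < \<bar>R3 J lam a (z y) c\<bar>} \<union> {y \<in> space (obs_law N x f). t < \<bar>R4 J lam (z y) c\<bar>}))"

lemma bad_set_measurable: "bad_set f \<theta> c \<in> sets (obs_law N x f)"
  unfolding bad_set_def Let_def
  by (intro sets.Un borel_measurable_less borel_measurable_abs borel_measurable_const measurable_R)

text \<open>Each remainder is linear in the noise or in its centred squares. With A = u / (1 + u)
  and B = 1 / (1 + u), u = c \<lambda>, the second moments of \<open>R1L\<close> and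
  \<open>R3\<close> are at most 4 D1, as A B \<le> B and B^2 \<le> B; those of \<open>R2L\<close>
  and \<open>R4\<close> are at most 2 s2 \<le> 2 C D. Chebyshev at \<theta> D yields the sum 4 + 4 +
  2 C + 2 C.\<close>

lemma measure_bad_set_le:
  fixes f :: "'a \<Rightarrow> real"
  defines "a \<equiv> f_coef N x e f"
  assumes c: "0 \<le> c" and D: "0 < DL J lam a c" and s2: "s2 J lam c \<le> C * D2L J lam c" and C: "0 \<le> C" and \<theta>: "0 < \<theta>"
  shows "measure (obs_law N x f) (bad_set f \<theta> c) \<le> (8 + 4 * C) / \<theta>\<^sup>2 / DL J lam a c"
proof -
  interpret Z: standard_gaussian_family "obs_law N x f" J "\<lambda>j y. Z_coef N x e f y j"
    by (rule obs_standard_gaussian_family)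
  let ?D = "DL J lam a c" and ?z = "\<lambda>y. Z_coef N x e f y"
  let ?S = "\<lambda>R. {y \<in> space (obs_law N x f). \<theta> * ?D < \<bar>R y\<bar>}"
  define A B where "A j = c * lam j / (1 + c * lam j)" and "B j = 1 / (1 + c * lam j)" for j
  have AB: "0 \<le> A j" "A j \<le> 1" "0 \<le> B j" "B j \<le> 1" if "j \<in> J" for j
    using mult_nonneg_nonneg[OF c lam_nonneg[OF that]] unfolding A_def B_def by auto
  have t: "0 < \<theta> * ?D" using D \<theta> by simp
  note nn = DL_nonneg_parts[where J=J and lam=lam, OF lam_nonneg c]
  have b1: "(\<Sum>j\<in>J. (a j * w j)\<^sup>2) \<le> ?D" if w: "\<And>j. j \<in> J \<Longrightarrow> 0 \<le> w j \<and> w j \<le> B j" for w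
  proof -
    have "(\<Sum>j\<in>J. (a j * w j)\<^sup>2) \<le> D1L J lam a c" unfolding D1L_def
    proof (rule sum_mono)
      fix j assume j: "j \<in> J"
      have "(w j)\<^sup>2 \<le> B j * 1" unfolding power2_eq_square using w[OF j] AB[OF j] by (intro mult_mono) auto
      then have "(a j)\<^sup>2 * (w j)\<^sup>2 \<le> (a j)\<^sup>2 * B j" by (intro mult_left_mono) auto
      then show "(a j * w j)\<^sup>2 \<le> (a j)\<^sup>2 / (1 + c * lam j)" by (simp add: power_mult_distrib B_def)
    qed
    then show ?thesis using nn(3) unfolding DL_def by simp
  qed
  have b2: "(\<Sum>j\<in>J. (w j)\<^sup>2) \<le> C * ?D" if w: "\<And>j. j \<in> J \<Longrightarrow> 0 \<le> w j \<and> w j \<le> A j" for w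
  proof -
    have "(\<Sum>j\<in>J. (w j)\<^sup>2) \<le> s2 J lam c" unfolding s2_def
    proof (rule sum_mono)
      fix j assume j: "j \<in> J"
      have "(w j)\<^sup>2 \<le> A j * 1" unfolding power2_eq_square using w[OF j] AB[OF j] by (intro mult_mono) auto
      then show "(w j)\<^sup>2 \<le> c * lam j / (1 + c * lam j)" unfolding A_def by simp
    qed
    also have "\<dots> \<le> C * D2L J lam c" by (rule s2)
    also have "\<dots> \<le> C * ?D" using nn(1) C unfolding DL_def by (intro mult_left_mono) auto
    finally show ?thesis .
  qed
  have q: "v / (\<theta> * ?D)\<^sup>2 \<le> k / \<theta>\<^sup>2 / ?D" if "v \<le> k * ?D" for v k :: real
  proof -
    have "v / (\<theta> * ?D)\<^sup>2 \<le> (k * ?D) / (\<theta> * ?D)\<^sup>2" using that by (intro divide_right_mono) auto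
    also have "\<dots> = k / \<theta>\<^sup>2 / ?D" using D \<theta> by (simp add: power2_eq_square)
    finally show ?thesis .
  qed
  have R1: "R1L J lam a (?z y) c = (\<Sum>j\<in>J. (2 * (a j * B j)) * ?z y j)" for y
    unfolding R1L_def B_def sum_distrib_left by (intro sum.cong[OF refl]) simp
  have R2: "R2L J lam (?z y) c = (\<Sum>j\<in>J. (- A j) * ((?z y j)\<^sup>2 - 1))" for y
    unfolding R2L_def A_def sum_negf[symmetric] by (intro sum.cong[OF refl]) simp
  have R3: "R3 J lam a (?z y) c = (\<Sum>j\<in>J. (- 2 * (a j * (A j * B j))) * ?z y j)" for y
    unfolding R3_def A_def B_def sum_distrib_left by (intro sum.cong[OF refl]) (simp add: power2_eq_square)
  have R4: "R4 J lam (?z y) c = (\<Sum>j\<in>J. (A j)\<^sup>2 * ((?z y j)\<^sup>2 - 1))" for y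
    unfolding R4_def A_def by (intro sum.cong[OF refl]) (simp add: power_divide)
  have m1: "measure (obs_law N x f) (?S (\<lambda>y. R1L J lam a (?z y) c)) \<le> 4 / \<theta>\<^sup>2 / ?D"
    unfolding R1 using b1[of B] AB
    by (intro order_trans[OF Z.chebyshev_linear[OF t] q]) (auto simp: power_mult_distrib sum_distrib_left[symmetric])
  have m3: "measure (obs_law N x f) (?S (\<lambda>y. R3 J lam a (?z y) c)) \<le> 4 / \<theta>\<^sup>2 / ?D"
    unfolding R3 using b1[of "\<lambda>j. A j * B j"] AB mult_left_le_one_le[of "B _" "A _"]
    by (intro order_trans[OF Z.chebyshev_linear[OF t] q]) (auto simp: power_mult_distrib sum_distrib_left[symmetric])
  have m2: "measure (obs_law N x f) (?S (\<lambda>y. R2L J lam (?z y) c)) \<le> 2 * C / \<theta>\<^sup>2 / ?D"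
    unfolding R2 using b2[of A] AB
    by (intro order_trans[OF Z.chebyshev_chi_square[OF t] q]) auto
  have m4: "measure (obs_law N x f) (?S (\<lambda>y. R4 J lam (?z y) c)) \<le> 2 * C / \<theta>\<^sup>2 / ?D"
    unfolding R4 using b2[of "\<lambda>j. (A j)\<^sup>2"] AB mult_left_le_one_le[of "A _" "A _"]
    by (intro order_trans[OF Z.chebyshev_chi_square[OF t] q]) (auto simp: power2_eq_square)
  have S: "?S (\<lambda>y. R1L J lam a (?z y) c) \<in> sets (obs_law N x f)" "?S (\<lambda>y. R2L J lam (?z y) c) \<in> sets (obs_law N x f)"
    "?S (\<lambda>y. R3 J lam a (?z y) c) \<in> sets (obs_law N x f)" "?S (\<lambda>y. R4 J lam (?z y) c) \<in> sets (obs_law N x f)"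
    by (intro borel_measurable_less borel_measurable_abs borel_measurable_const measurable_R)+
  have "measure (obs_law N x f) (bad_set f \<theta> c) \<le> (4 / \<theta>\<^sup>2 / ?D + 2 * C / \<theta>\<^sup>2 / ?D) + (4 / \<theta>\<^sup>2 / ?D + 2 * C / \<theta>\<^sup>2 / ?D)"
    unfolding bad_set_def Let_def a_def[symmetric]
    by (intro order_trans[OF measure_Un_le] add_mono sets.Un S m1 m2 m3 m4)
  also have "\<dots> = (8 + 4 * C) / \<theta>\<^sup>2 / ?D" unfolding add_divide_distrib[symmetric] by simp
  finally show ?thesis .
qed

text \<open>At \<open>c\<close> each remainder is at most D / 16 and T \<le> (2 + 2 C) D, so the
  choice of \<eta> makes each increment at most 2 D / 64 = D / 32. At \<open>u\<close> each
  remainder is then below D / 8, a pair below D / 4, and D(c) \<le> 2 D(u) turns this into D(u) /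
  2.\<close>

lemma good_near_good_point:
  fixes f :: "'a \<Rightarrow> real" and C :: real
  defines "a \<equiv> f_coef N x e f" and "z \<equiv> Z_coef N x e f" and "\<eta> \<equiv> 1 / (64 * (2 + 2 * C))"
  assumes y: "y \<in> space (obs_law N x f) - bad_set f (1 / 16) c" and C: "0 \<le> C"
    and c: "0 \<le> c" "c \<le> u" "u \<le> (1 + \<eta>) * c" and D: "0 < DL J lam a c" and s2: "s2 J lam c \<le> C * D2L J lam c"
  shows "\<bar>R1L J lam a (z y) u\<bar> + \<bar>R2L J lam (z y) u\<bar> \<le> DL J lam a u / 2"
    "\<bar>R3 J lam a (z y) u\<bar> + \<bar>R4 J lam (z y) u\<bar> \<le> DL J lam a u"
proof -
  let ?D = "DL J lam a c"
  have \<eta>: "0 \<le> \<eta>" "\<eta> \<le> 1" "\<eta> * (2 + 2 * C) = 1 / 64" unfolding \<eta>_def using C by (auto simp: field_simps)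
  note nn = DL_nonneg_parts[where J=J and lam=lam, OF lam_nonneg c(1)]
  have R: "\<bar>R1L J lam a (z y) c\<bar> \<le> ?D / 16" "\<bar>R2L J lam (z y) c\<bar> \<le> ?D / 16"
    "\<bar>R3 J lam a (z y) c\<bar> \<le> ?D / 16" "\<bar>R4 J lam (z y) c\<bar> \<le> ?D / 16"
    using y unfolding bad_set_def Let_def a_def z_def by (auto simp: not_less)
  define T where "T = D1L J lam a c + 2 * s2 J lam c + \<bar>R2L J lam (z y) c\<bar>"
  have "T \<le> D1L J lam a c + 2 * (C * D2L J lam c) + ?D" using R(2) s2 D unfolding T_def by simp
  also have "\<dots> \<le> (2 + 2 * C) * ?D"
  proof -
    have "0 \<le> C * D1L J lam a c" using C nn(1) by simp
    then show ?thesis using nn unfolding DL_def by (simp add: algebra_simps)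
  qed
  finally have "2 * \<eta> * T \<le> 2 * (\<eta> * ((2 + 2 * C) * ?D))" using \<eta> by (simp add: mult_left_mono)
  also have "\<dots> = ?D / 32" unfolding mult.assoc[symmetric] using \<eta>(3) by simp
  finally have T: "2 * \<eta> * T \<le> ?D / 32" .
  note inc = remainder_increments[where J=J and lam=lam and a=a and z="z y", OF lam_nonneg c \<eta>(1), folded T_def]
  have "u \<le> 2 * c" using c mult_right_mono[OF \<eta>(2) c(1)] by (simp add: algebra_simps)
  then have DD: "?D \<le> 2 * DL J lam a u" using DL_le_of_le[where J=J and lam=lam, OF lam_nonneg c(1,2)] by blast
  have t: "\<bar>v'\<bar> \<le> ?D / 8" if "\<bar>v' - v\<bar> \<le> 2 * \<eta> * T" "\<bar>v\<bar> \<le> ?D / 16" for v v' :: real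
    using that T D by linarith
  show "\<bar>R1L J lam a (z y) u\<bar> + \<bar>R2L J lam (z y) u\<bar> \<le> DL J lam a u / 2"
    "\<bar>R3 J lam a (z y) u\<bar> + \<bar>R4 J lam (z y) u\<bar> \<le> DL J lam a u"
    using t[OF inc(1) R(1)] t[OF inc(2) R(2)] t[OF inc(3) R(3)] t[OF inc(4) R(4)] DD by linarith+
qed

end

text \<open>Take the predecessor of the least k with u < p q^k; k = 0 is impossible because p \<le>
  u.\<close>

lemma geometric_grid_covers:
  fixes q u p :: real
  assumes "1 < q" "0 < p" "p \<le> u"
  shows "\<exists>k. p * q ^ k \<le> u \<and> u \<le> q * (p * q ^ k)"
proof -
  obtain n where "u / p < q ^ n" using real_arch_pow[OF assms(1)] by blast
  then have n: "u < p * q ^ n" using assms by (simp add: field_simps)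
  define k where "k = (LEAST k. u < p * q ^ k)"
  have k: "u < p * q ^ k" unfolding k_def by (rule LeastI) (rule n)
  then have "k \<noteq> 0" using assms by (cases k) auto
  then obtain l where l: "k = Suc l" using not0_implies_Suc by blast
  then have "\<not> u < p * q ^ l" unfolding k_def using not_less_Least[of l "\<lambda>k. u < p * q ^ k"] by simp
  then show ?thesis using k unfolding l by (intro exI[of _ l]) (simp add: mult_ac)
qed

text \<open>A union bound over a geometric grid, which is fine enough for the remainders to be controlled between
  neighbouring grid points; \<open>DL\<close> grows along the grid at least geometrically.\<close>

theorem contraction_of_growth:
  fixes N :: "nat \<Rightarrow> nat"
  assumes gp: "mean_zero_gaussian_process Q W" and eb: "eb_setting Q W m N x J lam e chat"
    and N: "filterlim N at_top sequentially" and pos: "0 \<le> C" "0 < \<kappa>" "0 < g"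
    and ev: "\<forall>\<^sub>F n in sequentially. \<forall>c\<in>c_interval m (N n).
       s2 (J n) (lam n) c \<le> C * D2L (J n) (lam n) c \<and> \<kappa> * (c * real (N n)) powr g \<le> D2L (J n) (lam n) c"
  shows "posterior_contracts Q W m N x J lam e chat f"
proof -
  define a where "a n = f_coef (N n) (x n) (e n) f" for n
  let ?D = "\<lambda>n. DL (J n) (lam n) (a n)" and ?P = "\<lambda>n. obs_law (N n) (x n) f"
  define \<eta> where "\<eta> = 1 / (64 * (2 + 2 * C))"
  define q where "q = 1 + \<eta>"
  have q: "1 < q" unfolding q_def \<eta>_def using pos by simp
  \<comment> \<open>The other \<open>n\<close> are finitely many; \<open>B n\<close> is empty for
    them, so that \<open>main\<close> holds for all \<open>n\<close>.\<close>
  define good where "good n \<longleftrightarrow> 2 \<le> N n \<and> (\<forall>c\<in>c_interval m (N n).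
       s2 (J n) (lam n) c \<le> C * D2L (J n) (lam n) c \<and> \<kappa> * (c * real (N n)) powr g \<le> D2L (J n) (lam n) c)" for n
  have evg: "\<forall>\<^sub>F n in sequentially. good n"
    using ev N[unfolded filterlim_at_top, rule_format, of 2] unfolding good_def by eventually_elim auto
  define p where "p n = ln (real (N n)) / real (N n)" for n
  define S where "S n = {k. p n * q ^ k \<in> c_interval m (N n)}" for n
  define B where "B n = (if good n then \<Union>k\<in>S n. gp_eigenbasis.bad_set (N n) (x n) (J n) (lam n) (e n) f (1 / 16) (p n * q ^ k) else {})" for n
  \<comment> \<open>The ratio of the series: along the grid the lower bound for \<open>DL\<close>
    grows by \<open>q powr g\<close> per step.\<close>
  define r where "r = q powr (- g)"
  have r: "0 \<le> r" "r < 1" unfolding r_def using q pos by (auto simp: powr_less_one)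
  define K where "K = (8 + 4 * C) / (1 / 16)\<^sup>2 / \<kappa>"
  have K: "0 \<le> K" unfolding K_def using pos by simp
  have p0: "0 < p n" if "good n" for n using that unfolding p_def good_def by simp
  have fin: "finite (S n)" if "good n" for n
  proof -
    obtain k0 where "real (N n) powr (m - 1) / p n < q ^ k0" using real_arch_pow[OF q] by blast
    then have k0: "real (N n) powr (m - 1) < p n * q ^ k0" using p0[OF that] by (simp add: field_simps)
    have "S n \<subseteq> {..k0}"
    proof
      fix k assume "k \<in> S n"
      then have "p n * q ^ k \<le> real (N n) powr (m - 1)" unfolding S_def c_interval_def by simp
      then have "p n * q ^ k < p n * q ^ k0" using k0 by simp
      then have "q ^ k < q ^ k0" using p0[OF that] by simp
      then show "k \<in> {..k0}" using q by (simp add: power_strict_increasing_iff)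
    qed
    then show ?thesis by (rule finite_subset) simp
  qed
  have D: "\<kappa> * (c * real (N n)) powr g \<le> ?D n c" "0 < ?D n c" if g: "good n" and c: "c \<in> c_interval m (N n)" for n c
  proof -
    interpret G: gp_eigenbasis Q W "N n" "x n" "J n" "lam n" "e n" by (rule gp_eigenbasisI[OF gp eb])
    have "0 \<le> D1L (J n) (lam n) (a n) c"
      using DL_nonneg_parts(1)[where J="J n" and lam="lam n", OF G.lam_nonneg c_interval_nonneg[OF c]] .
    then show 1: "\<kappa> * (c * real (N n)) powr g \<le> ?D n c" using g c unfolding good_def DL_def by force
    have "p n \<le> c" using c unfolding c_interval_def p_def by simp
    then have "0 < c" using p0[OF g] by simp
    then have "0 < \<kappa> * (c * real (N n)) powr g" using pos g unfolding good_def by simp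
    then show "0 < ?D n c" using 1 by simp
  qed
  have main: "B n \<in> sets (?P n) \<and> measure (?P n) (B n) \<le> K * (1 / (1 - r)) * ln (real (N n)) powr (- g)" for n
  proof (cases "good n")
    case False
    then show ?thesis using K r unfolding B_def by (simp only: if_False sets.empty_sets measure_empty) simp
  next
    case g: True
    interpret G: gp_eigenbasis Q W "N n" "x n" "J n" "lam n" "e n" by (rule gp_eigenbasisI[OF gp eb])
    let ?b = "\<lambda>k. G.bad_set f (1 / 16) (p n * q ^ k)"
    have B: "B n = (\<Union>k\<in>S n. ?b k)" using g unfolding B_def by simp
    have N2: "1 < real (N n)" using g unfolding good_def by simp
    have one: "measure (?P n) (?b k) \<le> K * ln (real (N n)) powr (- g) * r ^ k" if k: "k \<in> S n" for k
    proof -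
      let ?c = "p n * q ^ k"
      have c: "?c \<in> c_interval m (N n)" using k unfolding S_def by simp
      have "measure (?P n) (?b k) \<le> (8 + 4 * C) / (1 / 16)\<^sup>2 / ?D n ?c"
        using G.measure_bad_set_le[of ?c f C "1 / 16"] D(2)[OF g c] c_interval_nonneg[OF c] c g pos
        unfolding good_def a_def by simp
      also have "\<dots> \<le> (8 + 4 * C) / (1 / 16)\<^sup>2 / (\<kappa> * (?c * real (N n)) powr g)"
        using D[OF g c] pos p0[OF g] q N2 by (intro divide_left_mono) auto
      also have "?c * real (N n) = ln (real (N n)) * q ^ k" using N2 unfolding p_def by simp
      also have "(ln (real (N n)) * q ^ k) powr g = ln (real (N n)) powr g * (q powr g) ^ k"
        using N2 q by (simp add: powr_mult powr_realpow[symmetric] powr_powr mult.commute)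
      also have "(8 + 4 * C) / (1 / 16)\<^sup>2 / (\<kappa> * (ln (real (N n)) powr g * (q powr g) ^ k)) = K * ln (real (N n)) powr (- g) * r ^ k"
        unfolding K_def r_def powr_minus by (simp add: field_simps)
      finally show ?thesis .
    qed
    have "measure (?P n) (B n) \<le> (\<Sum>k\<in>S n. measure (?P n) (?b k))"
      unfolding B by (rule measure_UNION_le[OF fin[OF g]]) (rule G.bad_set_measurable)
    also have "\<dots> \<le> (\<Sum>k\<in>S n. K * ln (real (N n)) powr (- g) * r ^ k)" by (intro sum_mono one)
    also have "\<dots> = K * ln (real (N n)) powr (- g) * (\<Sum>k\<in>S n. r ^ k)" by (simp add: sum_distrib_left)
    also have "(\<Sum>k\<in>S n. r ^ k) \<le> (\<Sum>k. r ^ k)"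
      using r by (intro sum_le_suminf fin[OF g] summable_geometric) auto
    also have "(\<Sum>k. r ^ k) = 1 / (1 - r)" using r by (intro suminf_geometric) simp
    finally have "measure (?P n) (B n) \<le> K * ln (real (N n)) powr (- g) * (1 / (1 - r))"
      using K by (simp add: mult_left_mono)
    moreover have "B n \<in> sets (?P n)" unfolding B by (intro sets.finite_UN fin[OF g] G.bad_set_measurable)
    ultimately show ?thesis by (simp add: mult_ac)
  qed
  show ?thesis
  proof (rule posterior_contractsI[OF gp eb])
    show "B n \<in> sets (obs_space (N n))" for n using main[of n] by simp
    have "filterlim (\<lambda>n. ln (real (N n))) at_top sequentially"
      by (rule filterlim_compose[OF ln_at_top filterlim_compose[OF filterlim_real_sequentially N]])
    then have "(\<lambda>n. ln (real (N n)) powr (- g)) \<longlonglongrightarrow> 0" using pos by (intro tendsto_neg_powr) auto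
    then have lim: "(\<lambda>n. K * (1 / (1 - r)) * ln (real (N n)) powr (- g)) \<longlonglongrightarrow> 0" by (rule tendsto_mult_right_zero)
    show "(\<lambda>n. measure (?P n) (B n)) \<longlonglongrightarrow> 0"
    proof (rule tendsto_sandwich[OF _ _ tendsto_const lim])
      show "\<forall>\<^sub>F n in sequentially. measure (?P n) (B n) \<le> K * (1 / (1 - r)) * ln (real (N n)) powr (- g)"
        using main by (intro always_eventually allI) blast
    qed simp
    show "0 \<le> C" by (rule pos)
    show "\<forall>\<^sub>F n in sequentially. \<forall>y\<in>space (obs_space (N n)) - B n. \<forall>c\<in>c_interval m (N n).
       (let a = f_coef (N n) (x n) (e n) f; z = Z_coef (N n) (x n) (e n) f y in
        \<bar>R1L (J n) (lam n) a z c\<bar> + \<bar>R2L (J n) (lam n) z c\<bar> \<le> DL (J n) (lam n) a c / 2 \<and>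
        \<bar>R3 (J n) (lam n) a z c\<bar> + \<bar>R4 (J n) (lam n) z c\<bar> \<le> DL (J n) (lam n) a c \<and>
        0 < DL (J n) (lam n) a c \<and> s2 (J n) (lam n) c \<le> C * D2L (J n) (lam n) c)"
      using evg
    proof eventually_elim
      case (elim n)
      interpret G: gp_eigenbasis Q W "N n" "x n" "J n" "lam n" "e n" by (rule gp_eigenbasisI[OF gp eb])
      show ?case unfolding Let_def
      proof (intro ballI)
        fix y u assume y: "y \<in> space (obs_space (N n)) - B n" and u: "u \<in> c_interval m (N n)"
        have "p n \<le> u" using u unfolding c_interval_def p_def by simp
        from geometric_grid_covers[OF q p0[OF elim] this] obtain k where k: "p n * q ^ k \<le> u" "u \<le> q * (p n * q ^ k)" by blast
        let ?c = "p n * q ^ k"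
        have "p n \<le> ?c" using p0[OF elim] q by simp
        \<comment> \<open>The grid starts at the left endpoint of the interval, so the grid point
          just below \<open>u\<close> cannot fall outside.\<close>
        then have c: "?c \<in> c_interval m (N n)" using k(1) u unfolding c_interval_def p_def by simp
        then have "k \<in> S n" unfolding S_def by simp
        then have yb: "y \<in> space (?P n) - G.bad_set f (1 / 16) ?c" using y elim unfolding B_def by auto
        have sc: "s2 (J n) (lam n) ?c \<le> C * D2L (J n) (lam n) ?c" using elim c unfolding good_def by blast
        have k2: "u \<le> (1 + 1 / (64 * (2 + 2 * C))) * ?c" using k(2) unfolding \<eta>_def[symmetric] q_def[symmetric] .
        note gg = G.good_near_good_point[OF yb pos(1) c_interval_nonneg[OF c] k(1) k2 D(2)[OF elim c, unfolded a_def] sc]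
        show "\<bar>R1L (J n) (lam n) (f_coef (N n) (x n) (e n) f) (Z_coef (N n) (x n) (e n) f y) u\<bar> + \<bar>R2L (J n) (lam n) (Z_coef (N n) (x n) (e n) f y) u\<bar>
            \<le> DL (J n) (lam n) (f_coef (N n) (x n) (e n) f) u / 2 \<and>
          \<bar>R3 (J n) (lam n) (f_coef (N n) (x n) (e n) f) (Z_coef (N n) (x n) (e n) f y) u\<bar> + \<bar>R4 (J n) (lam n) (Z_coef (N n) (x n) (e n) f y) u\<bar>
            \<le> DL (J n) (lam n) (f_coef (N n) (x n) (e n) f) u \<and>
          0 < DL (J n) (lam n) (f_coef (N n) (x n) (e n) f) u \<and> s2 (J n) (lam n) u \<le> C * D2L (J n) (lam n) u"
          using gg D(2)[OF elim u] elim u unfolding good_def a_def by blast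
      qed
    qed
  qed
qed

section \<open>Counting eigenvalues\<close>

text \<open>Discrete form of the comparison of j^(-m) with the integral of t^(-m) from j - 1 to j,
  obtained from 1 + t \<le> exp t and ln (1 - 1 / j) \<le> - 1 / j. It fails at n = 0, where
  \<open>0 powr (1 - m)\<close> is 0.\<close>

lemma inverse_powr_telescope:
  fixes m :: real
  assumes "1 < m"
  shows "(m - 1) * real (Suc n) powr (- m) + real (Suc n) powr (1 - m) \<le> real n powr (1 - m) \<or> n = 0"
proof (cases "n = 0")
  case False
  define j where "j = real (Suc n)"
  have j: "j > 1" "real n = j * (1 - 1 / j)" using False unfolding j_def by (auto simp: field_simps)
  have x: "0 < 1 - 1 / j" using j by simp
  have "ln (1 - 1 / j) \<le> - (1 / j)" using ln_le_minus_one[OF x] by simp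
  then have "(m - 1) * (1 / j) \<le> (m - 1) * (- ln (1 - 1 / j))" using assms by (intro mult_left_mono) auto
  then have "1 + (m - 1) / j \<le> 1 + (1 - m) * ln (1 - 1 / j)" by (simp add: algebra_simps)
  also have "\<dots> \<le> exp ((1 - m) * ln (1 - 1 / j))" by (rule exp_ge_add_one_self)
  also have "\<dots> = (1 - 1 / j) powr (1 - m)" using x j(1) by (simp add: powr_def)
  finally have "j powr (1 - m) * (1 + (m - 1) / j) \<le> j powr (1 - m) * (1 - 1 / j) powr (1 - m)" by (intro mult_left_mono) auto
  also have "\<dots> = real n powr (1 - m)" unfolding j(2) using j x by (subst powr_mult) auto
  also have "j powr (1 - m) * (1 + (m - 1) / j) = (m - 1) * j powr (- m) + j powr (1 - m)"
  proof -
    have "j powr (1 - m) = j * j powr (- m)" using j by (simp add: powr_diff powr_minus divide_inverse)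
    moreover have "j * P * (1 + (m - 1) / j) = (m - 1) * P + j * P" for P using j by (simp add: field_simps)
    ultimately show ?thesis by metis
  qed
  finally show ?thesis unfolding j_def by simp
qed simp

text \<open>Keeping the subtracted term at \<open>n\<close> lets the induction telescope.\<close>

lemma sum_inverse_powr_tail:
  fixes m :: real
  assumes "1 < m" "1 \<le> k" "k \<le> n"
  shows "(\<Sum>j=Suc k..n. real j powr (- m)) \<le> (real k powr (1 - m) - real n powr (1 - m)) / (m - 1)"
  using assms(3)
proof (induction rule: dec_induct)
  case (step n)
  have "(\<Sum>j=Suc k..Suc n. real j powr (- m)) = (\<Sum>j=Suc k..n. real j powr (- m)) + real (Suc n) powr (- m)"
    using step by simp
  also have "\<dots> \<le> (real k powr (1 - m) - real n powr (1 - m)) / (m - 1) + (real n powr (1 - m) - real (Suc n) powr (1 - m)) / (m - 1)"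
  proof (intro add_mono step.IH)
    have "(m - 1) * real (Suc n) powr (- m) \<le> real n powr (1 - m) - real (Suc n) powr (1 - m)"
      using inverse_powr_telescope[OF assms(1), of n] step assms(2) by auto
    then show "real (Suc n) powr (- m) \<le> (real n powr (1 - m) - real (Suc n) powr (1 - m)) / (m - 1)"
      using assms(1) by (simp add: pos_le_divide_eq mult.commute)
  qed
  also have "\<dots> = (real k powr (1 - m) - real (Suc n) powr (1 - m)) / (m - 1)"
    unfolding add_divide_distrib[symmetric] by simp
  finally show ?case .
qed simp

text \<open>The 1 pays for the indices up to k = floor A, and 2^m / (m - 1) for the tail beyond k;
  the power of 2 comes from A \<le> 2 k.\<close>

definition tail_const :: "real \<Rightarrow> real" where
  "tail_const m = 1 + 2 powr m / (m - 1)"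

lemma tail_const_ge_1: "1 < m \<Longrightarrow> 1 \<le> tail_const m"
  by (simp add: tail_const_def)

lemma card_le_eq: "{j \<in> {1..n}. real j \<le> A} = {1..min n (nat \<lfloor>A\<rfloor>)}"
proof -
  have "real j \<le> A \<longleftrightarrow> j \<le> nat \<lfloor>A\<rfloor>" if "1 \<le> j" for j
    using that by linarith
  then show ?thesis by auto
qed

lemma min_powr_le:
  assumes "0 \<le> A" "1 \<le> j"
  shows "min 1 ((A / real j) powr m) \<le> A powr m * real j powr (- m)"
proof -
  have "(A / real j) powr m = A powr m / real j powr m" by (rule powr_divide)
  also have "\<dots> = A powr m * real j powr (- m)" by (simp add: powr_minus_divide)
  finally have "(A / real j) powr m = A powr m * real j powr (- m)" .
  then show ?thesis by simp
qed

lemma nat_floor_ge_half: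
  assumes "1 \<le> (A::real)" shows "1 \<le> nat \<lfloor>A\<rfloor>" "real (nat \<lfloor>A\<rfloor>) \<le> A" "A \<le> 2 * real (nat \<lfloor>A\<rfloor>)"
proof -
  have 1: "1 \<le> \<lfloor>A\<rfloor>" using assms by simp
  then have 2: "real (nat \<lfloor>A\<rfloor>) = of_int \<lfloor>A\<rfloor>" by simp
  show "1 \<le> nat \<lfloor>A\<rfloor>" using 1 by linarith
  show "real (nat \<lfloor>A\<rfloor>) \<le> A" unfolding 2 by simp
  have "A < of_int \<lfloor>A\<rfloor> + 1" "1 \<le> (of_int \<lfloor>A\<rfloor> :: real)" using 1 by linarith+
  then show "A \<le> 2 * real (nat \<lfloor>A\<rfloor>)" unfolding 2 by linarith
qed

text \<open>Intended for A < 1, where no index satisfies j \<le> A and the count used for large A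
  would give nothing.\<close>

lemma sum_min_powr_small:
  assumes "1 < m" "0 \<le> A" 
  shows "(\<Sum>j=1..n. min 1 ((A / real j) powr m)) \<le> tail_const m * A powr m"
proof (cases "n = 0")
  case False
  have "(\<Sum>j=1..n. min 1 ((A / real j) powr m)) \<le> (\<Sum>j=1..n. A powr m * real j powr (- m))"
    using assms(2) by (intro sum_mono min_powr_le) auto
  also have "\<dots> = A powr m * (\<Sum>j=1..n. real j powr (- m))" by (simp add: sum_distrib_left)
  finally have 1: "(\<Sum>j=1..n. min 1 ((A / real j) powr m)) \<le> A powr m * (\<Sum>j=1..n. real j powr (- m))" .
  have "(\<Sum>j=1..n. real j powr (- m)) = 1 + (\<Sum>j=Suc 1..n. real j powr (- m))"
    using False by (subst sum.atLeast_Suc_atMost) auto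
  also have "\<dots> \<le> 1 + (real 1 powr (1 - m) - real n powr (1 - m)) / (m - 1)"
    using sum_inverse_powr_tail[OF assms(1), of 1 n] False by simp
  also have "\<dots> \<le> tail_const m"
    unfolding tail_const_def using assms(1)
    by (intro add_left_mono divide_right_mono) (auto intro: order_trans[OF _ ge_one_powr_ge_zero])
  finally have "A powr m * (\<Sum>j=1..n. real j powr (- m)) \<le> A powr m * tail_const m" by (intro mult_left_mono) auto
  with 1 show ?thesis by (simp add: mult.commute)
qed (use tail_const_ge_1[OF assms(1)] in simp)

text \<open>Each of the first k = floor A terms is at most 1. The rest is at most A^m k^(1 - m) / (m
  - 1), which is of order k since A \<le> 2 k. If A reaches n there is no tail.\<close>

lemma sum_min_powr_large:
  assumes m: "1 < m" and A: "1 \<le> A"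
  shows "(\<Sum>j=1..n. min 1 ((A / real j) powr m)) \<le> tail_const m * card {j \<in> {1..n}. real j \<le> A}"
proof (cases "real n \<le> A")
  case True
  have "(\<Sum>j=1..n. min 1 ((A / real j) powr m)) \<le> (\<Sum>j=1..n. 1)" by (intro sum_mono) auto
  also have "\<dots> = real (card {j \<in> {1..n}. real j \<le> A})"
  proof -
    have "{j \<in> {1..n}. real j \<le> A} = {1..n}" using True by auto
    then show ?thesis by simp
  qed
  also have "\<dots> \<le> tail_const m * card {j \<in> {1..n}. real j \<le> A}"
    using tail_const_ge_1[OF m] by (simp add: mult_le_cancel_right1)
  finally show ?thesis .
next
  case False
  define k where "k = nat \<lfloor>A\<rfloor>"
  have k: "1 \<le> k" "real k \<le> A" "A \<le> 2 * real k" using nat_floor_ge_half[OF A] unfolding k_def by blast+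
  then have kn: "k \<le> n" using False by linarith
  have c: "{j \<in> {1..n}. real j \<le> A} = {1..k}" unfolding card_le_eq k_def[symmetric] using kn by simp
  have "(\<Sum>j=1..n. min 1 ((A / real j) powr m)) = (\<Sum>j=1..k. min 1 ((A / real j) powr m)) + (\<Sum>j=Suc k..n. min 1 ((A / real j) powr m))"
    using sum.ub_add_nat[of 1 k "\<lambda>j. min 1 ((A / real j) powr m)" "n - k"] kn k(1) by simp
  also have "\<dots> \<le> (\<Sum>j=1..k. 1) + (\<Sum>j=Suc k..n. A powr m * real j powr (- m))"
    using A by (intro add_mono sum_mono min_powr_le) auto
  also have "\<dots> = real k + A powr m * (\<Sum>j=Suc k..n. real j powr (- m))" by (simp add: sum_distrib_left)
  also have "\<dots> \<le> real k + (2 * real k) powr m * (real k powr (1 - m) / (m - 1))"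
  proof (intro add_left_mono mult_mono)
    show "A powr m \<le> (2 * real k) powr m" using k A m by (intro powr_mono2) auto
    have "(\<Sum>j=Suc k..n. real j powr (- m)) \<le> (real k powr (1 - m) - real n powr (1 - m)) / (m - 1)"
      by (rule sum_inverse_powr_tail[OF m k(1) kn])
    also have "\<dots> \<le> real k powr (1 - m) / (m - 1)" using m by (intro divide_right_mono) auto
    finally show "(\<Sum>j=Suc k..n. real j powr (- m)) \<le> real k powr (1 - m) / (m - 1)" .
  qed (auto intro: sum_nonneg)
  also have "(2 * real k) powr m * (real k powr (1 - m) / (m - 1)) = 2 powr m / (m - 1) * real k"
    using k(1) by (simp add: powr_mult powr_diff)
  also have "real k + \<dots> = tail_const m * real k" unfolding tail_const_def by (simp add: algebra_simps)
  finally show ?thesis unfolding c by simp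
qed

lemma card_le_ge_half:
  assumes "1 \<le> A" "A \<le> real n"
  shows "A / 2 \<le> card {j \<in> {1..n}. real j \<le> A}"
proof -
  have "nat \<lfloor>A\<rfloor> \<le> n" using assms by linarith
  then have "card {j \<in> {1..n}. real j \<le> A} = nat \<lfloor>A\<rfloor>" unfolding card_le_eq by simp
  then show ?thesis using nat_floor_ge_half(3)[OF assms(1)] by simp
qed

lemma card_le_le:
  fixes A :: real
  assumes "0 \<le> A"
  shows "card {j \<in> {1..n}. real j \<le> A} \<le> A"
proof -
  have "real (nat \<lfloor>A\<rfloor>) \<le> A" using assms by simp
  moreover have "real (card {j \<in> {1..n}. real j \<le> A}) \<le> real (nat \<lfloor>A\<rfloor>)" unfolding card_le_eq by simp
  ultimately show ?thesis by linarith
qed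

text \<open>\<open>\<rho>\<close> is the model eigenvalue. The first bound is x / (1 + x) \<le> min
  1 x; the second keeps only the indices with \<open>c * \<rho> j\<close> at least 1, where by
  monotonicity each summand is at least its value at \<open>\<delta>l\<close>.\<close>

lemma s2_D2L_bounds:
  assumes fin: "finite J" and \<delta>: "0 < \<delta>l" and c: "0 \<le> c"
    and lam: "\<And>j. j \<in> J \<Longrightarrow> 0 \<le> \<rho> j \<and> \<delta>l * \<rho> j \<le> lam j \<and> lam j \<le> \<delta>u * \<rho> j"
  shows "s2 J lam c \<le> max 1 \<delta>u * (\<Sum>j\<in>J. min 1 (c * \<rho> j))"
    "(ln (1 + \<delta>l) - \<delta>l / (1 + \<delta>l)) * card {j \<in> J. 1 \<le> c * \<rho> j} \<le> D2L J lam c"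
proof -
  have p: "0 \<le> c * lam j" if "j \<in> J" for j
    using lam[OF that] \<delta> c by (meson mult_nonneg_nonneg order_less_imp_le order_trans)
  show "s2 J lam c \<le> max 1 \<delta>u * (\<Sum>j\<in>J. min 1 (c * \<rho> j))"
    unfolding s2_def sum_distrib_left
  proof (rule sum_mono)
    fix j assume j: "j \<in> J"
    have 1: "c * lam j / (1 + c * lam j) \<le> 1" using p[OF j] by simp
    have "c * lam j / (1 + c * lam j) \<le> c * lam j" using p[OF j] by (simp add: divide_le_eq mult_le_cancel_left1)
    also have "\<dots> \<le> c * (\<delta>u * \<rho> j)" using lam[OF j] c by (intro mult_left_mono) auto
    also have "\<dots> = \<delta>u * (c * \<rho> j)" by simp
    also have "\<dots> \<le> max 1 \<delta>u * (c * \<rho> j)" using lam[OF j] c by (intro mult_right_mono) auto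
    finally have 2: "c * lam j / (1 + c * lam j) \<le> max 1 \<delta>u * (c * \<rho> j)" .
    show "c * lam j / (1 + c * lam j) \<le> max 1 \<delta>u * min 1 (c * \<rho> j)"
      using 1 2 by (cases "1 \<le> c * \<rho> j") (auto simp: min_def)
  qed
  let ?g = "\<lambda>u::real. ln (1 + u) - u / (1 + u)"
  have "?g \<delta>l * card {j \<in> J. 1 \<le> c * \<rho> j} = (\<Sum>j\<in>{j \<in> J. 1 \<le> c * \<rho> j}. ?g \<delta>l)" by simp
  also have "\<dots> \<le> (\<Sum>j\<in>{j \<in> J. 1 \<le> c * \<rho> j}. ?g (c * lam j))"
  proof (intro sum_mono D2_summand_mono)
    fix j assume j: "j \<in> {j \<in> J. 1 \<le> c * \<rho> j}"
    then have "\<delta>l * 1 \<le> \<delta>l * (c * \<rho> j)" using \<delta> by (intro mult_left_mono) auto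
    also have "\<dots> = c * (\<delta>l * \<rho> j)" by simp
    also have "\<dots> \<le> c * lam j" using lam j c by (intro mult_left_mono) auto
    finally show "\<delta>l \<le> c * lam j" by simp
  qed (use \<delta> in simp)
  also have "\<dots> \<le> (\<Sum>j\<in>J. ?g (c * lam j))"
  proof (rule sum_mono2[OF fin])
    show "0 \<le> ?g (c * lam j)" if "j \<in> J - {j \<in> J. 1 \<le> c * \<rho> j}" for j
      using D2_summand_mono[of 0 "c * lam j"] p that by simp
  qed auto
  finally show "?g \<delta>l * card {j \<in> J. 1 \<le> c * \<rho> j} \<le> D2L J lam c" unfolding D2L_def .
qed

text \<open>Reduces an eigenvalue condition to two facts about the model: the truncated sum is
  comparable with the count of large terms, and that count grows at least like a power of c
  N.\<close>

theorem contraction_of_counting: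
  fixes N :: "nat \<Rightarrow> nat" and \<delta>l \<delta>u C \<kappa> g :: real
  assumes gp: "mean_zero_gaussian_process Q W" and eb: "eb_setting Q W m N x J lam e chat"
    and N: "filterlim N at_top sequentially" and pos: "0 < \<delta>l" "0 \<le> C" "0 < \<kappa>" "0 < g"
    and lam: "\<forall>\<^sub>F n in sequentially. \<forall>j\<in>J n. 0 \<le> \<rho> n j \<and> \<delta>l * \<rho> n j \<le> lam n j \<and> lam n j \<le> \<delta>u * \<rho> n j"
    and ev: "\<forall>\<^sub>F n in sequentially. \<forall>c\<in>c_interval m (N n).
       (\<Sum>j\<in>J n. min 1 (c * \<rho> n j)) \<le> C * card {j \<in> J n. 1 \<le> c * \<rho> n j} \<and>
       \<kappa> * (c * real (N n)) powr g \<le> card {j \<in> J n. 1 \<le> c * \<rho> n j}"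
  shows "posterior_contracts Q W m N x J lam e chat f"
proof -
  define \<kappa>0 where "\<kappa>0 = ln (1 + \<delta>l) - \<delta>l / (1 + \<delta>l)"
  \<comment> \<open>Strict because ln t = t - 1 only at t = 1; this makes \<open>\<kappa>0\<close>
    positive.\<close>
  have "ln (1 / (1 + \<delta>l)) < 1 / (1 + \<delta>l) - 1"
    using pos(1) ln_le_minus_one[of "1 / (1 + \<delta>l)"] ln_eq_minus_one[of "1 / (1 + \<delta>l)"] by fastforce
  then have \<kappa>0: "0 < \<kappa>0" unfolding \<kappa>0_def using pos(1) by (simp add: ln_div field_simps)
  have fin: "finite (J n)" for n using eb unfolding eb_setting_def orthonormal_eigenbasis_def by blast
  show ?thesis
  proof (rule contraction_of_growth[OF gp eb N])
    show "0 \<le> max 1 \<delta>u * C / \<kappa>0" "0 < \<kappa>0 * \<kappa>" "0 < g" using pos \<kappa>0 by auto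
    show "\<forall>\<^sub>F n in sequentially. \<forall>c\<in>c_interval m (N n).
       s2 (J n) (lam n) c \<le> max 1 \<delta>u * C / \<kappa>0 * D2L (J n) (lam n) c \<and> \<kappa>0 * \<kappa> * (c * real (N n)) powr g \<le> D2L (J n) (lam n) c"
      using lam ev
    proof eventually_elim
      case (elim n)
      show ?case
      proof
        fix c assume c: "c \<in> c_interval m (N n)"
        note b = s2_D2L_bounds[where J="J n" and lam="lam n" and \<rho>="\<rho> n" and \<delta>l=\<delta>l and \<delta>u=\<delta>u, OF fin pos(1) c_interval_nonneg[OF c], folded \<kappa>0_def]
        note b1 = b(1)[OF elim(1)[rule_format]] and b2 = b(2)[OF elim(1)[rule_format]]
        let ?k = "real (card {j \<in> J n. 1 \<le> c * \<rho> n j})"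
        have e: "(\<Sum>j\<in>J n. min 1 (c * \<rho> n j)) \<le> C * ?k" "\<kappa> * (c * real (N n)) powr g \<le> ?k" using elim(2) c by auto
        have "s2 (J n) (lam n) c \<le> max 1 \<delta>u * (C * ?k)"
          by (rule order_trans[OF b1 mult_left_mono[OF e(1)]]) (auto simp: le_max_iff_disj)
        also have "\<dots> = (max 1 \<delta>u * C / \<kappa>0) * (\<kappa>0 * ?k)" using \<kappa>0 by simp
        also have "\<dots> \<le> (max 1 \<delta>u * C / \<kappa>0) * D2L (J n) (lam n) c"
          using b2 \<kappa>0 pos by (intro mult_left_mono) auto
        finally have 1: "s2 (J n) (lam n) c \<le> max 1 \<delta>u * C / \<kappa>0 * D2L (J n) (lam n) c" .
        have "\<kappa>0 * (\<kappa> * (c * real (N n)) powr g) \<le> \<kappa>0 * ?k" using e(2) \<kappa>0 by (intro mult_left_mono) auto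
        then show "s2 (J n) (lam n) c \<le> max 1 \<delta>u * C / \<kappa>0 * D2L (J n) (lam n) c \<and> \<kappa>0 * \<kappa> * (c * real (N n)) powr g \<le> D2L (J n) (lam n) c"
          using 1 b2 by (simp add: mult.assoc)
      qed
    qed
  qed
qed

lemma one_le_powr_iff: "0 < m \<Longrightarrow> 0 < u \<Longrightarrow> 1 \<le> u powr m \<longleftrightarrow> 1 \<le> (u::real)"
  using powr_mono2[of m 1 u] powr_less_mono2[of m u 1] by (auto simp: not_le[symmetric])

text \<open>\<open>T\<close> is the index at which c times the model eigenvalue N / j^m crosses 1.
  The right endpoint N^(m - 1) of the interval is what gives T \<le> N, the left one what gives T
  \<ge> 2 for large N.\<close>

lemma interval_scale:
  assumes m: "1 < m" and c: "c \<in> c_interval m N" and N: "2 powr m \<le> ln (real N)"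
  defines "T \<equiv> (c * real N) powr (1 / m)"
  shows "2 \<le> T" "T \<le> real N" "T powr m = c * real N"
proof -
  have "0 < ln (real N)" using N by (rule less_le_trans[rotated]) simp
  then have N1: "1 < real N" by (metis ln_gt_zero_iff gr0I ln_0 of_nat_0 of_nat_0_less_iff less_irrefl)
  have "ln (real N) / real N * real N \<le> c * real N" using c unfolding c_interval_def by (intro mult_right_mono) auto
  then have lo: "2 powr m \<le> c * real N" using N N1 by simp
  have "c * real N \<le> real N powr (m - 1) * real N" using c unfolding c_interval_def by (intro mult_right_mono) auto
  also have "\<dots> = real N powr m" using N1 by (simp add: powr_diff)
  finally have hi: "c * real N \<le> real N powr m" .
  have cN: "0 < c * real N" using lo by (rule less_le_trans[rotated]) simp
  have "(2 powr m) powr (1 / m) \<le> T" unfolding T_def using m lo by (intro powr_mono2) auto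
  then show "2 \<le> T" using m by (simp add: powr_powr)
  have "T \<le> (real N powr m) powr (1 / m)" unfolding T_def using m hi cN by (intro powr_mono2) auto
  then show "T \<le> real N" using m N1 by (simp add: powr_powr)
  show "T powr m = c * real N" unfolding T_def using m cN by (simp add: powr_powr)
qed

lemma eventually_ln_ge:
  fixes N :: "nat \<Rightarrow> nat"
  assumes "filterlim N at_top sequentially"
  shows "\<forall>\<^sub>F n in sequentially. K \<le> ln (real (N n))"
  using filterlim_compose[OF ln_at_top filterlim_compose[OF filterlim_real_sequentially assms]]
  by (simp add: filterlim_at_top)

theorem contraction_polynomial:
  assumes gp: "mean_zero_gaussian_process Q W" and m: "1 < m"
    and eb: "eb_setting Q W m (\<lambda>n. n) x (\<lambda>n. {1..n}) lam e chat" and lam: "polynomial_eigenvalues m lam"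
  shows "posterior_contracts Q W m (\<lambda>n. n) x (\<lambda>n. {1..n}) lam e chat f"
proof -
  obtain \<delta>l \<delta>u where \<delta>: "0 < \<delta>l" "\<delta>l \<le> \<delta>u" "\<And>n j. j \<in> {1..n} \<Longrightarrow> \<delta>l * real n / real j powr m \<le> lam n j \<and> lam n j \<le> \<delta>u * real n / real j powr m"
    using lam unfolding polynomial_eigenvalues_def by blast
  let ?\<rho> = "\<lambda>n j. real n / real j powr m"
  have N: "filterlim (\<lambda>n. n) at_top sequentially" by (rule filterlim_ident)
  show ?thesis
  proof (rule contraction_of_counting[OF gp eb N \<delta>(1), where \<rho>="?\<rho>" and \<delta>u=\<delta>u and C="tail_const m" and \<kappa>="1 / 2" and g="1 / m"])
    show "0 \<le> tail_const m" using tail_const_ge_1[OF m] by simp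
    show "\<forall>\<^sub>F n in sequentially. \<forall>j\<in>{1..n}. 0 \<le> ?\<rho> n j \<and> \<delta>l * ?\<rho> n j \<le> lam n j \<and> lam n j \<le> \<delta>u * ?\<rho> n j"
      using \<delta>(3) by (intro always_eventually allI ballI) simp
    show "\<forall>\<^sub>F n in sequentially. \<forall>c\<in>c_interval m n.
       (\<Sum>j\<in>{1..n}. min 1 (c * ?\<rho> n j)) \<le> tail_const m * card {j \<in> {1..n}. 1 \<le> c * ?\<rho> n j} \<and>
       1 / 2 * (c * real n) powr (1 / m) \<le> card {j \<in> {1..n}. 1 \<le> c * ?\<rho> n j}"
      using eventually_ln_ge[OF N, of "2 powr m"]
    proof eventually_elim
      case (elim n)
      show ?case
      proof
        fix c assume c: "c \<in> c_interval m n"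
        define T where "T = (c * real n) powr (1 / m)"
        note T = interval_scale[OF m c elim, folded T_def]
        have r: "c * ?\<rho> n j = (T / real j) powr m" for j
          using T by (simp add: powr_divide)
        have s: "{j \<in> {1..n}. 1 \<le> c * ?\<rho> n j} = {j \<in> {1..n}. real j \<le> T}"
          unfolding r using T(1) m by (intro Collect_cong conj_cong refl) (auto simp: one_le_powr_iff le_divide_eq_1)
        show "(\<Sum>j\<in>{1..n}. min 1 (c * ?\<rho> n j)) \<le> tail_const m * card {j \<in> {1..n}. 1 \<le> c * ?\<rho> n j} \<and>
            1 / 2 * (c * real n) powr (1 / m) \<le> card {j \<in> {1..n}. 1 \<le> c * ?\<rho> n j}"
          unfolding s unfolding r T_def[symmetric]
          using sum_min_powr_large[OF m, of T n] card_le_ge_half[of T n] T by simp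
      qed
    qed
  qed (use m in auto)
qed

lemma unif_asymp_bounds:
  assumes "unif_asymp S a b" and "\<And>n s. s \<in> S n \<Longrightarrow> 0 < b n s"
  shows "\<exists>l>0. \<exists>u. \<forall>\<^sub>F n in sequentially. \<forall>s\<in>S n. 0 \<le> b n s \<and> l * b n s \<le> a n s \<and> a n s \<le> u * b n s"
proof -
  obtain l u where l: "l > 0" "\<forall>\<^sub>F n in sequentially. \<forall>s\<in>S n. l \<le> a n s / b n s \<and> a n s / b n s \<le> u"
    using assms(1) unfolding unif_asymp_def by blast
  have "\<forall>\<^sub>F n in sequentially. \<forall>s\<in>S n. 0 \<le> b n s \<and> l * b n s \<le> a n s \<and> a n s \<le> u * b n s"
    using l(2) by eventually_elim (use assms(2) in \<open>auto simp: pos_le_divide_eq pos_divide_le_eq less_imp_le\<close>)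
  then show ?thesis using l(1) by blast
qed

section \<open>Doubly indexed eigenvalues\<close>

lemma filterlim_square: "filterlim (\<lambda>n::nat. n\<^sup>2) at_top sequentially"
  by (rule filterlim_at_top_mono[OF filterlim_ident]) (simp add: power2_nat_le_imp_le power2_eq_square le_square)

text \<open>Row \<open>i\<close> is the one-dimensional problem at level T / i. Rows with i \<le> T
  are paid by their own counts \<open>k i\<close>. Rows with i > T cost a multiple of (T / i)^m,
  again a one-dimensional sum, bounded by the number of i \<le> T; this is at most \<open>K\<close>
  since each such row contains j = 1.\<close>

lemma product_counting:
  assumes m: "1 < m" and T: "1 \<le> T" "T \<le> (real n)\<^sup>2"
  defines "K \<equiv> card {p \<in> {1..n} \<times> {1..n}. real (fst p) * real (snd p) \<le> T}"
  shows "(\<Sum>i=1..n. \<Sum>j=1..n. min 1 ((T / real i / real j) powr m)) \<le> (tail_const m + (tail_const m)\<^sup>2) * K"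
    "1 / 2 * sqrt T \<le> K"
proof -
  define k where "k i = card {j \<in> {1..n}. real j \<le> T / real i}" for i :: nat
  have "{p \<in> {1..n} \<times> {1..n}. real (fst p) * real (snd p) \<le> T} = (SIGMA i:{1..n}. {j \<in> {1..n}. real j \<le> T / real i})"
    by (auto simp: pos_le_divide_eq mult.commute)
  then have K: "K = (\<Sum>i=1..n. k i)" unfolding K_def k_def by (simp add: card_SigmaI)
  let ?I = "{i \<in> {1..n}. real i \<le> T}"
  have "card ?I = (\<Sum>i\<in>?I. 1)" by simp
  also have "\<dots> \<le> (\<Sum>i\<in>?I. k i)"
  proof (rule sum_mono)
    fix i assume i: "i \<in> ?I"
    then have "1 \<in> {j \<in> {1..n}. real j \<le> T / real i}" by (auto simp: le_divide_eq)
    then have "0 < k i" unfolding k_def card_gt_0_iff by (intro conjI) auto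
    then show "1 \<le> k i" by simp
  qed
  also have "\<dots> \<le> K" unfolding K by (rule sum_mono2) auto
  finally have IK: "card ?I \<le> K" .
  have tc: "1 \<le> tail_const m" by (rule tail_const_ge_1[OF m])
  have row: "(\<Sum>j=1..n. min 1 ((T / real i / real j) powr m)) \<le> tail_const m * real (k i) + tail_const m * min 1 ((T / real i) powr m)"
    if i: "i \<in> {1..n}" for i
  proof (cases "real i \<le> T")
    case True
    then have "1 \<le> T / real i" using i by (auto simp: le_divide_eq)
    from sum_min_powr_large[OF m this, of n] have "(\<Sum>j=1..n. min 1 ((T / real i / real j) powr m)) \<le> tail_const m * real (k i)"
      unfolding k_def .
    moreover have "0 \<le> tail_const m * min 1 ((T / real i) powr m)" using tc by simp
    ultimately show ?thesis by linarith
  next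
    case False
    then have "(T / real i) powr m \<le> 1" using T i m by (intro powr_le1) auto
    moreover have "(\<Sum>j=1..n. min 1 ((T / real i / real j) powr m)) \<le> tail_const m * (T / real i) powr m"
      using T by (intro sum_min_powr_small m) auto
    moreover have "0 \<le> tail_const m * real (k i)" using tc by simp
    ultimately show ?thesis by (simp add: min_def)
  qed
  have "(\<Sum>i=1..n. \<Sum>j=1..n. min 1 ((T / real i / real j) powr m))
     \<le> (\<Sum>i=1..n. tail_const m * real (k i) + tail_const m * min 1 ((T / real i) powr m))"
    by (intro sum_mono row)
  also have "\<dots> = tail_const m * K + tail_const m * (\<Sum>i=1..n. min 1 ((T / real i) powr m))"
    unfolding K by (simp add: sum.distrib sum_distrib_left)
  also have "\<dots> \<le> tail_const m * K + tail_const m * (tail_const m * K)"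
  proof (intro add_left_mono mult_left_mono)
    have "(\<Sum>i=1..n. min 1 ((T / real i) powr m)) \<le> tail_const m * card ?I" by (rule sum_min_powr_large[OF m T(1)])
    also have "\<dots> \<le> tail_const m * K" using IK tc by (intro mult_left_mono) auto
    finally show "(\<Sum>i=1..n. min 1 ((T / real i) powr m)) \<le> tail_const m * K" .
  qed (use tc in auto)
  finally show "(\<Sum>i=1..n. \<Sum>j=1..n. min 1 ((T / real i / real j) powr m)) \<le> (tail_const m + (tail_const m)\<^sup>2) * K"
    by (simp add: power2_eq_square algebra_simps)
  \<comment> \<open>\<open>T\<close> itself may exceed \<open>n\<close>; only its root is guaranteed
    to stay in the index range, so the lower bound counts the pairs (i, 1) with i \<le> sqrt
    T.\<close>
  have "sqrt T \<le> real n" using T(2) by (simp add: real_le_lsqrt)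
  then have "sqrt T / 2 \<le> card {i \<in> {1..n}. real i \<le> sqrt T}" using T by (intro card_le_ge_half) auto
  also have "card {i \<in> {1..n}. real i \<le> sqrt T} \<le> card ?I"
  proof (intro card_mono)
    have "sqrt T * 1 \<le> sqrt T * sqrt T" using T(1) by (intro mult_left_mono) auto
    then have "sqrt T \<le> T" using T by simp
    then show "{i \<in> {1..n}. real i \<le> sqrt T} \<subseteq> ?I" by auto
  qed simp
  finally show "1 / 2 * sqrt T \<le> K" using IK by linarith
qed

text \<open>Decouples a double sum into a product. If u and v are both at most 1 the bound w \<le> u
  v is used; if just one of them is, say u, then w \<le> u^2 \<le> u.\<close>

lemma min_one_powr_le_prod:
  fixes u v w m :: real
  assumes "0 < m" "0 < u" "0 < v" "0 < w" "w \<le> u * v" "w \<le> u\<^sup>2" "w \<le> v\<^sup>2"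
  shows "min 1 (w powr m) \<le> min 1 (u powr m) * min 1 (v powr m)"
proof -
  have sq: "w powr m \<le> t powr m" if "0 < t" "t \<le> 1" "w \<le> t\<^sup>2" for t
  proof -
    have "t\<^sup>2 \<le> t" using that by (simp add: power2_eq_square mult_left_le_one_le)
    then show ?thesis using that assms by (intro powr_mono2) auto
  qed
  have "w powr m \<le> (u * v) powr m" using assms by (intro powr_mono2) auto
  also have "\<dots> = u powr m * v powr m" using assms by (simp add: powr_mult)
  finally have uv: "w powr m \<le> u powr m * v powr m" .
  have big: "1 \<le> t powr m" if "1 < t" for t using that assms by (simp add: ge_one_powr_ge_zero)
  have small: "t powr m \<le> 1" if "0 < t" "t \<le> 1" for t using that assms by (intro powr_le1) auto
  consider "u \<le> 1" "v \<le> 1" | "u \<le> 1" "1 < v" | "1 < u" "v \<le> 1" | "1 < u" "1 < v" by linarith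
  then show ?thesis
  proof cases
    case 1
    then have "min 1 (u powr m) = u powr m" "min 1 (v powr m) = v powr m"
      using small assms by (simp_all add: min.absorb2)
    then show ?thesis using uv by simp
  next
    case 2 then show ?thesis using sq[of u] small[of u] big[of v] assms by (auto simp: min_def)
  next
    case 3 then show ?thesis using sq[of v] small[of v] big[of u] assms by (auto simp: min_def)
  next
    case 4 then show ?thesis using big[of u] big[of v] by (auto simp: min_def)
  qed
qed

text \<open>Above: decoupling with S = sqrt T bounds the sum by the square of a one-dimensional sum
  of order S, hence by a multiple of T. Below: the disc of radius S contains the square of side R =
  sqrt (T / 2), with at least (R / 2)^2 = T / 8 points; T \<ge> 2 ensures R \<ge> 1.\<close>

lemma sobolev_counting:
  assumes m: "1 < m" and T: "2 \<le> T" "T \<le> (real n)\<^sup>2"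
  defines "K \<equiv> card {p \<in> {1..n} \<times> {1..n}. (real (fst p))\<^sup>2 + (real (snd p))\<^sup>2 \<le> T}"
  shows "(\<Sum>i=1..n. \<Sum>j=1..n. min 1 ((T / ((real i)\<^sup>2 + (real j)\<^sup>2)) powr m)) \<le> 8 * (tail_const m)\<^sup>2 * K"
    "1 / 8 * T \<le> K"
proof -
  define S where "S = sqrt T"
  have S: "1 \<le> S" "S\<^sup>2 = T" unfolding S_def using T by auto
  define R where "R = sqrt (T / 2)"
  have R: "1 \<le> R" "R\<^sup>2 = T / 2" unfolding R_def using T by auto
  have Rn: "R \<le> real n" unfolding R_def using T by (intro real_le_lsqrt) auto
  let ?I = "{i \<in> {1..n}. real i \<le> R}"
  have "?I \<times> ?I \<subseteq> {p \<in> {1..n} \<times> {1..n}. (real (fst p))\<^sup>2 + (real (snd p))\<^sup>2 \<le> T}"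
  proof
    fix p assume p: "p \<in> ?I \<times> ?I"
    then have "(real (fst p))\<^sup>2 \<le> R\<^sup>2" "(real (snd p))\<^sup>2 \<le> R\<^sup>2" by (auto intro: power_mono)
    then show "p \<in> {p \<in> {1..n} \<times> {1..n}. (real (fst p))\<^sup>2 + (real (snd p))\<^sup>2 \<le> T}" using p R by auto
  qed
  then have "card (?I \<times> ?I) \<le> K" unfolding K_def by (intro card_mono) auto
  then have KI: "(real (card ?I))\<^sup>2 \<le> real K" by (simp add: card_cartesian_product power2_eq_square flip: of_nat_mult)
  have "R / 2 \<le> card ?I" using R Rn by (intro card_le_ge_half) auto
  then have "(R / 2)\<^sup>2 \<le> (real (card ?I))\<^sup>2" using R by (intro power_mono) auto
  moreover have "(R / 2)\<^sup>2 = 1 / 8 * T" by (simp add: power_divide R(2))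
  ultimately show lower: "1 / 8 * T \<le> K" using KI by linarith
  have "(\<Sum>i=1..n. \<Sum>j=1..n. min 1 ((T / ((real i)\<^sup>2 + (real j)\<^sup>2)) powr m))
      \<le> (\<Sum>i=1..n. \<Sum>j=1..n. min 1 ((S / real i) powr m) * min 1 ((S / real j) powr m))"
  proof (intro sum_mono min_one_powr_le_prod)
    fix i j assume ij: "i \<in> {1..n}" "j \<in> {1..n}"
    then have p: "0 < real i" "0 < real j" by auto
    have q: "0 < (real i)\<^sup>2" "0 < (real j)\<^sup>2" using p by auto
    show "0 < m" "0 < S / real i" "0 < S / real j" "0 < T / ((real i)\<^sup>2 + (real j)\<^sup>2)" using p S m T q by (auto intro!: divide_pos_pos add_pos_pos)
    have "real i * real j \<le> (real i)\<^sup>2 + (real j)\<^sup>2" using sum_squares_bound[of "real i" "real j"] p mult_pos_pos[OF p] by linarith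
    then have "T / ((real i)\<^sup>2 + (real j)\<^sup>2) \<le> T / (real i * real j)" using T p q by (intro divide_left_mono) (auto intro!: mult_pos_pos add_pos_pos)
    then show "T / ((real i)\<^sup>2 + (real j)\<^sup>2) \<le> S / real i * (S / real j)" unfolding S(2)[symmetric] by (simp add: power2_eq_square)
    have "T / ((real i)\<^sup>2 + (real j)\<^sup>2) \<le> T / (real i)\<^sup>2" using T p q by (intro divide_left_mono) (auto intro!: mult_pos_pos add_pos_pos)
    then show "T / ((real i)\<^sup>2 + (real j)\<^sup>2) \<le> (S / real i)\<^sup>2" by (simp add: power_divide S)
    have "T / ((real i)\<^sup>2 + (real j)\<^sup>2) \<le> T / (real j)\<^sup>2" using T p q by (intro divide_left_mono) (auto intro!: mult_pos_pos add_pos_pos)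
    then show "T / ((real i)\<^sup>2 + (real j)\<^sup>2) \<le> (S / real j)\<^sup>2" by (simp add: power_divide S)
  qed
  also have "\<dots> = (\<Sum>i=1..n. min 1 ((S / real i) powr m))\<^sup>2" unfolding power2_eq_square sum_product ..
  also have "\<dots> \<le> (tail_const m * S)\<^sup>2"
  proof (rule power_mono)
    have "(\<Sum>i=1..n. min 1 ((S / real i) powr m)) \<le> tail_const m * card {i \<in> {1..n}. real i \<le> S}" by (rule sum_min_powr_large[OF m S(1)])
    also have "\<dots> \<le> tail_const m * S" using card_le_le[where A=S and n=n] S tail_const_ge_1[OF m] by (intro mult_left_mono) auto
    finally show "(\<Sum>i=1..n. min 1 ((S / real i) powr m)) \<le> tail_const m * S" .
  qed (auto intro: sum_nonneg)
  also have "\<dots> = (tail_const m)\<^sup>2 * T" by (simp add: power_mult_distrib S)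
  also have "\<dots> \<le> (tail_const m)\<^sup>2 * (8 * K)" using lower by (intro mult_left_mono) auto
  finally show "(\<Sum>i=1..n. \<Sum>j=1..n. min 1 ((T / ((real i)\<^sup>2 + (real j)\<^sup>2)) powr m)) \<le> 8 * (tail_const m)\<^sup>2 * K"
    by (simp add: mult_ac)
qed

theorem contraction_product:
  assumes gp: "mean_zero_gaussian_process Q W" and m: "1 < m"
    and eb: "eb_setting Q W m (\<lambda>n. n\<^sup>2) x (\<lambda>n. {1..n} \<times> {1..n}) lam e chat" and lam: "product_eigenvalues m lam"
  shows "posterior_contracts Q W m (\<lambda>n. n\<^sup>2) x (\<lambda>n. {1..n} \<times> {1..n}) lam e chat f"
proof -
  let ?J = "\<lambda>n. {1..n} \<times> {1..n}"
  let ?\<rho> = "\<lambda>n. \<lambda>(i, j). (real n)\<^sup>2 / (real i powr m * real j powr m)"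
  have "0 < ?\<rho> n s" if "s \<in> ?J n" for n s using that by auto
  from unif_asymp_bounds[OF lam[unfolded product_eigenvalues_def] this]
  obtain \<delta>l \<delta>u where \<delta>: "0 < \<delta>l" "\<forall>\<^sub>F n in sequentially. \<forall>s\<in>?J n. 0 \<le> ?\<rho> n s \<and> \<delta>l * ?\<rho> n s \<le> lam n s \<and> lam n s \<le> \<delta>u * ?\<rho> n s"
    by blast
  have tc: "1 \<le> tail_const m" by (rule tail_const_ge_1[OF m])
  show ?thesis
  \<comment> \<open>The exponent \<open>g\<close> is half of 1 / m because
    \<open>product_counting\<close> bounds the count from below by sqrt T only.\<close>
  proof (rule contraction_of_counting[OF gp eb filterlim_square \<delta>(1) _ _ _ \<delta>(2), where C="tail_const m + (tail_const m)\<^sup>2" and \<kappa>="1 / 2" and g="1 / (2 * m)"])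
    show "\<forall>\<^sub>F n in sequentially. \<forall>c\<in>c_interval m (n\<^sup>2).
       (\<Sum>s\<in>?J n. min 1 (c * ?\<rho> n s)) \<le> (tail_const m + (tail_const m)\<^sup>2) * card {s \<in> ?J n. 1 \<le> c * ?\<rho> n s} \<and>
       1 / 2 * (c * real (n\<^sup>2)) powr (1 / (2 * m)) \<le> card {s \<in> ?J n. 1 \<le> c * ?\<rho> n s}"
      using eventually_ln_ge[OF filterlim_square, of "2 powr m"]
    proof eventually_elim
      case (elim n)
      show ?case
      proof
        fix c assume c: "c \<in> c_interval m (n\<^sup>2)"
        define T where "T = (c * real (n\<^sup>2)) powr (1 / m)"
        note T = interval_scale[OF m c elim, folded T_def]
        have T': "1 \<le> T" "T \<le> (real n)\<^sup>2" using T by auto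
        have r: "c * ?\<rho> n (i, j) = (T / real i / real j) powr m" for i j
          using T by (simp add: powr_divide powr_mult)
        have s: "{s \<in> ?J n. 1 \<le> c * ?\<rho> n s} = {p \<in> ?J n. real (fst p) * real (snd p) \<le> T}"
        proof (intro Collect_cong conj_cong refl)
          fix s assume s: "s \<in> ?J n"
          obtain i j where ij: "s = (i, j)" by (cases s)
          have p: "0 < real i" "0 < real j" using s unfolding ij by auto
          have "1 \<le> c * ?\<rho> n s \<longleftrightarrow> 1 \<le> T / real i / real j"
            unfolding ij r using p m T(1) by (intro one_le_powr_iff) auto
          also have "\<dots> \<longleftrightarrow> real (fst s) * real (snd s) \<le> T" unfolding ij using p by (simp add: pos_le_divide_eq mult.commute)
          finally show "1 \<le> c * ?\<rho> n s \<longleftrightarrow> real (fst s) * real (snd s) \<le> T" .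
        qed
        have sm: "(\<Sum>s\<in>?J n. min 1 (c * ?\<rho> n s)) = (\<Sum>i=1..n. \<Sum>j=1..n. min 1 ((T / real i / real j) powr m))"
          unfolding sum.cartesian_product r[symmetric] by (intro sum.cong[OF refl]) auto
        have "sqrt T = (c * real (n\<^sup>2)) powr (1 / (2 * m))"
          using T(1) by (simp add: powr_half_sqrt[symmetric]) (simp add: T_def powr_powr mult.commute)
        then show "(\<Sum>s\<in>?J n. min 1 (c * ?\<rho> n s)) \<le> (tail_const m + (tail_const m)\<^sup>2) * card {s \<in> ?J n. 1 \<le> c * ?\<rho> n s} \<and>
            1 / 2 * (c * real (n\<^sup>2)) powr (1 / (2 * m)) \<le> card {s \<in> ?J n. 1 \<le> c * ?\<rho> n s}"
          unfolding s sm using product_counting[OF m T'] by metis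
      qed
    qed
  qed (use m tc in auto)
qed

theorem contraction_sobolev:
  assumes gp: "mean_zero_gaussian_process Q W" and m: "1 < m"
    and eb: "eb_setting Q W m (\<lambda>n. n\<^sup>2) x (\<lambda>n. {1..n} \<times> {1..n}) lam e chat" and lam: "sobolev_eigenvalues m lam"
  shows "posterior_contracts Q W m (\<lambda>n. n\<^sup>2) x (\<lambda>n. {1..n} \<times> {1..n}) lam e chat f"
proof -
  let ?J = "\<lambda>n. {1..n} \<times> {1..n}"
  let ?\<rho> = "\<lambda>n. \<lambda>(i, j). (real n)\<^sup>2 / ((real i)\<^sup>2 + (real j)\<^sup>2) powr m"
  have q: "0 < (real i)\<^sup>2 + (real j)\<^sup>2" if "1 \<le> i" for i j :: nat using that by (intro add_pos_nonneg) auto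
  have "0 < ?\<rho> n s" if "s \<in> ?J n" for n s using that q by (auto simp: less_imp_neq[OF q, symmetric])
  from unif_asymp_bounds[OF lam[unfolded sobolev_eigenvalues_def] this]
  obtain \<delta>l \<delta>u where \<delta>: "0 < \<delta>l" "\<forall>\<^sub>F n in sequentially. \<forall>s\<in>?J n. 0 \<le> ?\<rho> n s \<and> \<delta>l * ?\<rho> n s \<le> lam n s \<and> lam n s \<le> \<delta>u * ?\<rho> n s"
    by blast
  have tc: "1 \<le> tail_const m" by (rule tail_const_ge_1[OF m])
  show ?thesis
  proof (rule contraction_of_counting[OF gp eb filterlim_square \<delta>(1) _ _ _ \<delta>(2), where C="8 * (tail_const m)\<^sup>2" and \<kappa>="1 / 8" and g="1 / m"])
    show "\<forall>\<^sub>F n in sequentially. \<forall>c\<in>c_interval m (n\<^sup>2).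
       (\<Sum>s\<in>?J n. min 1 (c * ?\<rho> n s)) \<le> 8 * (tail_const m)\<^sup>2 * card {s \<in> ?J n. 1 \<le> c * ?\<rho> n s} \<and>
       1 / 8 * (c * real (n\<^sup>2)) powr (1 / m) \<le> card {s \<in> ?J n. 1 \<le> c * ?\<rho> n s}"
      using eventually_ln_ge[OF filterlim_square, of "2 powr m"]
    proof eventually_elim
      case (elim n)
      show ?case
      proof
        fix c assume c: "c \<in> c_interval m (n\<^sup>2)"
        define T where "T = (c * real (n\<^sup>2)) powr (1 / m)"
        note T = interval_scale[OF m c elim, folded T_def]
        have T': "T \<le> (real n)\<^sup>2" using T by auto
        have r: "c * ?\<rho> n (i, j) = (T / ((real i)\<^sup>2 + (real j)\<^sup>2)) powr m" for i j
          using T by (simp add: powr_divide)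
        have s: "{s \<in> ?J n. 1 \<le> c * ?\<rho> n s} = {p \<in> ?J n. (real (fst p))\<^sup>2 + (real (snd p))\<^sup>2 \<le> T}"
        proof (intro Collect_cong conj_cong refl)
          fix s assume s: "s \<in> ?J n"
          obtain i j where ij: "s = (i, j)" by (cases s)
          have p: "0 < (real i)\<^sup>2 + (real j)\<^sup>2" using s unfolding ij by (intro q) auto
          have "1 \<le> c * ?\<rho> n s \<longleftrightarrow> 1 \<le> T / ((real i)\<^sup>2 + (real j)\<^sup>2)"
            unfolding ij r using p m T(1) by (intro one_le_powr_iff) auto
          also have "\<dots> \<longleftrightarrow> (real (fst s))\<^sup>2 + (real (snd s))\<^sup>2 \<le> T" unfolding ij using p by (simp add: pos_le_divide_eq)
          finally show "1 \<le> c * ?\<rho> n s \<longleftrightarrow> (real (fst s))\<^sup>2 + (real (snd s))\<^sup>2 \<le> T" .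
        qed
        have sm: "(\<Sum>s\<in>?J n. min 1 (c * ?\<rho> n s)) = (\<Sum>i=1..n. \<Sum>j=1..n. min 1 ((T / ((real i)\<^sup>2 + (real j)\<^sup>2)) powr m))"
          unfolding sum.cartesian_product r[symmetric] by (intro sum.cong[OF refl]) auto
        show "(\<Sum>s\<in>?J n. min 1 (c * ?\<rho> n s)) \<le> 8 * (tail_const m)\<^sup>2 * card {s \<in> ?J n. 1 \<le> c * ?\<rho> n s} \<and>
            1 / 8 * (c * real (n\<^sup>2)) powr (1 / m) \<le> card {s \<in> ?J n. 1 \<le> c * ?\<rho> n s}"
          unfolding s sm T_def[symmetric] using sobolev_counting[OF m T(1) T'] by metis
      qed
    qed
  qed (use m tc in auto)
qed

theorem theorem21:
  fixes Q :: "'w measure" and W :: "'a \<Rightarrow> 'w \<Rightarrow> real" and f :: "'a \<Rightarrow> real" and m :: real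
  assumes "mean_zero_gaussian_process Q W" and "m \<ge> 1"
  shows
    "(\<forall>x lam e chat.
        eb_setting Q W m (\<lambda>n. n) x (\<lambda>n. {1..n}) lam e chat \<longrightarrow>
        remainders_negligible m (\<lambda>n. n) x (\<lambda>n. {1..n}) lam e f \<longrightarrow>
        unif_asymp (c_interval m) (\<lambda>n. D2L {1..n} (lam n)) (\<lambda>n. s2 {1..n} (lam n)) \<longrightarrow>
        posterior_contracts Q W m (\<lambda>n. n) x (\<lambda>n. {1..n}) lam e chat f)
     \<and>
     (m > 1 \<longrightarrow>
       (\<forall>x lam e chat.
          eb_setting Q W m (\<lambda>n. n) x (\<lambda>n. {1..n}) lam e chat \<longrightarrow>
          polynomial_eigenvalues m lam \<longrightarrow>
          posterior_contracts Q W m (\<lambda>n. n) x (\<lambda>n. {1..n}) lam e chat f) \<and>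
       (\<forall>x lam e chat.
          eb_setting Q W m (\<lambda>n. n\<^sup>2) x (\<lambda>n. {1..n} \<times> {1..n}) lam e chat \<longrightarrow>
          product_eigenvalues m lam \<or> sobolev_eigenvalues m lam \<longrightarrow>
          posterior_contracts Q W m (\<lambda>n. n\<^sup>2) x (\<lambda>n. {1..n} \<times> {1..n}) lam e chat f))"
proof (intro conjI impI allI)
  fix x :: "nat \<Rightarrow> nat \<Rightarrow> 'a" and lam :: "nat \<Rightarrow> nat \<Rightarrow> real" and e :: "nat \<Rightarrow> nat \<Rightarrow> real Matrix.vec" and chat
  assume eb: "eb_setting Q W m (\<lambda>n. n) x (\<lambda>n. {1..n}) lam e chat"
  show "posterior_contracts Q W m (\<lambda>n. n) x (\<lambda>n. {1..n}) lam e chat f"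
    if "remainders_negligible m (\<lambda>n. n) x (\<lambda>n. {1..n}) lam e f"
      "unif_asymp (c_interval m) (\<lambda>n. D2L {1..n} (lam n)) (\<lambda>n. s2 {1..n} (lam n))"
    using contraction_of_negligible_remainders[OF assms(1) eb that(1)] that(2) by simp
  show "posterior_contracts Q W m (\<lambda>n. n) x (\<lambda>n. {1..n}) lam e chat f"
    if "m > 1" "polynomial_eigenvalues m lam"
    using contraction_polynomial[OF assms(1) that(1) eb that(2)] .
next
  fix x :: "nat \<Rightarrow> nat \<Rightarrow> 'a" and lam :: "nat \<Rightarrow> nat \<times> nat \<Rightarrow> real" and e :: "nat \<Rightarrow> nat \<times> nat \<Rightarrow> real Matrix.vec" and chat
  assume "m > 1" and eb: "eb_setting Q W m (\<lambda>n. n\<^sup>2) x (\<lambda>n. {1..n} \<times> {1..n}) lam e chat"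
    and "product_eigenvalues m lam \<or> sobolev_eigenvalues m lam"
  then show "posterior_contracts Q W m (\<lambda>n. n\<^sup>2) x (\<lambda>n. {1..n} \<times> {1..n}) lam e chat f"
    using contraction_product[OF assms(1) _ eb] contraction_sobolev[OF assms(1) _ eb] by blast
qed

end
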